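(* Let $F$ be a free group of finite rank $k\ge 5$. Then there exists no continuous $Out(F)$-equivariant map $\partial CV(F)\to \mathbb{P}Curr(F)$. Similarly, there is no continuous $Out(F)$-anti-equivariant map $\partial CV(F)\to \mathbb{P}Curr(F)$.
   Context: Currents. $\partial F$ is the hyperbolic (Gromov) boundary of $F$, and $\partial^2F=\{(\zeta,\xi): \zeta,\xi\in\partial F,\ \zeta\neq\xi\}$, with flip map $\sigma(\zeta,\xi)=(\xi,\zeta)$. A geodesic current on $F$ is a positive Radon measure on $\partial^2F$ that is $F$-invariant and $\sigma$-invariant. $Curr(F)$ is the space of all geodesic currents with the weak topology: $\nu_n\to\nu$ iff $\nu_n(S\times S')\to\nu(S\times S')$ for all disjoint closed-open $S,S'\subseteq\partial F$. $\mathbb{P}Curr(F)$ is the set of non-zero currents modulo multiplication by non-zero (necessarily positive) scalars, with the quotient topology; the class of $\nu$ is $[\nu]$. An automorphism $\phi\in Aut(F)$ induces a homeomorphism $\hat\phi$ of $\partial^2F$, and $(\phi\nu)(S)=\nu(\hat\phi^{-1}(S))$; this induces a continuous left action of $Out(F)$ on $\mathbb{P}Curr(F)$. Outer space. $cv(F)$ is the space of $\mathbb{R}$-trees $T$ with a minimal, free and discrete isometric action of $F$, up to $F$-equivariant isometry, identified with the set of their translation length functions $\|\cdot\|_T\in\mathbb{R}^F$ (topology of pointwise convergence). $CV(F)=\mathbb{P}cv(F)\subset\mathbb{P}\mathbb{R}^F=(\mathbb{R}^F\setminus\{0\})/\text{scaling}$ is its projectivization, $\overline{CV(F)}$ is its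 (compact) closure in $\mathbb{P}\mathbb{R}^F$, and $\partial CV(F)=\overline{CV(F)}\setminus CV(F)$. $Out(F)$ acts on the left by homeomorphisms via $\|w\|_{\phi T}=\|\phi^{-1}(w)\|_T$. A map $\tau:X\to Z$ between spaces with left $Out(F)$-actions is equivariant if $\tau(\phi x)=\phi\,\tau(x)$, and anti-equivariant if $\tau(\phi x)=\phi^{-1}\tau(x)$, for all $\phi\in Out(F)$ and $x\in X$. *)

theory Defs
  imports "HOL-Analysis.Analysis" "HOL-Algebra.Group_Action" "HOL-Algebra.Bij"
begin

section \<open>Free groups and outer automorphisms\<close>

text \<open>A word is a list of signed letters: \<^term>\<open>(x, True)\<close> stands for the letter \<^term>\<open>x\<close> and
  \<^term>\<open>(x, False)\<close> for its inverse.\<close>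

definition reduced_word :: "('a \<times> bool) list \<Rightarrow> bool" where
  "reduced_word w \<longleftrightarrow> successively (\<lambda>(x, b) (y, c). \<not> (x = y \<and> b \<noteq> c)) w"

definition word_value :: "('a, 'b) monoid_scheme \<Rightarrow> ('a \<times> bool) list \<Rightarrow> 'a" where
  "word_value F w = foldr (\<lambda>(x, b) g. (if b then x else inv\<^bsub>F\<^esub> x) \<otimes>\<^bsub>F\<^esub> g) w \<one>\<^bsub>F\<^esub>"

definition free_basis :: "('a, 'b) monoid_scheme \<Rightarrow> 'a set \<Rightarrow> bool" where
  "free_basis F X \<longleftrightarrow> group F \<and> X \<subseteq> carrier F \<and>
     bij_betw (word_value F) {w. fst ` set w \<subseteq> X \<and> reduced_word w} (carrier F)"

definition inner_auts :: "('a, 'b) monoid_scheme \<Rightarrow> ('a \<Rightarrow> 'a) set" where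
  "inner_auts F = {\<lambda>x\<in>carrier F. g \<otimes>\<^bsub>F\<^esub> x \<otimes>\<^bsub>F\<^esub> inv\<^bsub>F\<^esub> g | g. g \<in> carrier F}"

definition Out :: "('a, 'b) monoid_scheme \<Rightarrow> ('a \<Rightarrow> 'a) set monoid" where
  "Out F = AutoGroup F Mod inner_auts F"

text \<open>Both projectivized spaces below consist of classes (sets) of objects on which automorphisms
  act.  An outer automorphism \<^term>\<open>\<Phi>\<close>, being a coset of automorphisms, acts on such a class by
  letting all its representatives act on all members.  Inner automorphisms act trivially on
  currents and on length functions, so the result is the class of \<^term>\<open>act \<phi> c\<close> for any
  \<^term>\<open>\<phi> \<in> \<Phi>\<close> and \<^term>\<open>c \<in> C\<close>.\<close>

definition out_act :: "(('a \<Rightarrow> 'a) \<Rightarrow> 'c \<Rightarrow> 'c) \<Rightarrow> ('a \<Rightarrow> 'a) set \<Rightarrow> 'c set \<Rightarrow> 'c set" where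
  "out_act act \<Phi> C = {act \<phi> c | \<phi> c. \<phi> \<in> \<Phi> \<and> c \<in> C}"

definition equivariant_on ::
  "('g, 'b) monoid_scheme \<Rightarrow> 'x set \<Rightarrow> ('g \<Rightarrow> 'x \<Rightarrow> 'x) \<Rightarrow> ('g \<Rightarrow> 'z \<Rightarrow> 'z) \<Rightarrow> ('x \<Rightarrow> 'z) \<Rightarrow> bool" where
  "equivariant_on G A actX actZ \<tau> \<longleftrightarrow>
     (\<forall>\<phi>\<in>carrier G. \<forall>x\<in>A. \<tau> (actX \<phi> x) = actZ \<phi> (\<tau> x))"

definition anti_equivariant_on ::
  "('g, 'b) monoid_scheme \<Rightarrow> 'x set \<Rightarrow> ('g \<Rightarrow> 'x \<Rightarrow> 'x) \<Rightarrow> ('g \<Rightarrow> 'z \<Rightarrow> 'z) \<Rightarrow> ('x \<Rightarrow> 'z) \<Rightarrow> bool" where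
  "anti_equivariant_on G A actX actZ \<tau> \<longleftrightarrow>
     (\<forall>\<phi>\<in>carrier G. \<forall>x\<in>A. \<tau> (actX \<phi> x) = actZ (inv\<^bsub>G\<^esub> \<phi>) (\<tau> x))"


section \<open>Topological and measure-theoretic preliminaries\<close>

definition quotient_topology :: "'a topology \<Rightarrow> ('a \<Rightarrow> 'b) \<Rightarrow> 'b topology" where
  "quotient_topology T p =
     topology (\<lambda>U. U \<subseteq> p ` topspace T \<and> openin T {x \<in> topspace T. p x \<in> U})"

lemma openin_quotient_topology:
  "openin (quotient_topology T p) U \<longleftrightarrow>
     U \<subseteq> p ` topspace T \<and> openin T {x \<in> topspace T. p x \<in> U}"
proof -
  have "istopology (\<lambda>U. U \<subseteq> p ` topspace T \<and> openin T {x \<in> topspace T. p x \<in> U})"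
  proof (unfold istopology_def, intro conjI allI impI; (elim conjE)?)
    fix S U
    assume "openin T {x \<in> topspace T. p x \<in> S}" "openin T {x \<in> topspace T. p x \<in> U}"
    then have "openin T ({x \<in> topspace T. p x \<in> S} \<inter> {x \<in> topspace T. p x \<in> U})"
      by (rule openin_Int)
    moreover have "{x \<in> topspace T. p x \<in> S} \<inter> {x \<in> topspace T. p x \<in> U} =
        {x \<in> topspace T. p x \<in> S \<inter> U}" by auto
    ultimately show "openin T {x \<in> topspace T. p x \<in> S \<inter> U}" by simp
  next
    fix \<K> assume "\<forall>K\<in>\<K>. K \<subseteq> p ` topspace T \<and> openin T {x \<in> topspace T. p x \<in> K}"
    then have "openin T (\<Union>K\<in>\<K>. {x \<in> topspace T. p x \<in> K})" by blast
    moreover have "(\<Union>K\<in>\<K>. {x \<in> topspace T. p x \<in> K}) = {x \<in> topspace T. p x \<in> \<Union>\<K>}" by auto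
    ultimately show "openin T {x \<in> topspace T. p x \<in> \<Union>\<K>}" by simp
  qed blast+
  then show ?thesis
    by (simp add: quotient_topology_def topology_inverse')
qed

lemma topspace_quotient_topology [simp]:
  "topspace (quotient_topology T p) = p ` topspace T"
proof -
  have "{x \<in> topspace T. p x \<in> p ` topspace T} = topspace T" by blast
  then have "openin (quotient_topology T p) (p ` topspace T)"
    by (simp add: openin_quotient_topology)
  then show ?thesis
    by (meson openin_quotient_topology openin_subset openin_topspace subset_antisym)
qed

lemma quotient_map_quotient_topology: "quotient_map T (quotient_topology T p) p"
  by (auto simp: quotient_map_def openin_quotient_topology)

definition borel_of :: "'a topology \<Rightarrow> 'a measure" where
  "borel_of T = sigma (topspace T) {U. openin T U}"

definition radon_measure :: "'a topology \<Rightarrow> 'a measure \<Rightarrow> bool" where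
  "radon_measure T \<mu> \<longleftrightarrow>
     sets \<mu> = sets (borel_of T) \<and>
     (\<forall>K. compactin T K \<longrightarrow> emeasure \<mu> K < \<infinity>) \<and>
     (\<forall>A\<in>sets \<mu>. emeasure \<mu> A = (SUP K\<in>{K. compactin T K \<and> K \<in> sets \<mu> \<and> K \<subseteq> A}. emeasure \<mu> K))"


section \<open>The Gromov boundary\<close>

definition gromov_product :: "('a \<Rightarrow> 'a \<Rightarrow> real) \<Rightarrow> 'a \<Rightarrow> 'a \<Rightarrow> 'a \<Rightarrow> real" where
  "gromov_product d e x y = (d x e + d y e - d x y) / 2"

definition gromov_seqs :: "'a set \<Rightarrow> ('a \<Rightarrow> 'a \<Rightarrow> real) \<Rightarrow> 'a \<Rightarrow> (nat \<Rightarrow> 'a) set" where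
  "gromov_seqs M d e = {u. range u \<subseteq> M \<and>
     filterlim (\<lambda>(i, j). gromov_product d e (u i) (u j)) at_top (sequentially \<times>\<^sub>F sequentially)}"

definition gromov_rel :: "'a set \<Rightarrow> ('a \<Rightarrow> 'a \<Rightarrow> real) \<Rightarrow> 'a \<Rightarrow> ((nat \<Rightarrow> 'a) \<times> (nat \<Rightarrow> 'a)) set" where
  "gromov_rel M d e = {(u, v). u \<in> gromov_seqs M d e \<and> v \<in> gromov_seqs M d e \<and>
     filterlim (\<lambda>(i, j). gromov_product d e (u i) (v j)) at_top (sequentially \<times>\<^sub>F sequentially)}"

definition gromov_boundary :: "'a set \<Rightarrow> ('a \<Rightarrow> 'a \<Rightarrow> real) \<Rightarrow> 'a \<Rightarrow> (nat \<Rightarrow> 'a) set set" where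
  "gromov_boundary M d e = gromov_seqs M d e // gromov_rel M d e"

definition boundary_product ::
  "('a \<Rightarrow> 'a \<Rightarrow> real) \<Rightarrow> 'a \<Rightarrow> (nat \<Rightarrow> 'a) set \<Rightarrow> (nat \<Rightarrow> 'a) set \<Rightarrow> ereal" where
  "boundary_product d e \<zeta> \<xi> = (SUP (u, v)\<in>\<zeta> \<times> \<xi>.
     Liminf (sequentially \<times>\<^sub>F sequentially) (\<lambda>(i, j). ereal (gromov_product d e (u i) (v j))))"

definition gromov_topology :: "'a set \<Rightarrow> ('a \<Rightarrow> 'a \<Rightarrow> real) \<Rightarrow> 'a \<Rightarrow> (nat \<Rightarrow> 'a) set topology" where
  "gromov_topology M d e = topology (\<lambda>U. U \<subseteq> gromov_boundary M d e \<and>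
     (\<forall>\<zeta>\<in>U. \<exists>r::real. {\<xi> \<in> gromov_boundary M d e. boundary_product d e \<zeta> \<xi> > ereal r} \<subseteq> U))"

lemma openin_gromov_topology:
  "openin (gromov_topology M d e) U \<longleftrightarrow> U \<subseteq> gromov_boundary M d e \<and>
     (\<forall>\<zeta>\<in>U. \<exists>r::real. {\<xi> \<in> gromov_boundary M d e. boundary_product d e \<zeta> \<xi> > ereal r} \<subseteq> U)"
proof -
  let ?N = "\<lambda>\<zeta> r. {\<xi> \<in> gromov_boundary M d e. boundary_product d e \<zeta> \<xi> > ereal r}"
  have mono: "?N \<zeta> (max r s) \<subseteq> ?N \<zeta> r \<inter> ?N \<zeta> s" for \<zeta> r s
    by (auto simp: max_def split: if_splits)
      (meson ereal_less_eq(3) le_less_trans less_le_trans linear less_imp_le)+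
  have "istopology (\<lambda>U. U \<subseteq> gromov_boundary M d e \<and> (\<forall>\<zeta>\<in>U. \<exists>r. ?N \<zeta> r \<subseteq> U))"
  proof (unfold istopology_def, intro conjI allI impI ballI; (elim conjE)?)
    fix S U \<zeta>
    assume "\<forall>\<zeta>\<in>S. \<exists>r. ?N \<zeta> r \<subseteq> S" "\<forall>\<zeta>\<in>U. \<exists>r. ?N \<zeta> r \<subseteq> U" "\<zeta> \<in> S \<inter> U"
    then obtain r s where "?N \<zeta> r \<subseteq> S" "?N \<zeta> s \<subseteq> U" by (meson IntD1 IntD2)
    then have "?N \<zeta> (max r s) \<subseteq> S \<inter> U" using mono[where \<zeta>=\<zeta> and r=r and s=s] by blast
    then show "\<exists>r. ?N \<zeta> r \<subseteq> S \<inter> U" ..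
  next
    fix \<K> \<zeta>
    assume "\<forall>K\<in>\<K>. K \<subseteq> gromov_boundary M d e \<and> (\<forall>\<zeta>\<in>K. \<exists>r. ?N \<zeta> r \<subseteq> K)" "\<zeta> \<in> \<Union>\<K>"
    then obtain K r where "K \<in> \<K>" "?N \<zeta> r \<subseteq> K" by (meson UnionE)
    then show "\<exists>r. ?N \<zeta> r \<subseteq> \<Union>\<K>" by blast
  qed blast+
  then show ?thesis
    by (simp add: gromov_topology_def topology_inverse')
qed

definition word_length :: "('a, 'b) monoid_scheme \<Rightarrow> 'a set \<Rightarrow> 'a \<Rightarrow> nat" where
  "word_length F X g = (LEAST n. \<exists>w. fst ` set w \<subseteq> X \<and> length w = n \<and> word_value F w = g)"

definition word_dist :: "('a, 'b) monoid_scheme \<Rightarrow> 'a set \<Rightarrow> 'a \<Rightarrow> 'a \<Rightarrow> real" where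
  "word_dist F X g h = real (word_length F X (inv\<^bsub>F\<^esub> g \<otimes>\<^bsub>F\<^esub> h))"

text \<open>The boundary of \<^term>\<open>F\<close> is computed from the word metric of a finite basis \<^term>\<open>X\<close>.  Word
  metrics of different finite bases are bi-Lipschitz equivalent, so neither the boundary (as a
  set of equivalence classes of sequences in \<^term>\<open>F\<close>) nor its topology depends on \<^term>\<open>X\<close>.\<close>

definition bdry :: "('a, 'b) monoid_scheme \<Rightarrow> 'a set \<Rightarrow> (nat \<Rightarrow> 'a) set topology" where
  "bdry F X = gromov_topology (carrier F) (word_dist F X) \<one>\<^bsub>F\<^esub>"

definition bdry2 :: "('a, 'b) monoid_scheme \<Rightarrow> 'a set \<Rightarrow> ((nat \<Rightarrow> 'a) set \<times> (nat \<Rightarrow> 'a) set) topology" where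
  "bdry2 F X = subtopology (prod_topology (bdry F X) (bdry F X)) {(\<zeta>, \<xi>). \<zeta> \<noteq> \<xi>}"

text \<open>The map induced on \<^term>\<open>bdry2 F X\<close> by a self-map of the group; it is used for automorphisms
  and for left translations.\<close>

definition bdry2_map ::
  "('a \<Rightarrow> 'a) \<Rightarrow> (nat \<Rightarrow> 'a) set \<times> (nat \<Rightarrow> 'a) set \<Rightarrow> (nat \<Rightarrow> 'a) set \<times> (nat \<Rightarrow> 'a) set" where
  "bdry2_map f = map_prod ((`) ((\<circ>) f)) ((`) ((\<circ>) f))"


section \<open>Geodesic currents\<close>

type_synonym 'a current = "((nat \<Rightarrow> 'a) set \<times> (nat \<Rightarrow> 'a) set) measure"

definition currents :: "('a, 'b) monoid_scheme \<Rightarrow> 'a set \<Rightarrow> 'a current set" where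
  "currents F X = {\<nu>. radon_measure (bdry2 F X) \<nu> \<and>
     (\<forall>g\<in>carrier F. distr \<nu> (borel_of (bdry2 F X)) (bdry2_map (\<lambda>h. g \<otimes>\<^bsub>F\<^esub> h)) = \<nu>) \<and>
     distr \<nu> (borel_of (bdry2 F X)) prod.swap = \<nu>}"

definition clopen_pairs ::
  "('a, 'b) monoid_scheme \<Rightarrow> 'a set \<Rightarrow> ((nat \<Rightarrow> 'a) set set \<times> (nat \<Rightarrow> 'a) set set) set" where
  "clopen_pairs F X = {(S, S'). openin (bdry F X) S \<and> closedin (bdry F X) S \<and>
     openin (bdry F X) S' \<and> closedin (bdry F X) S' \<and> S \<inter> S' = {}}"

text \<open>The weak topology: the initial topology for the evaluations at products of disjoint
  closed-open sets.  Such products are compact, so \<^const>\<open>measure\<close> is the actual (finite) value.\<close>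

definition Curr :: "('a, 'b) monoid_scheme \<Rightarrow> 'a set \<Rightarrow> 'a current topology" where
  "Curr F X = pullback_topology (currents F X)
     (\<lambda>\<nu>. \<lambda>(S, S')\<in>clopen_pairs F X. measure \<nu> (S \<times> S')) (powertop_real (clopen_pairs F X))"

definition current_class :: "'a current \<Rightarrow> 'a current set" where
  "current_class \<nu> = {scale_measure (ennreal c) \<nu> | c. c > 0}"

definition PCurr :: "('a, 'b) monoid_scheme \<Rightarrow> 'a set \<Rightarrow> 'a current set topology" where
  "PCurr F X = quotient_topology
     (subtopology (Curr F X) {\<nu>. emeasure \<nu> (space \<nu>) \<noteq> 0}) current_class"

definition act_current ::
  "('a, 'b) monoid_scheme \<Rightarrow> 'a set \<Rightarrow> ('a \<Rightarrow> 'a) \<Rightarrow> 'a current \<Rightarrow> 'a current" where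
  "act_current F X \<phi> \<nu> = distr \<nu> (borel_of (bdry2 F X)) (bdry2_map \<phi>)"


section \<open>Real trees and Outer space\<close>

definition geodesic_segment :: "'p set \<Rightarrow> ('p \<Rightarrow> 'p \<Rightarrow> real) \<Rightarrow> 'p \<Rightarrow> 'p \<Rightarrow> 'p set \<Rightarrow> bool" where
  "geodesic_segment M d x y S \<longleftrightarrow> (\<exists>\<gamma>. \<gamma> 0 = x \<and> \<gamma> (d x y) = y \<and> \<gamma> ` {0..d x y} = S \<and> S \<subseteq> M \<and>
     (\<forall>s\<in>{0..d x y}. \<forall>t\<in>{0..d x y}. d (\<gamma> s) (\<gamma> t) = \<bar>s - t\<bar>))"

definition arc_between :: "'p topology \<Rightarrow> 'p \<Rightarrow> 'p \<Rightarrow> 'p set \<Rightarrow> bool" where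
  "arc_between T x y S \<longleftrightarrow> (\<exists>f. continuous_map (top_of_set {0..1::real}) T f \<and>
     inj_on f {0..1} \<and> f 0 = x \<and> f 1 = y \<and> f ` {0..1} = S)"

definition real_tree :: "'p set \<Rightarrow> ('p \<Rightarrow> 'p \<Rightarrow> real) \<Rightarrow> bool" where
  "real_tree M d \<longleftrightarrow> Metric_space M d \<and> M \<noteq> {} \<and>
     (\<forall>x\<in>M. \<forall>y\<in>M. \<exists>S. geodesic_segment M d x y S \<and>
        (\<forall>S'. arc_between (Metric_space.mtopology M d) x y S' \<longrightarrow> S' = S))"

definition isometric_action ::
  "('a, 'b) monoid_scheme \<Rightarrow> 'p set \<Rightarrow> ('p \<Rightarrow> 'p \<Rightarrow> real) \<Rightarrow> ('a \<Rightarrow> 'p \<Rightarrow> 'p) \<Rightarrow> bool" where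
  "isometric_action F M d \<rho> \<longleftrightarrow> group_action F M \<rho> \<and>
     (\<forall>g\<in>carrier F. \<forall>x\<in>M. \<forall>y\<in>M. d (\<rho> g x) (\<rho> g y) = d x y)"

definition minimal_action ::
  "('a, 'b) monoid_scheme \<Rightarrow> 'p set \<Rightarrow> ('p \<Rightarrow> 'p \<Rightarrow> real) \<Rightarrow> ('a \<Rightarrow> 'p \<Rightarrow> 'p) \<Rightarrow> bool" where
  "minimal_action F M d \<rho> \<longleftrightarrow>
     (\<forall>N. N \<subseteq> M \<and> real_tree N d \<and> (\<forall>g\<in>carrier F. \<rho> g ` N \<subseteq> N) \<longrightarrow> N = M)"

definition free_action ::
  "('a, 'b) monoid_scheme \<Rightarrow> 'p set \<Rightarrow> ('a \<Rightarrow> 'p \<Rightarrow> 'p) \<Rightarrow> bool" where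
  "free_action F M \<rho> \<longleftrightarrow> (\<forall>g\<in>carrier F. \<forall>x\<in>M. \<rho> g x = x \<longrightarrow> g = \<one>\<^bsub>F\<^esub>)"

definition discrete_action ::
  "('a, 'b) monoid_scheme \<Rightarrow> 'p set \<Rightarrow> ('p \<Rightarrow> 'p \<Rightarrow> real) \<Rightarrow> ('a \<Rightarrow> 'p \<Rightarrow> 'p) \<Rightarrow> bool" where
  "discrete_action F M d \<rho> \<longleftrightarrow> (\<forall>x\<in>M.
     subtopology (Metric_space.mtopology M d) (orbit F \<rho> x) = discrete_topology (orbit F \<rho> x))"

definition translation_length ::
  "('a, 'b) monoid_scheme \<Rightarrow> 'p set \<Rightarrow> ('p \<Rightarrow> 'p \<Rightarrow> real) \<Rightarrow> ('a \<Rightarrow> 'p \<Rightarrow> 'p) \<Rightarrow> 'a \<Rightarrow> real" where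
  "translation_length F M d \<rho> = (\<lambda>g\<in>carrier F. INF x\<in>M. d x (\<rho> g x))"

text \<open>Unprojectivized Outer space, as a set of length functions.  The points of the trees are taken
  from the type \<^typ>\<open>real\<close>, with an arbitrary carrier \<^term>\<open>M\<close> and an arbitrary metric \<^term>\<open>d\<close>
  unrelated to the usual one.  This loses nothing: for a countable group acting freely, a minimal
  tree is the union of the countably many axes of its elements, so it has the cardinality of the
  continuum.\<close>

definition cv :: "('a, 'b) monoid_scheme \<Rightarrow> ('a \<Rightarrow> real) set" where
  "cv F = {translation_length F M d \<rho> | (M :: real set) d \<rho>.
     real_tree M d \<and> isometric_action F M d \<rho> \<and> minimal_action F M d \<rho> \<and>
     free_action F M \<rho> \<and> discrete_action F M d \<rho>}"

definition fun_class :: "('a, 'b) monoid_scheme \<Rightarrow> ('a \<Rightarrow> real) \<Rightarrow> ('a \<Rightarrow> real) set" where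
  "fun_class F l = {\<lambda>g\<in>carrier F. c * l g | c. c \<noteq> 0}"

definition PR :: "('a, 'b) monoid_scheme \<Rightarrow> ('a \<Rightarrow> real) set topology" where
  "PR F = quotient_topology
     (subtopology (powertop_real (carrier F)) {l. \<exists>g\<in>carrier F. l g \<noteq> 0}) (fun_class F)"

definition CV :: "('a, 'b) monoid_scheme \<Rightarrow> ('a \<Rightarrow> real) set set" where
  "CV F = fun_class F ` cv F"

definition boundary_CV :: "('a, 'b) monoid_scheme \<Rightarrow> ('a \<Rightarrow> real) set topology" where
  "boundary_CV F = subtopology (PR F) (PR F closure_of CV F - CV F)"

definition act_length :: "('a, 'b) monoid_scheme \<Rightarrow> ('a \<Rightarrow> 'a) \<Rightarrow> ('a \<Rightarrow> real) \<Rightarrow> 'a \<Rightarrow> real" where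
  "act_length F \<phi> l = (\<lambda>w\<in>carrier F. l (inv_into (carrier F) \<phi> w))"

end

theory Submission
  imports Defs "HOL-Library.Sublist"
begin

text \<open>Let \<^term>\<open>t \<in> X\<close> and let \<open>T\<close> be the Bass--Serre tree of \<^term>\<open>F\<close> as an HNN extension with
  stable letter \<^term>\<open>t\<close> and trivial edge group.  Its class lies in the boundary of Outer space: it
  is the limit of Cayley trees in which all edges except those labelled \<^term>\<open>t\<close> shrink, and its
  length function vanishes on the other generators.  The automorphisms \<open>y \<mapsto> y b\<close> with
  \<open>b \<noteq> y, t\<close> preserve the number of letters \<^term>\<open>t\<close> and hence fix this class, and so do their
  inverses; any equivariant or anti-equivariant map therefore sends it to the class of a current
  \<open>\<nu>\<close> that is invariant, up to scaling, under all these automorphisms.  No such current exists.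
  Indeed the set \<open>C\<close> of pairs of ends whose geodesic crosses the edge from \<open>1\<close> to \<open>y\<close> is compact
  and mapped onto itself by \<open>y \<mapsto> y b\<close>, so \<open>\<nu>\<close> restricted to \<open>C\<close> is invariant if it is nonzero;
  and the automorphism maps all of \<open>C\<close> except the geodesics that continue with \<open>b\<inverse>\<close> to
  geodesics that continue with \<open>b\<close>.  Hence at least the mass \<open>\<nu>(C)\<close> continues with \<open>b\<close> or \<open>b\<inverse>\<close>.
  Using two different \<open>b\<close> gives \<open>2 \<nu>(C) \<le> \<nu>(C)\<close>, so \<open>\<nu>(C) = 0\<close>; since the translates of
  these sets and of their flips cover everything, \<open>\<nu> = 0\<close>.\<close>

section \<open>Real trees and the four-point condition\<close>

text \<open>\<open>cv F\<close> consists of length functions of genuine real trees, so the point to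
  be fixed must be approximated by such trees and also be kept apart from all of them. Both
  directions pass through the four-point condition (0-hyperbolicity). A weighted word metric
  satisfies it, because common prefixes behave ultrametrically, and a tree with a free, discrete and
  minimal action is built around that metric. Conversely, every real tree satisfies it, which gives
  \<open>max 0 (d x (g (g x)) - d x (g x))\<close> as the translation length of an isometry
  \<open>g\<close>, attained at a midpoint; hence a free action has strictly positive lengths,
  whereas the limit vanishes on a generator other than \<open>t\<close>. The approximating weights
  are positive on every letter, which makes the actions free, and converge to the indicator of
  \<open>t\<close>.

  On the side of currents, the boundary has to be shown compact, since only finite mass lets the
  unknown scaling factor be cancelled. The two letters \<open>b\<close> must avoid both
  \<open>y\<close> and \<open>t\<close>, and \<open>y\<close> runs through all generators,
  \<open>t\<close> included.\<close>

definition four_point :: "'p set \<Rightarrow> ('p \<Rightarrow> 'p \<Rightarrow> real) \<Rightarrow> bool" where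
  "four_point M d \<longleftrightarrow> (\<forall>x\<in>M. \<forall>y\<in>M. \<forall>z\<in>M. \<forall>w\<in>M.
     d x y + d z w \<le> max (d x z + d y w) (d x w + d y z))"

lemma four_pointD:
  "four_point M d \<Longrightarrow> x \<in> M \<Longrightarrow> y \<in> M \<Longrightarrow> z \<in> M \<Longrightarrow> w \<in> M \<Longrightarrow>
     d x y + d z w \<le> max (d x z + d y w) (d x w + d y z)"
  by (auto simp: four_point_def)

lemma (in Metric_space) lipschitz_path_continuous:
  fixes f :: "real \<Rightarrow> 'a"
  assumes "\<And>s. s \<in> I \<Longrightarrow> f s \<in> M"
    and "\<And>s t. s \<in> I \<Longrightarrow> t \<in> I \<Longrightarrow> d (f s) (f t) \<le> C * \<bar>s - t\<bar>"
  shows "continuous_map (top_of_set I) mtopology f"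
  unfolding continuous_map_to_metric
proof (intro ballI allI impI)
  fix x and e :: real
  assume x: "x \<in> topspace (top_of_set I)" and e: "e > 0"
  \<comment> \<open>Adding 1 covers \<open>C = 0\<close>, where the quotient by \<open>C\<close>
    would be 0 instead of a positive radius; the absolute value covers a negative
    \<open>C\<close>.\<close>
  define r where "r = e / (\<bar>C\<bar> + 1)"
  have r: "r > 0" using e by (simp add: r_def add_nonneg_pos)
  have "f y \<in> mball (f x) e" if "y \<in> I \<inter> ball x r" for y
  proof -
    have "d (f x) (f y) \<le> C * \<bar>x - y\<bar>" using x that assms(2) by auto
    also have "\<dots> \<le> (\<bar>C\<bar> + 1) * \<bar>x - y\<bar>" by (intro mult_right_mono) auto
    also have "\<dots> < (\<bar>C\<bar> + 1) * r" using that by (intro mult_strict_left_mono) (auto simp: dist_real_def)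
    also have "\<dots> = e" by (simp add: r_def)
    finally show ?thesis using x that assms(1) by (auto simp: in_mball)
  qed
  then show "\<exists>U. openin (top_of_set I) U \<and> x \<in> U \<and> (\<forall>y\<in>U. f y \<in> mball (f x) e)"
    using x r by (intro exI[of _ "I \<inter> ball x r"]) auto
qed

lemma (in Metric_space) continuous_on_dist_path:
  fixes f :: "real \<Rightarrow> 'a"
  assumes "continuous_map (top_of_set I) mtopology f" "x \<in> M"
  shows "continuous_on I (\<lambda>t. d (f t) x)"
proof -
  have "continuous_map (top_of_set I) euclidean (\<lambda>t. mdist (metric (M, d)) (f t) x)"
    by (rule continuous_map_mdist) (use assms in auto)
  then show ?thesis by simp
qed

text \<open>Off the point \<^term>\<open>p\<close> of the segment from \<^term>\<open>x\<close> to \<^term>\<open>y\<close>, the projection to that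
  segment is locally constant on the branch hanging at \<^term>\<open>p\<close>.\<close>

lemma (in Metric_space) path_stays_in_branch:
  fixes f :: "real \<Rightarrow> 'a"
  assumes fp: "four_point M d" and f: "continuous_map (top_of_set I) mtopology f"
    and I: "connected I" and M: "x \<in> M" "y \<in> M" "p \<in> M"
    and p: "d x p + d p y = d x y" "p \<notin> f ` I"
    and i: "i \<in> I" "d (f i) x - d (f i) y = d p x - d p y" and t: "t \<in> I"
  shows "d (f t) x - d (f t) y = d p x - d p y"
proof -
  define W where "W = {t \<in> I. d (f t) x - d (f t) y = d p x - d p y}"
  have fM: "f t \<in> M" if "t \<in> I" for t using continuous_map_funspace[OF f] that by auto
  have "closedin (top_of_set I) W"
    unfolding W_def by (intro continuous_closedin_preimage_constant continuous_intros continuous_on_dist_path f M)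
  moreover have "openin (top_of_set I) W"
  proof (subst openin_subopen, intro ballI)
    fix t assume t: "t \<in> W"
    then have tI: "t \<in> I" by (simp add: W_def)
    have ne: "f t \<noteq> p" using p(2) tI by auto
    \<comment> \<open>\<open>A\<close> below shows that \<open>p\<close> is the projection of
      \<open>f t\<close> to the segment, so \<open>e\<close> is the distance from \<open>f t\<close>
      to the segment. A point closer than \<open>e\<close> to \<open>f t\<close> hangs on the same
      branch and has the same projection.\<close>
    define e where "e = d (f t) p"
    have e: "e > 0" using ne fM[OF tI] M by (simp add: e_def mdist_pos_less)
    then obtain U where U: "openin (top_of_set I) U" "t \<in> U" "\<And>s. s \<in> U \<Longrightarrow> f s \<in> mball (f t) e"
      using f tI unfolding continuous_map_to_metric by (metis topspace_euclidean_subtopology)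
    have "s \<in> W" if s: "s \<in> U" for s
    proof -
      have sI: "s \<in> I" using U(1) s openin_imp_subset by blast
      have de: "d (f s) (f t) < e" using U(3)[OF s] by (simp add: in_mball commute)
      have eq: "d (f t) x - d (f t) y = d p x - d p y" using t by (simp add: W_def)
      note F = four_pointD[OF fp]
      have "e + d x y \<le> max (d (f t) x + d p y) (d (f t) y + d p x)"
        unfolding e_def using F[of "f t" p x y] fM[OF tI] M by simp
      then have A: "d (f t) x \<ge> e + d p x" "d (f t) y \<ge> e + d p y"
        using p(1) eq by (simp_all add: commute max_def split: if_splits)
      have B: "d (f s) (f t) + d x y \<le> max (d (f s) x + d (f t) y) (d (f s) y + d (f t) x)"
           "d (f s) x + d (f t) y \<le> max (d (f s) (f t) + d x y) (d (f s) y + d (f t) x)"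
           "d (f s) y + d (f t) x \<le> max (d (f s) (f t) + d x y) (d (f s) x + d (f t) y)"
        using F[of "f s" "f t" x y] F[of "f s" x "f t" y] F[of "f s" y "f t" x] fM[OF tI] fM[OF sI] M
        by (simp_all add: commute)
      have C: "d x y \<le> d (f s) x + d (f s) y"
        using triangle[of x "f s" y] fM[OF sI] M by (simp add: commute)
      have P: "d x y = d p x + d p y" using p(1) by (simp add: commute)
      have "d (f s) x - d (f s) y = d (f t) x - d (f t) y"
        using A B C de P eq by (auto simp: max_def split: if_splits)
      then show ?thesis using eq sI by (simp add: W_def)
    qed
    then show "\<exists>U. openin (top_of_set I) U \<and> t \<in> U \<and> U \<subseteq> W" using U by blast
  qed
  ultimately have "W = {} \<or> W = I" using I by (simp add: connected_clopen)
  then show ?thesis using i t by (auto simp: W_def)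
qed

text \<open>Only uniqueness of arcs needs an argument, and the coordinate
  \<open>d _ x - d _ y\<close> of the projection to the geodesic supplies it. If an arc missed a
  point of the geodesic, the coordinate would be constant along it, by
  \<open>path_stays_in_branch\<close>. If the arc visited a point \<open>q\<close> off the geodesic,
  it would pass the foot of \<open>q\<close> only once, so on one side of \<open>q\<close> it would
  avoid the foot; the endpoint on that side would then be the foot itself, against
  injectivity.\<close>

lemma real_treeI:
  assumes "Metric_space M d" "M \<noteq> {}" and fp: "four_point M d"
    and geo: "\<And>x y. x \<in> M \<Longrightarrow> y \<in> M \<Longrightarrow> \<exists>S. geodesic_segment M d x y S"
  shows "real_tree M d"
  unfolding real_tree_def
proof (intro conjI ballI)
  interpret Metric_space M d by fact
  fix x y assume xy: "x \<in> M" "y \<in> M"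
  obtain S where S: "geodesic_segment M d x y S" using geo xy by blast
  then obtain \<gamma> where \<gamma>: "\<gamma> 0 = x" "\<gamma> (d x y) = y" "\<gamma> ` {0..d x y} = S" "S \<subseteq> M"
     "\<And>s t. s \<in> {0..d x y} \<Longrightarrow> t \<in> {0..d x y} \<Longrightarrow> d (\<gamma> s) (\<gamma> t) = \<bar>s - t\<bar>"
    unfolding geodesic_segment_def by metis
  have seg: "\<gamma> s \<in> M" "d x (\<gamma> s) = s" "d (\<gamma> s) y = d x y - s" if "s \<in> {0..d x y}" for s
    using \<gamma>(3,4) \<gamma>(5)[of 0 s] \<gamma>(5)[of s "d x y"] that by (auto simp: \<gamma>(1,2))
  have "S' = S" if arc: "arc_between mtopology x y S'" for S'
  proof -
    obtain f where f: "continuous_map (top_of_set {0..1::real}) mtopology f" "inj_on f {0..1}"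
      "f 0 = x" "f 1 = y" "f ` {0..1} = S'"
      using arc unfolding arc_between_def by blast
    have fM: "f t \<in> M" if "t \<in> {0..1}" for t using continuous_map_funspace[OF f(1)] that by auto
    have branch: "d (f t) x - d (f t) y = 2 * s - d x y"
      if "connected I" "I \<subseteq> {0..1}" "s \<in> {0..d x y}" "\<gamma> s \<notin> f ` I" "i \<in> I" "t \<in> I"
         "d (f i) x - d (f i) y = 2 * s - d x y" for I s i t
      using path_stays_in_branch[OF fp continuous_map_from_subtopology_mono[OF f(1) that(2)] that(1) xy
          seg(1)[OF that(3)] _ that(4,5) _ that(6)] seg[OF that(3)] that(7)
      by (simp add: commute)
    have "S \<subseteq> S'"
    proof
      fix p assume "p \<in> S"
      then obtain s where s: "s \<in> {0..d x y}" "p = \<gamma> s" using \<gamma>(3) by blast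
      have "continuous_on {0..1} (\<lambda>t. d (f t) x - d (f t) y)"
        by (intro continuous_intros continuous_on_dist_path f xy)
      then have "\<exists>t. 0 \<le> t \<and> t \<le> 1 \<and> d (f t) x - d (f t) y = 2 * s - d x y"
        by (intro IVT') (use s xy in \<open>auto simp: f commute\<close>)
      then obtain i where i: "i \<in> {0..1}" "d (f i) x - d (f i) y = 2 * s - d x y" by auto
      show "p \<in> S'"
      proof (rule ccontr)
        assume "p \<notin> S'"
        then have n: "\<gamma> s \<notin> f ` {0..1}" using s f(5) by simp
        have "d (f 0) x - d (f 0) y = 2 * s - d x y"
          using branch[OF _ _ s(1) n i(1) _ i(2), of 0] by simp
        then have "s = 0" using xy f(3) by simp
        then show False using n \<gamma>(1) f(3) by (metis atLeastAtMost_iff imageI order_refl zero_le_one)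
      qed
    qed
    moreover have "S' \<subseteq> S"
    proof
      fix q assume "q \<in> S'"
      then obtain i where i: "i \<in> {0..1}" "q = f i" using f(5) by blast
      show "q \<in> S"
      proof (rule ccontr)
        assume nS: "q \<notin> S"
        \<comment> \<open>The parameter on the geodesic of the projection of
          \<open>q\<close>.\<close>
        define s where "s = (d x y + d q x - d q y) / 2"
        have qM: "q \<in> M" using i fM by simp
        have s: "s \<in> {0..d x y}"
          using triangle[of x q y] triangle[of q x y] triangle[of x y q] triangle[of q y x] qM xy
          by (auto simp: s_def commute)
        have "\<gamma> s \<in> S'" using s \<gamma>(3) \<open>S \<subseteq> S'\<close> by blast
        then obtain j where j: "j \<in> {0..1}" "\<gamma> s = f j" using f(5) by blast
        have ij: "i \<noteq> j" using nS i j s \<gamma>(3) by force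
        have fi: "d (f i) x - d (f i) y = 2 * s - d x y" using i by (simp add: s_def field_simps)
        have notin: "\<gamma> s \<notin> f ` I" if "I \<subseteq> {0..1}" "j \<notin> I" for I
          using inj_onD[OF f(2) _ j(1)] that j by (metis imageE subsetD)
        show False
        proof (cases "j < i")
          case True
          have "d (f 1) x - d (f 1) y = 2 * s - d x y"
            using i j True s fi notin[of "{i..1}"] by (intro branch[of "{i..1}" s i 1]) auto
          then have "s = d x y" using f(4) xy by (simp add: commute)
          then have "f j = f 1" using j \<gamma>(2) f(4) by simp
          then have "j = 1" using inj_onD[OF f(2)] j(1) by simp
          then show False using True i by simp
        next
          case False
          have "d (f 0) x - d (f 0) y = 2 * s - d x y"
            using i j False ij s fi notin[of "{0..i}"] by (intro branch[of "{0..i}" s i 0]) auto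
          then have "s = 0" using f(3) xy by (simp add: commute)
          then have "f j = f 0" using j \<gamma>(1) f(3) by simp
          then have "j = 0" using inj_onD[OF f(2)] j(1) by simp
          then show False using False ij i by simp
        qed
      qed
    qed
    ultimately show "S' = S" by simp
  qed
  then show "\<exists>S. geodesic_segment M d x y S \<and> (\<forall>S'. arc_between mtopology x y S' \<longrightarrow> S' = S)"
    using S by blast
qed (use assms in auto)


section \<open>Geodesics and tripods in real trees\<close>

definition geodesic_path :: "'p set \<Rightarrow> ('p \<Rightarrow> 'p \<Rightarrow> real) \<Rightarrow> (real \<Rightarrow> 'p) \<Rightarrow> 'p \<Rightarrow> 'p \<Rightarrow> bool" where
  "geodesic_path M d \<gamma> x y \<longleftrightarrow> \<gamma> 0 = x \<and> \<gamma> (d x y) = y \<and> \<gamma> ` {0..d x y} \<subseteq> M \<and>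
     (\<forall>s\<in>{0..d x y}. \<forall>t\<in>{0..d x y}. d (\<gamma> s) (\<gamma> t) = \<bar>s - t\<bar>)"

lemma geodesic_segment_iff:
  "geodesic_segment M d x y S \<longleftrightarrow> (\<exists>\<gamma>. geodesic_path M d \<gamma> x y \<and> S = \<gamma> ` {0..d x y})"
  unfolding geodesic_segment_def geodesic_path_def by blast

lemma real_tree_geodesic_path:
  assumes "real_tree M d" "x \<in> M" "y \<in> M"
  obtains \<gamma> where "geodesic_path M d \<gamma> x y"
  using assms unfolding real_tree_def geodesic_segment_iff by blast

lemma geodesic_path_dist:
  assumes "geodesic_path M d \<gamma> x y" "s \<in> {0..d x y}" "t \<in> {0..d x y}"
  shows "d (\<gamma> s) (\<gamma> t) = \<bar>s - t\<bar>"
  using assms by (auto simp: geodesic_path_def)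

lemma geodesic_path_mem: "geodesic_path M d \<gamma> x y \<Longrightarrow> s \<in> {0..d x y} \<Longrightarrow> \<gamma> s \<in> M"
  by (auto simp: geodesic_path_def)

context Metric_space
begin

lemma geodesic_path_ends:
  assumes "geodesic_path M d \<gamma> x y" "s \<in> {0..d x y}"
  shows "d x (\<gamma> s) = s" "d (\<gamma> s) x = s" "d (\<gamma> s) y = d x y - s" "d y (\<gamma> s) = d x y - s"
  using geodesic_path_dist[OF assms(1), of 0 s] geodesic_path_dist[OF assms(1), of s "d x y"] assms
  by (auto simp: geodesic_path_def commute)

text \<open>A Lipschitz bound is asked for instead of an isometry, because the concatenated path in
  \<open>real_tree_tripod\<close> is not yet known to be geodesic when this is applied to
  it.\<close>

lemma arc_between_path:
  assumes "D > 0" and M: "\<And>s. s \<in> {0..D} \<Longrightarrow> h s \<in> M"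
    and L: "\<And>s t. s \<in> {0..D} \<Longrightarrow> t \<in> {0..D} \<Longrightarrow> d (h s) (h t) \<le> \<bar>s - t\<bar>"
    and inj: "inj_on h {0..D}"
  shows "arc_between mtopology (h 0) (h D) (h ` {0..D})"
proof -
  have mem: "D * s \<in> {0..D}" if "s \<in> {0..1}" for s
    using that \<open>D > 0\<close> mult_left_le[of s D] by auto
  have "continuous_map (top_of_set {0..1}) mtopology (\<lambda>s. h (D * s))"
  proof (rule lipschitz_path_continuous)
    fix s t :: real assume "s \<in> {0..1}" "t \<in> {0..1}"
    then have "d (h (D * s)) (h (D * t)) \<le> \<bar>D * s - D * t\<bar>" by (intro L mem)
    also have "\<dots> = D * \<bar>s - t\<bar>"
      using \<open>D > 0\<close> by (simp add: abs_mult flip: right_diff_distrib)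
    finally show "d (h (D * s)) (h (D * t)) \<le> D * \<bar>s - t\<bar>" .
  qed (use M mem in auto)
  moreover have "inj_on (\<lambda>s. h (D * s)) {0..1}"
    using inj_onD[OF inj _ mem mem] \<open>D > 0\<close> by (intro inj_onI) simp
  moreover have "(\<lambda>s. h (D * s)) ` {0..1} = h ` {0..D}"
  proof -
    have "(*) D ` {0..1} = {0..D}" using \<open>D > 0\<close> by (simp add: image_mult_atLeastAtMost)
    then show ?thesis by (metis image_image)
  qed
  ultimately show ?thesis
    unfolding arc_between_def by (intro exI[of _ "\<lambda>s. h (D * s)"]) auto
qed

lemma arc_between_geodesic_path:
  assumes \<gamma>: "geodesic_path M d \<gamma> x y" and s: "0 < s" "s \<le> d x y"
  shows "arc_between mtopology x (\<gamma> s) (\<gamma> ` {0..s})"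
proof -
  have "inj_on \<gamma> {0..s}"
  proof (rule inj_onI)
    fix u v assume uv: "u \<in> {0..s}" "v \<in> {0..s}" and eq: "\<gamma> u = \<gamma> v"
    have "u = d x (\<gamma> u)" by (rule geodesic_path_ends(1)[OF \<gamma>, symmetric]) (use uv s in auto)
    also have "\<dots> = v" unfolding eq by (rule geodesic_path_ends(1)[OF \<gamma>]) (use uv s in auto)
    finally show "u = v" .
  qed
  moreover have "\<gamma> 0 = x" using \<gamma> by (simp add: geodesic_path_def)
  ultimately show ?thesis
    using arc_between_path[OF s(1), of \<gamma>] s(2)
    by (simp add: geodesic_path_dist[OF \<gamma>] geodesic_path_mem[OF \<gamma>])
qed

text \<open>Two geodesics issuing from a point \<^term>\<open>p\<close> of a real tree follow each other up to their
  last common point; the two remaining pieces form an arc, hence a geodesic.\<close>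

lemma real_tree_tripod:
  assumes T: "real_tree M d" and M: "p \<in> M" "x \<in> M" "y \<in> M"
    and \<gamma>: "geodesic_path M d \<gamma> p x" and \<eta>: "geodesic_path M d \<eta> p y"
  obtains s where "0 \<le> s" "s \<le> d p x" "s \<le> d p y" "\<And>t. t \<in> {0..s} \<Longrightarrow> \<gamma> t = \<eta> t"
    "d x y = d p x + d p y - 2 * s"
proof -
  have uniq: "S = S'" if "arc_between mtopology u v S" "arc_between mtopology u v S'" "u \<in> M" "v \<in> M" for u v S S'
    using T that unfolding real_tree_def by metis
  have ends: "\<gamma> 0 = p" "\<gamma> (d p x) = x" "\<eta> 0 = p" "\<eta> (d p y) = y"
    using \<gamma> \<eta> by (auto simp: geodesic_path_def)
  define m where "m = min (d p x) (d p y)"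
  define A where "A = {t \<in> {0..m}. mdist (metric (M, d)) (\<gamma> t) (\<eta> t) = 0}"
  have "continuous_map (top_of_set {0..m}) mtopology \<gamma>" "continuous_map (top_of_set {0..m}) mtopology \<eta>"
    by (rule lipschitz_path_continuous[where C = 1];
        use geodesic_path_mem[OF \<gamma>] geodesic_path_dist[OF \<gamma>] geodesic_path_mem[OF \<eta>] geodesic_path_dist[OF \<eta>]
        in \<open>auto simp: m_def\<close>)+
  then have "continuous_map (top_of_set {0..m}) euclidean (\<lambda>t. mdist (metric (M, d)) (\<gamma> t) (\<eta> t))"
    by (intro continuous_map_mdist) auto
  then have "continuous_on {0..m} (\<lambda>t. mdist (metric (M, d)) (\<gamma> t) (\<eta> t))" by simp
  then have "closed A" unfolding A_def
    by (intro continuous_closed_preimage_constant) auto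
  moreover have "bounded A"
    by (rule bounded_subset[OF bounded_closed_interval[of 0 m]]) (auto simp: A_def)
  ultimately have "compact A" by (simp add: compact_eq_bounded_closed)
  moreover have "0 \<in> A" using M by (simp add: A_def ends m_def)
  ultimately obtain s where s: "s \<in> A" "\<And>t. t \<in> A \<Longrightarrow> t \<le> s"
    using compact_attains_sup[of A] by blast
  have A_iff: "t \<in> A \<longleftrightarrow> t \<in> {0..m} \<and> \<gamma> t = \<eta> t" for t
    using geodesic_path_mem[OF \<gamma>, of t] geodesic_path_mem[OF \<eta>, of t] by (auto simp: A_def m_def)
  have sm: "0 \<le> s" "s \<le> d p x" "s \<le> d p y" "\<gamma> s = \<eta> s" using s(1) by (auto simp: A_iff m_def)
  have agree: "\<gamma> t = \<eta> t" if t: "t \<in> {0..s}" for t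
  proof (cases "s = 0")
    case False
    then have "\<gamma> ` {0..s} = \<eta> ` {0..s}"
      using arc_between_geodesic_path[OF \<gamma>, of s] arc_between_geodesic_path[OF \<eta>, of s] sm M(1)
        geodesic_path_mem[OF \<gamma>, of s]
      by (intro uniq[of p "\<gamma> s"]) auto
    then obtain t' where t': "t' \<in> {0..s}" "\<gamma> t = \<eta> t'" using t by blast
    then have "t = t'"
      using geodesic_path_ends(1)[OF \<gamma>, of t] geodesic_path_ends(1)[OF \<eta>, of t'] t sm by auto
    then show ?thesis using t' by simp
  qed (use t sm in auto)
  define a where "a = d p x - s"
  define D where "D = a + (d p y - s)"
  have "d x y = D"
  proof (cases "D = 0")
    case True
    then have "s = d p x" "s = d p y" using sm by (auto simp: D_def a_def)
    then show ?thesis using sm ends True M by auto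
  next
    case False
    then have D: "D > 0" using sm by (simp add: D_def a_def)
    \<comment> \<open>The path runs from \<open>x\<close> back along \<gamma> to the branch point,
      which it reaches at time \<open>a\<close>, and then along \<eta> to \<open>y\<close>.\<close>
    define h where "h u = (if u \<le> a then \<gamma> (d p x - u) else \<eta> (s + (u - a)))" for u
    have h1: "h u = \<gamma> (d p x - u)" "d p x - u \<in> {0..d p x}" "s \<le> d p x - u" if "u \<in> {0..D}" "u \<le> a" for u
      using that sm by (auto simp: h_def D_def a_def)
    have h2: "h u = \<eta> (s + (u - a))" "s + (u - a) \<in> {0..d p y}" "s < s + (u - a)" if "u \<in> {0..D}" "u > a" for u
      using that sm by (auto simp: h_def D_def a_def)
    have hM: "h u \<in> M" if "u \<in> {0..D}" for u
      using h1[OF that] h2[OF that] geodesic_path_mem[OF \<gamma>] geodesic_path_mem[OF \<eta>] by (cases "u \<le> a") auto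
    have same: "d (h u) (h v) = \<bar>u - v\<bar>" if "u \<in> {0..D}" "v \<in> {0..D}" "u \<le> a \<longleftrightarrow> v \<le> a" for u v
    proof (cases "u \<le> a")
      case True
      then show ?thesis using h1[of u] h1[of v] that geodesic_path_dist[OF \<gamma>, of "d p x - u" "d p x - v"] by auto
    next
      case False
      then show ?thesis using h2[of u] h2[of v] that geodesic_path_dist[OF \<eta>, of "s + (u - a)" "s + (v - a)"] by auto
    qed
    have cross: "d (h u) (h v) \<le> v - u" "h u \<noteq> h v" if uv: "u \<in> {0..D}" "v \<in> {0..D}" "u \<le> a" "v > a" for u v
    proof -
      note u = h1[OF uv(1,3)] and v = h2[OF uv(2,4)]
      have "d (h u) (\<gamma> s) = a - u" "d (\<gamma> s) (h v) = v - a"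
        using u v sm geodesic_path_dist[OF \<gamma>, of "d p x - u" s] geodesic_path_dist[OF \<eta>, of s "s + (v - a)"]
        by (auto simp: a_def)
      then show "d (h u) (h v) \<le> v - u"
        using triangle[of "h u" "\<gamma> s" "h v"] hM uv geodesic_path_mem[OF \<gamma>, of s] sm by auto
      show "h u \<noteq> h v"
      proof
        assume eq: "h u = h v"
        then have "d p x - u = s + (v - a)"
          using u v geodesic_path_ends(1)[OF \<gamma>, of "d p x - u"] geodesic_path_ends(1)[OF \<eta>, of "s + (v - a)"] by simp
        then have "d p x - u \<in> A" using eq u v by (auto simp: A_iff m_def)
        then show False using s(2) v(3) \<open>d p x - u = s + (v - a)\<close> by fastforce
      qed
    qed
    have lip: "d (h u) (h v) \<le> \<bar>u - v\<bar>" if "u \<in> {0..D}" "v \<in> {0..D}" for u v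
    proof (cases "u \<le> a \<longleftrightarrow> v \<le> a")
      case False
      then consider "u \<le> a" "v > a" | "v \<le> a" "u > a" by linarith
      then show ?thesis
      proof cases
        case 1
        then show ?thesis using cross(1)[OF that] by simp
      next
        case 2
        then show ?thesis using cross(1)[OF that(2,1)] commute[of "h u" "h v"] by simp
      qed
    qed (use same[OF that] in simp)
    have inj: "inj_on h {0..D}"
    proof (rule inj_onI)
      fix u v assume uv: "u \<in> {0..D}" "v \<in> {0..D}" "h u = h v"
      then have "u \<le> a \<longleftrightarrow> v \<le> a" using cross(2)[of u v] cross(2)[of v u] by force
      then show "u = v" using same[OF uv(1,2)] uv hM[OF uv(2)] by simp
    qed
    have hends: "h 0 = x" "h D = y"
    proof -
      show "h 0 = x" using sm ends by (simp add: h_def a_def)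
      show "h D = y"
      proof (cases "D \<le> a")
        case True
        then have "d p y = s" using sm by (simp add: D_def)
        then show ?thesis using True ends sm by (auto simp: h_def D_def a_def)
      qed (use ends in \<open>auto simp: h_def D_def\<close>)
    qed
    then have arc: "arc_between mtopology x y (h ` {0..D})"
      using arc_between_path[OF D hM lip inj] by simp
    obtain \<sigma> where \<sigma>: "geodesic_path M d \<sigma> x y" using real_tree_geodesic_path[OF T M(2,3)] .
    have "x \<noteq> y" using hends inj_onD[OF inj, of 0 D] D by auto
    then have "0 < d x y" using M by (simp add: mdist_pos_less)
    then have "arc_between mtopology x y (\<sigma> ` {0..d x y})"
      using arc_between_geodesic_path[OF \<sigma>, of "d x y"] \<sigma> by (simp add: geodesic_path_def)
    then have "\<sigma> ` {0..d x y} = h ` {0..D}" using arc uniq M by blast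
    \<comment> \<open>Uniqueness of arcs puts the branch point on the geodesic from \<open>x\<close>
      to \<open>y\<close>, which turns the triangle inequality into an equality.\<close>
    moreover have "\<gamma> s \<in> h ` {0..D}"
      using h1[of a] sm by (auto simp: D_def a_def intro!: image_eqI[of _ _ a])
    ultimately obtain t where "t \<in> {0..d x y}" "\<gamma> s = \<sigma> t" by (metis imageE)
    then have "d x y = d x (\<gamma> s) + d (\<gamma> s) y" using geodesic_path_ends[OF \<sigma>] by simp
    then show ?thesis
      using geodesic_path_ends[OF \<gamma>, of s] geodesic_path_ends[OF \<eta>, of s] sm by (simp add: D_def a_def)
  qed
  then show thesis using that[of s] sm agree by (simp add: D_def a_def)
qed

text \<open>Seen from \<open>w\<close>, the overlap of two geodesics is a Gromov product. The
  geodesics to \<open>x\<close> and \<open>y\<close> agree at least as long as both agree with the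
  one to \<open>z\<close>; this ultrametric inequality is the four-point condition.\<close>

lemma real_tree_four_point:
  assumes T: "real_tree M d"
  shows "four_point M d"
  unfolding four_point_def
proof (intro ballI)
  fix x y z w assume M: "x \<in> M" "y \<in> M" "z \<in> M" "w \<in> M"
  obtain \<alpha> \<beta> \<gamma> where g: "geodesic_path M d \<alpha> w x" "geodesic_path M d \<beta> w y" "geodesic_path M d \<gamma> w z"
    using real_tree_geodesic_path[OF T] M by metis
  obtain s where s: "0 \<le> s" "s \<le> d w x" "s \<le> d w z" "\<And>t. t \<in> {0..s} \<Longrightarrow> \<alpha> t = \<gamma> t"
    "d x z = d w x + d w z - 2 * s" using real_tree_tripod[OF T M(4,1,3) g(1,3)] by metis
  obtain t where t: "0 \<le> t" "t \<le> d w z" "t \<le> d w y" "\<And>r. r \<in> {0..t} \<Longrightarrow> \<gamma> r = \<beta> r"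
    "d z y = d w z + d w y - 2 * t" using real_tree_tripod[OF T M(4,3,2) g(3,2)] by metis
  define r where "r = min s t"
  have r: "0 \<le> r" "r \<le> d w x" "r \<le> d w y" "\<alpha> r = \<beta> r" using s(1-3) t(1-3) s(4)[of r] t(4)[of r] by (auto simp: r_def)
  have "d x y \<le> d x (\<alpha> r) + d (\<alpha> r) y"
    using r M by (intro triangle geodesic_path_mem[OF g(1)]) auto
  also have "\<dots> = d w x - r + (d w y - r)"
    using geodesic_path_ends[OF g(1), of r] geodesic_path_ends[OF g(2), of r] r by simp
  finally show "d x y + d z w \<le> max (d x z + d y w) (d x w + d y z)"
    using s(5) t(5) by (auto simp: r_def commute)
qed

text \<open>For an isometry of a real tree, moving the base point along its orbit shows that the
  displacement cannot drop below the increment \<^term>\<open>d x (T (T x)) - d x (T x)\<close>, while the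
  midpoint of \<^term>\<open>x\<close> and \<^term>\<open>T x\<close> is moved by no more than that.\<close>

lemma displacement_ge:
  assumes fp: "four_point M d" and T: "\<And>x. x \<in> M \<Longrightarrow> T x \<in> M"
    and iso: "\<And>x y. x \<in> M \<Longrightarrow> y \<in> M \<Longrightarrow> d (T x) (T y) = d x y"
    and x: "x \<in> M" and y: "y \<in> M"
  shows "d x (T (T x)) - d x (T x) \<le> d y (T y)"
proof (cases "d x (T (T x)) - d x (T x) > 0")
  case False
  then show ?thesis using nonneg[of y "T y"] by linarith
next
  case True
  define \<delta> where "\<delta> = d x (T (T x)) - d x (T x)"
  define D where "D n = d x ((T ^^ n) x)" for n
  have TM: "(T ^^ n) z \<in> M" if "z \<in> M" for n z using that T by (induction n) auto
  have isoM: "d ((T ^^ n) z) ((T ^^ n) w) = d z w" if "z \<in> M" "w \<in> M" for n z w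
    using that by (induction n) (auto simp: iso TM)
  have Tdist: "d ((T ^^ n) x) ((T ^^ (n + k)) x) = D k" for n k
    using isoM[of x "(T ^^ k) x" n] x TM by (simp add: D_def funpow_add)
  \<comment> \<open>Whenever \<open>D (n + 2)\<close> exceeds \<open>D 1\<close>, this says that
    \<open>D\<close> is convex there, so its increments never fall below the first one, which is
    \<delta>.\<close>
  have step: "2 * D (n + 2) \<le> max (2 * D 1) (D (n + 3) + D (n + 1))" for n
    using four_pointD[OF fp x TM[OF x, of "n + 2"] TM[OF x, of 1] TM[OF x, of "n + 3"]]
      Tdist[of 1 "n + 2"] Tdist[of "n + 2" 1] Tdist[of 1 "n + 1"]
    by (auto simp: D_def eval_nat_numeral commute max_def split: if_splits)
  have grow: "D (n + 2) \<ge> D (n + 1) + \<delta> \<and> D (n + 2) \<ge> D 1 + \<delta>" for n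
  proof (induction n)
    case 0
    then show ?case by (simp add: D_def \<delta>_def eval_nat_numeral)
  next
    case (Suc n)
    then show ?case using step[of n] True by (auto simp: \<delta>_def eval_nat_numeral)
  qed
  have lin: "D (n + 1) \<ge> n * \<delta>" for n
  proof (induction n)
    case (Suc n)
    then show ?case using grow[of n] by (simp add: algebra_simps)
  qed (simp add: D_def)
  define e where "e = d y (T y)"
  have ydist: "d y ((T ^^ n) y) \<le> n * e" for n
  proof (induction n)
    case (Suc n)
    have "d y ((T ^^ Suc n) y) \<le> d y ((T ^^ n) y) + d ((T ^^ n) y) ((T ^^ n) (T y))"
      using triangle[of y "(T ^^ n) y" "(T ^^ Suc n) y"] y TM T by (simp add: funpow_swap1)
    also have "d ((T ^^ n) y) ((T ^^ n) (T y)) = e" using isoM[OF y T[OF y]] by (simp add: e_def)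
    finally show ?case using Suc by (simp add: algebra_simps)
  qed (use y in simp)
  \<comment> \<open>The orbit of \<open>x\<close> moves away at rate at least \<delta>, that of
    \<open>y\<close> at rate at most \<open>e\<close>, and the two orbits stay within
    \<open>d x y\<close> of each other, which forces \<delta> to be at most
    \<open>e\<close>.\<close>
  have "n * \<delta> \<le> 2 * d x y + (n + 1) * e" for n :: nat
  proof -
    have "D (n + 1) \<le> d x y + d y ((T ^^ (n + 1)) x)"
      unfolding D_def by (intro triangle TM x y)
    also have "d y ((T ^^ (n + 1)) x) \<le> d y ((T ^^ (n + 1)) y) + d ((T ^^ (n + 1)) y) ((T ^^ (n + 1)) x)"
      by (intro triangle TM x y)
    also have "d ((T ^^ (n + 1)) y) ((T ^^ (n + 1)) x) = d x y" using isoM[OF y x] by (subst commute)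
    finally show ?thesis using lin[of n] ydist[of "n + 1"] by simp
  qed
  then have *: "n * (\<delta> - e) \<le> 2 * d x y + e" for n :: nat by (simp add: algebra_simps)
  show ?thesis
  proof (rule ccontr)
    assume "\<not> ?thesis"
    then have "\<delta> - e > 0" by (simp add: \<delta>_def e_def)
    then obtain n :: nat where "n * (\<delta> - e) > 2 * d x y + e" using reals_Archimedean3 by blast
    then show False using *[of n] by simp
  qed
qed

lemma displacement_midpoint_le:
  assumes fp: "four_point M d" and T: "\<And>x. x \<in> M \<Longrightarrow> T x \<in> M"
    and iso: "\<And>x y. x \<in> M \<Longrightarrow> y \<in> M \<Longrightarrow> d (T x) (T y) = d x y"
    and x: "x \<in> M" and \<gamma>: "geodesic_path M d \<gamma> x (T x)"
  shows "d (\<gamma> (d x (T x) / 2)) (T (\<gamma> (d x (T x) / 2))) \<le> max 0 (d x (T (T x)) - d x (T x))"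
proof -
  define h where "h = d x (T x) / 2"
  define m where "m = \<gamma> h"
  have h: "h \<in> {0..d x (T x)}" by (simp add: h_def)
  have m: "m \<in> M" "d x m = h" "d m (T x) = h" "d (T m) (T x) = h"
    using geodesic_path_mem[OF \<gamma> h] geodesic_path_ends[OF \<gamma> h] iso[of m x] x
    by (auto simp: m_def h_def commute)
  have m': "d (T m) (T (T x)) = h" using iso[of m "T x"] m x T by simp
  have e: "d x (T x) = 2 * h" "d (T x) (T (T x)) = 2 * h" using iso[of x "T x"] x T by (auto simp: h_def)
  have "d (T m) x + d (T x) (T (T x)) \<le> max (d (T m) (T x) + d x (T (T x))) (d (T m) (T (T x)) + d x (T x))"
    by (rule four_pointD[OF fp]) (auto simp: x T m)
  then have 1: "d x (T m) \<le> max (d x (T (T x)) - h) h" using m m' e by (auto simp: commute)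
  have "d m (T m) + d x (T x) \<le> max (d m x + d (T m) (T x)) (d m (T x) + d (T m) x)"
    by (rule four_pointD[OF fp]) (auto simp: x T m)
  then show ?thesis using 1 m e unfolding h_def[symmetric] m_def[symmetric] by (auto simp: commute max_def split: if_splits)
qed

end

section \<open>Translation lengths\<close>

text \<open>\<open>displacement_ge\<close> bounds every displacement from below and the midpoint
  reaches the bound. The second part records that the infimum is attained: freeness only says that
  each single point is moved, so \<open>cv_pos\<close> needs a point that realises the
  infimum.\<close>

lemma translation_length_real_tree:
  assumes T: "real_tree M d" and A: "isometric_action F M d \<rho>" and g: "g \<in> carrier F" and x: "x \<in> M"
  shows "translation_length F M d \<rho> g = max 0 (d x (\<rho> g (\<rho> g x)) - d x (\<rho> g x))"
    and "\<exists>m\<in>M. d m (\<rho> g m) \<le> max 0 (d x (\<rho> g (\<rho> g x)) - d x (\<rho> g x))"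
proof -
  interpret Metric_space M d using T by (simp add: real_tree_def)
  interpret group_action F M \<rho> using A by (simp add: isometric_action_def)
  note fp = real_tree_four_point[OF T]
  have M: "\<rho> g y \<in> M" if "y \<in> M" for y using element_image[OF g that] by simp
  have iso: "d (\<rho> g y) (\<rho> g z) = d y z" if "y \<in> M" "z \<in> M" for y z
    using A g that by (simp add: isometric_action_def)
  obtain \<gamma> where \<gamma>: "geodesic_path M d \<gamma> x (\<rho> g x)" using real_tree_geodesic_path[OF T x M[OF x]] .
  define m where "m = \<gamma> (d x (\<rho> g x) / 2)"
  have m: "m \<in> M" unfolding m_def by (rule geodesic_path_mem[OF \<gamma>]) simp
  have le: "d m (\<rho> g m) \<le> max 0 (d x (\<rho> g (\<rho> g x)) - d x (\<rho> g x))"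
    unfolding m_def by (rule displacement_midpoint_le[OF fp M iso x \<gamma>])
  then show "\<exists>m\<in>M. d m (\<rho> g m) \<le> max 0 (d x (\<rho> g (\<rho> g x)) - d x (\<rho> g x))" using m by blast
  have ge: "max 0 (d x (\<rho> g (\<rho> g x)) - d x (\<rho> g x)) \<le> d y (\<rho> g y)" if "y \<in> M" for y
    using displacement_ge[OF fp M iso x that] by simp
  have "(INF y\<in>M. d y (\<rho> g y)) = max 0 (d x (\<rho> g (\<rho> g x)) - d x (\<rho> g x))"
  proof (rule antisym)
    have "(INF y\<in>M. d y (\<rho> g y)) \<le> d m (\<rho> g m)"
      by (rule cINF_lower[OF _ m]) (auto intro!: bdd_belowI[of _ 0])
    then show "(INF y\<in>M. d y (\<rho> g y)) \<le> max 0 (d x (\<rho> g (\<rho> g x)) - d x (\<rho> g x))" using le by linarith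
    show "max 0 (d x (\<rho> g (\<rho> g x)) - d x (\<rho> g x)) \<le> (INF y\<in>M. d y (\<rho> g y))"
      using ge x by (intro cINF_greatest) auto
  qed
  then show "translation_length F M d \<rho> g = max 0 (d x (\<rho> g (\<rho> g x)) - d x (\<rho> g x))"
    using g by (simp add: translation_length_def)
qed

lemma cv_pos:
  assumes "l \<in> cv F" "g \<in> carrier F" "g \<noteq> \<one>\<^bsub>F\<^esub>"
  shows "l g > 0"
proof -
  obtain M :: "real set" and d \<rho> where *: "l = translation_length F M d \<rho>" "real_tree M d"
    "isometric_action F M d \<rho>" "free_action F M \<rho>" using assms(1) by (auto simp: cv_def)
  interpret Metric_space M d using * by (simp add: real_tree_def)
  interpret group_action F M \<rho> using * by (simp add: isometric_action_def)
  obtain x where x: "x \<in> M" using * by (auto simp: real_tree_def)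
  obtain m where m: "m \<in> M" "d m (\<rho> g m) \<le> l g"
    using translation_length_real_tree[OF *(2,3) assms(2) x] * by auto
  have "\<rho> g m \<in> M" using element_image[OF assms(2) m(1)] by simp
  moreover have "\<rho> g m \<noteq> m" using * assms m by (auto simp: free_action_def)
  ultimately have "d m (\<rho> g m) > 0" using m by (simp add: mdist_pos_less)
  then show ?thesis using m by linarith
qed

section \<open>The tree spanned by a zero-hyperbolic space\<close>

text \<open>A point at distance \<^term>\<open>s\<close> from \<^term>\<open>g\<close> on a segment from \<^term>\<open>g\<close> to \<^term>\<open>h\<close> is encoded
  by \<^term>\<open>(g, h, s)\<close>.  In a tree the distance of two such points is the largest of the four
  numbers obtained by subtracting, from the distance of an end of the first and an end of
  the second segment, the distances of the points to these ends.\<close>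

definition seg_ends :: "('s \<Rightarrow> 's \<Rightarrow> real) \<Rightarrow> 's \<times> 's \<times> real \<Rightarrow> ('s \<times> real) set" where
  "seg_ends D = (\<lambda>(g, h, s). {(g, s), (h, D g h - s)})"

definition seg_dist :: "('s \<Rightarrow> 's \<Rightarrow> real) \<Rightarrow> 's \<times> 's \<times> real \<Rightarrow> 's \<times> 's \<times> real \<Rightarrow> real" where
  "seg_dist D p q = Max ((\<lambda>((a, \<alpha>), (b, \<beta>)). D a b - \<alpha> - \<beta>) ` (seg_ends D p \<times> seg_ends D q))"

definition seg_points :: "'s set \<Rightarrow> ('s \<Rightarrow> 's \<Rightarrow> real) \<Rightarrow> ('s \<times> 's \<times> real) set" where
  "seg_points S D = {(g, h, s). g \<in> S \<and> h \<in> S \<and> 0 \<le> s \<and> s \<le> D g h}"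

lemma seg_dist_ge:
  assumes "(a, \<alpha>) \<in> seg_ends D p" "(b, \<beta>) \<in> seg_ends D q"
  shows "D a b - \<alpha> - \<beta> \<le> seg_dist D p q"
  unfolding seg_dist_def
  by (rule Max_ge) (use assms in \<open>auto simp: seg_ends_def split: prod.splits intro!: rev_image_eqI\<close>)

lemma seg_dist_attained:
  obtains a \<alpha> b \<beta> where "(a, \<alpha>) \<in> seg_ends D p" "(b, \<beta>) \<in> seg_ends D q"
    "seg_dist D p q = D a b - \<alpha> - \<beta>"
proof -
  have "seg_dist D p q \<in> (\<lambda>((a, \<alpha>), (b, \<beta>)). D a b - \<alpha> - \<beta>) ` (seg_ends D p \<times> seg_ends D q)"
    unfolding seg_dist_def by (rule Max_in) (auto simp: seg_ends_def split: prod.splits)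
  then show thesis using that by auto
qed

lemma seg_dist_leI:
  assumes "\<And>a \<alpha> b \<beta>. (a, \<alpha>) \<in> seg_ends D p \<Longrightarrow> (b, \<beta>) \<in> seg_ends D q \<Longrightarrow> D a b - \<alpha> - \<beta> \<le> c"
  shows "seg_dist D p q \<le> c"
  using assms seg_dist_attained by metis

lemma four_point_nonneg:
  assumes "four_point S D" "\<And>x. x \<in> S \<Longrightarrow> D x x = 0" "x \<in> S" "y \<in> S"
  shows "D x y \<ge> 0"
  using four_pointD[OF assms(1) assms(3,3,4,4)] assms(2)[OF assms(3)] assms(2)[OF assms(4)] by auto

lemma four_point_triangle:
  assumes "four_point S D" "\<And>x. x \<in> S \<Longrightarrow> D x x = 0" "\<And>x y. x \<in> S \<Longrightarrow> y \<in> S \<Longrightarrow> D x y = D y x"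
    "x \<in> S" "y \<in> S" "z \<in> S"
  shows "D x z \<le> D x y + D y z"
  using four_pointD[OF assms(1,4,6,5,5)] assms(2)[OF assms(5)] assms(3)[OF assms(5,6)] by auto

text \<open>\<open>D\<close> may vanish at distinct points, and a point of the tree has many
  encodings in \<open>P\<close>. Both identifications are deferred to \<open>code\<close>.\<close>

locale zero_hyperbolic =
  fixes S :: "'s set" and D :: "'s \<Rightarrow> 's \<Rightarrow> real"
  assumes four_point: "four_point S D"
    and zero: "x \<in> S \<Longrightarrow> D x x = 0"
    and sym: "x \<in> S \<Longrightarrow> y \<in> S \<Longrightarrow> D x y = D y x"
begin

abbreviation "P \<equiv> seg_points S D"
abbreviation "\<Delta> \<equiv> seg_dist D"

lemma nonneg: "x \<in> S \<Longrightarrow> y \<in> S \<Longrightarrow> D x y \<ge> 0"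
  using four_point_nonneg[OF four_point zero] .

lemma seg_ends_mem: "p \<in> P \<Longrightarrow> (a, \<alpha>) \<in> seg_ends D p \<Longrightarrow> a \<in> S \<and> \<alpha> \<ge> 0"
  by (auto simp: seg_points_def seg_ends_def)

lemma seg_dist_sym: "p \<in> P \<Longrightarrow> q \<in> P \<Longrightarrow> \<Delta> p q = \<Delta> q p"
proof -
  have "\<Delta> p q \<le> \<Delta> q p" if "p \<in> P" "q \<in> P" for p q
  proof (rule seg_dist_leI)
    fix a \<alpha> b \<beta> assume *: "(a, \<alpha>) \<in> seg_ends D p" "(b, \<beta>) \<in> seg_ends D q"
    then have "D a b = D b a" using seg_ends_mem that sym by blast
    then show "D a b - \<alpha> - \<beta> \<le> \<Delta> q p" using seg_dist_ge[OF *(2,1)] by simp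
  qed
  then show "p \<in> P \<Longrightarrow> q \<in> P \<Longrightarrow> \<Delta> p q = \<Delta> q p" by (meson antisym)
qed

lemma seg_dist_zero: "p \<in> P \<Longrightarrow> \<Delta> p p = 0"
proof (rule antisym)
  assume p: "p \<in> P"
  obtain g h s where *: "p = (g, h, s)" by (cases p)
  have "g \<in> S" "h \<in> S" using p * by (auto simp: seg_points_def)
  then show "\<Delta> p p \<le> 0"
    by (intro seg_dist_leI) (use p * sym[of g h] zero[of g] zero[of h] in \<open>auto simp: seg_ends_def seg_points_def\<close>)
  show "0 \<le> \<Delta> p p"
    using seg_dist_ge[of g s D p h "D g h - s" p] * by (simp add: seg_ends_def)
qed

text \<open>The maximum in \<open>seg_dist\<close> makes this short: the two distances on the left
  are attained at four ends, \<open>D\<close> satisfies the condition there, and on the right the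
  ends give lower bounds for the distances in \<open>P\<close>.\<close>

lemma four_point_seg: "four_point P \<Delta>"
  unfolding four_point_def
proof (intro ballI)
  fix p q r t assume P: "p \<in> P" "q \<in> P" "r \<in> P" "t \<in> P"
  obtain a \<alpha> b \<beta> where 1: "(a, \<alpha>) \<in> seg_ends D p" "(b, \<beta>) \<in> seg_ends D q" "\<Delta> p q = D a b - \<alpha> - \<beta>"
    by (rule seg_dist_attained)
  obtain c \<gamma> e \<epsilon> where 2: "(c, \<gamma>) \<in> seg_ends D r" "(e, \<epsilon>) \<in> seg_ends D t" "\<Delta> r t = D c e - \<gamma> - \<epsilon>"
    by (rule seg_dist_attained)
  have "D a b + D c e \<le> max (D a c + D b e) (D a e + D b c)"
    by (rule four_pointD[OF four_point]) (use 1 2 P seg_ends_mem in blast)+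
  then show "\<Delta> p q + \<Delta> r t \<le> max (\<Delta> p r + \<Delta> q t) (\<Delta> p t + \<Delta> q r)"
    using seg_dist_ge[OF 1(1) 2(1)] seg_dist_ge[OF 1(1) 2(2)] seg_dist_ge[OF 1(2) 2(1)] seg_dist_ge[OF 1(2) 2(2)]
    by (auto simp: 1(3) 2(3))
qed

lemma seg_dist_nonneg: "p \<in> P \<Longrightarrow> q \<in> P \<Longrightarrow> \<Delta> p q \<ge> 0"
  using four_point_nonneg[OF four_point_seg seg_dist_zero] .

lemma seg_dist_triangle: "p \<in> P \<Longrightarrow> q \<in> P \<Longrightarrow> r \<in> P \<Longrightarrow> \<Delta> p r \<le> \<Delta> p q + \<Delta> q r"
  using four_point_triangle[OF four_point_seg seg_dist_zero seg_dist_sym] .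

lemma vertex_mem: "a \<in> S \<Longrightarrow> (a, a, 0) \<in> P"
  by (simp add: seg_points_def zero)

lemma seg_ends_vertex: "a \<in> S \<Longrightarrow> seg_ends D (a, a, 0) = {(a, 0)}"
  by (simp add: seg_ends_def zero)

lemma seg_dist_vertices: "a \<in> S \<Longrightarrow> b \<in> S \<Longrightarrow> \<Delta> (a, a, 0) (b, b, 0) = D a b"
  by (simp add: seg_dist_def seg_ends_vertex)

text \<open>In a tree, a path from \<open>p\<close> to a point of a segment can be prolonged
  geodesically to at least one end of that segment.\<close>

lemma seg_dist_segment:
  assumes "a \<in> S" "b \<in> S"
  shows "\<Delta> p (a, b, s) = max (\<Delta> p (a, a, 0) - s) (\<Delta> p (b, b, 0) - (D a b - s))"
proof (rule antisym)
  show "\<Delta> p (a, b, s) \<le> max (\<Delta> p (a, a, 0) - s) (\<Delta> p (b, b, 0) - (D a b - s))"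
  proof (rule seg_dist_leI)
    fix c \<gamma> e \<epsilon> assume *: "(c, \<gamma>) \<in> seg_ends D p" "(e, \<epsilon>) \<in> seg_ends D (a, b, s)"
    then show "D c e - \<gamma> - \<epsilon> \<le> max (\<Delta> p (a, a, 0) - s) (\<Delta> p (b, b, 0) - (D a b - s))"
      using seg_dist_ge[OF *(1), of a 0 "(a, a, 0)"] seg_dist_ge[OF *(1), of b 0 "(b, b, 0)"] assms
      by (auto simp: seg_ends_vertex) (auto simp: seg_ends_def)
  qed
  obtain c \<gamma> e \<epsilon> where 1: "(c, \<gamma>) \<in> seg_ends D p" "(e, \<epsilon>) \<in> seg_ends D (a, a, 0)" "\<Delta> p (a, a, 0) = D c e - \<gamma> - \<epsilon>"
    by (rule seg_dist_attained)
  obtain c' \<gamma>' e' \<epsilon>' where 2: "(c', \<gamma>') \<in> seg_ends D p" "(e', \<epsilon>') \<in> seg_ends D (b, b, 0)" "\<Delta> p (b, b, 0) = D c' e' - \<gamma>' - \<epsilon>'"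
    by (rule seg_dist_attained)
  show "max (\<Delta> p (a, a, 0) - s) (\<Delta> p (b, b, 0) - (D a b - s)) \<le> \<Delta> p (a, b, s)"
    using 1 2 assms seg_dist_ge[OF 1(1), of a s "(a, b, s)"] seg_dist_ge[OF 2(1), of b "D a b - s" "(a, b, s)"]
    by (auto simp: seg_ends_vertex) (auto simp: seg_ends_def)
qed

lemma seg_dist_end:
  assumes "p \<in> P" "(a, \<alpha>) \<in> seg_ends D p"
  shows "\<Delta> p (a, a, 0) = \<alpha>"
proof -
  obtain g h s where p: "p = (g, h, s)" "g \<in> S" "h \<in> S" "0 \<le> s" "s \<le> D g h"
    using assms(1) by (auto simp: seg_points_def)
  then have "\<Delta> p (a, a, 0) = max (\<Delta> (a, a, 0) (g, g, 0) - s) (\<Delta> (a, a, 0) (h, h, 0) - (D g h - s))"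
    using seg_dist_segment[of g h "(a, a, 0)" s] seg_dist_sym[OF assms(1) vertex_mem] seg_ends_mem[OF assms] by simp
  also have "\<dots> = \<alpha>"
    using assms(2) p seg_ends_mem[OF assms] zero sym[of h g] by (auto simp: seg_dist_vertices seg_ends_def)
  finally show ?thesis .
qed

lemma seg_dist_same_segment:
  assumes "a \<in> S" "b \<in> S" "s \<in> {0..D a b}" "t \<in> {0..D a b}"
  shows "\<Delta> (a, b, s) (a, b, t) = \<bar>s - t\<bar>"
proof -
  have P: "(a, b, s) \<in> P" using assms by (simp add: seg_points_def)
  show ?thesis
    using assms seg_dist_segment[OF assms(1,2), of "(a, b, s)" t]
      seg_dist_end[OF P, of a s] seg_dist_end[OF P, of b "D a b - s"]
    by (auto simp: seg_ends_def)
qed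

text \<open>The ends that attain \<open>\<Delta> p q\<close> lie beyond \<open>p\<close> and beyond
  \<open>q\<close>, so the segment between them passes through both points. This yields geodesics
  without any concatenation.\<close>

lemma common_segment:
  assumes P: "p \<in> P" "q \<in> P"
  obtains a b \<alpha> where "a \<in> S" "b \<in> S" "0 \<le> \<alpha>" "\<alpha> + \<Delta> p q \<le> D a b"
    "\<Delta> p (a, b, \<alpha>) = 0" "\<Delta> q (a, b, \<alpha> + \<Delta> p q) = 0"
proof -
  obtain a \<alpha> b \<beta> where 1: "(a, \<alpha>) \<in> seg_ends D p" "(b, \<beta>) \<in> seg_ends D q" "\<Delta> p q = D a b - \<alpha> - \<beta>"
    by (rule seg_dist_attained)
  have S: "a \<in> S" "b \<in> S" "\<alpha> \<ge> 0" "\<beta> \<ge> 0" using seg_ends_mem P 1 by blast+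
  note e = seg_dist_end[OF P(1) 1(1)] seg_dist_end[OF P(2) 1(2)]
  have V: "(a, a, 0) \<in> P" "(b, b, 0) \<in> P" using S vertex_mem by auto
  have "\<Delta> p (b, b, 0) \<le> \<Delta> p q + \<beta>" using seg_dist_triangle[OF P V(2)] e by simp
  then have "\<Delta> p (a, b, \<alpha>) \<le> 0" using seg_dist_segment[OF S(1,2), of p \<alpha>] e 1(3) by simp
  moreover have "\<Delta> q (a, a, 0) \<le> \<Delta> p q + \<alpha>"
    using seg_dist_triangle[OF P(2,1) V(1)] e seg_dist_sym[OF P] by simp
  then have "\<Delta> q (a, b, \<alpha> + \<Delta> p q) \<le> 0" using seg_dist_segment[OF S(1,2), of q "\<alpha> + \<Delta> p q"] e 1(3) by simp
  moreover have "\<Delta> p q \<ge> 0" using seg_dist_nonneg P .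
  then have "(a, b, \<alpha>) \<in> P" "(a, b, \<alpha> + \<Delta> p q) \<in> P" using S 1(3) by (auto simp: seg_points_def)
  then have "\<Delta> p (a, b, \<alpha>) \<ge> 0" "\<Delta> q (a, b, \<alpha> + \<Delta> p q) \<ge> 0" using seg_dist_nonneg P by auto
  ultimately show thesis using that[of a b \<alpha>] S 1(3) by simp
qed

lemma seg_dist_cong:
  assumes "p \<in> P" "q \<in> P" "r \<in> P" "\<Delta> p q = 0"
  shows "\<Delta> p r = \<Delta> q r"
  using seg_dist_triangle[OF assms(1,2,3)] seg_dist_triangle[OF assms(2,1,3)] seg_dist_sym[OF assms(1,2)] assms(4)
  by simp

end

section \<open>The tree as a set of reals, with its group action\<close>

locale hyperbolic_group = group F + zero_hyperbolic "carrier F" D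
  for F :: "('a, 'b) monoid_scheme" (structure) and D :: "'a \<Rightarrow> 'a \<Rightarrow> real" +
  assumes countable: "countable (carrier F)"
    and left_inv: "k \<in> carrier F \<Longrightarrow> g \<in> carrier F \<Longrightarrow> h \<in> carrier F \<Longrightarrow> D (k \<otimes> g) (k \<otimes> h) = D g h"
begin

definition shift :: "'a \<Rightarrow> 'a \<times> 'a \<times> real \<Rightarrow> 'a \<times> 'a \<times> real" where
  "shift k = (\<lambda>(g, h, s). (k \<otimes> g, k \<otimes> h, s))"

lemma shift_mem: "k \<in> carrier F \<Longrightarrow> p \<in> P \<Longrightarrow> shift k p \<in> P"
  by (auto simp: seg_points_def shift_def left_inv)

lemma seg_ends_shift:
  assumes "k \<in> carrier F" "p \<in> P"
  shows "seg_ends D (shift k p) = (\<lambda>(a, \<alpha>). (k \<otimes> a, \<alpha>)) ` seg_ends D p"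
  using assms by (auto simp: seg_ends_def shift_def seg_points_def left_inv)

lemma seg_dist_shift:
  assumes k: "k \<in> carrier F" and P: "p \<in> P" "q \<in> P"
  shows "\<Delta> (shift k p) (shift k q) = \<Delta> p q"
proof (rule antisym; rule seg_dist_leI)
  fix a \<alpha> b \<beta>
  assume "(a, \<alpha>) \<in> seg_ends D (shift k p)" "(b, \<beta>) \<in> seg_ends D (shift k q)"
  then obtain a' b' where *: "(a', \<alpha>) \<in> seg_ends D p" "(b', \<beta>) \<in> seg_ends D q" "a = k \<otimes> a'" "b = k \<otimes> b'"
    using seg_ends_shift[OF k] P by auto
  then show "D a b - \<alpha> - \<beta> \<le> \<Delta> p q"
    using seg_dist_ge[OF *(1,2)] left_inv[OF k] seg_ends_mem P by metis
next
  fix a \<alpha> b \<beta>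
  assume *: "(a, \<alpha>) \<in> seg_ends D p" "(b, \<beta>) \<in> seg_ends D q"
  then have "(k \<otimes> a, \<alpha>) \<in> seg_ends D (shift k p)" "(k \<otimes> b, \<beta>) \<in> seg_ends D (shift k q)"
    unfolding seg_ends_shift[OF k P(1)] seg_ends_shift[OF k P(2)] by force+
  from seg_dist_ge[OF this] show "D a b - \<alpha> - \<beta> \<le> \<Delta> (shift k p) (shift k q)"
    using left_inv[OF k] seg_ends_mem[OF P(1) *(1)] seg_ends_mem[OF P(2) *(2)] by simp
qed

lemma shift_mult:
  "k \<in> carrier F \<Longrightarrow> l \<in> carrier F \<Longrightarrow> p \<in> P \<Longrightarrow> shift (k \<otimes> l) p = shift k (shift l p)"
  by (auto simp: shift_def seg_points_def m_assoc)

lemma shift_one: "p \<in> P \<Longrightarrow> shift \<one> p = p"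
  by (auto simp: shift_def seg_points_def)

text \<open>The integer part stores the pair of group elements, and the fractional part
  \<open>s / (1 + s)\<close>, which lies below 1, stores the position. An injection into the reals
  is wanted because \<open>cv\<close> takes its trees from the type \<open>real\<close>.\<close>

lemma ex_inj_real: "\<exists>c :: 'a \<times> 'a \<times> real \<Rightarrow> real. inj_on c P"
proof -
  define e where "e = to_nat_on (carrier F \<times> carrier F)"
  define c where "c = (\<lambda>(g, h, s). real (e (g, h)) + s / (1 + s))"
  have "inj_on c P"
  proof (rule inj_onI)
    fix p q assume P: "p \<in> P" "q \<in> P" and eq: "c p = c q"
    obtain g h s g' h' s' where [simp]: "p = (g, h, s)" "q = (g', h', s')" by (metis prod_cases3)
    have s: "0 \<le> s" "0 \<le> s'" "g \<in> carrier F" "h \<in> carrier F" "g' \<in> carrier F" "h' \<in> carrier F"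
      using P by (auto simp: seg_points_def)
    have fl: "\<lfloor>real n + r / (1 + r)\<rfloor> = int n" if "r \<ge> 0" for n :: nat and r :: real
      proof -
      have "0 \<le> r / (1 + r)" "r / (1 + r) < 1" using that by (simp_all add: divide_simps)
      then show ?thesis by (intro floor_unique) auto
    qed
    have "int (e (g, h)) = \<lfloor>c p\<rfloor>" using fl[OF s(1), of "e (g, h)"] by (simp add: c_def)
    also have "\<dots> = int (e (g', h'))" unfolding eq using fl[OF s(2), of "e (g', h')"] by (simp add: c_def)
    finally have ee: "e (g, h) = e (g', h')" by simp
    then have "(g, h) = (g', h')"
      unfolding e_def by (subst (asm) to_nat_on_inj) (auto intro: countable_SIGMA countable s)
    moreover have "s / (1 + s) = s' / (1 + s')" using eq ee by (simp add: c_def)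
    then have "s = s'" using s by (simp add: field_simps)
    ultimately show "p = q" by simp
  qed
  then show ?thesis by blast
qed

text \<open>The inner choice depends only on the class of \<open>p\<close> under distance 0, because
  equal predicates have equal choices; so \<open>code\<close> is the quotient map to a metric space,
  followed by an injection into the reals.\<close>

definition code :: "'a \<times> 'a \<times> real \<Rightarrow> real" where
  "code p = (SOME c. inj_on c P) (SOME q. q \<in> P \<and> \<Delta> p q = 0)"

definition decode :: "real \<Rightarrow> 'a \<times> 'a \<times> real" where
  "decode x = (SOME p. p \<in> P \<and> code p = x)"

lemma code_eq_iff:
  assumes P: "p \<in> P" "q \<in> P"
  shows "code p = code q \<longleftrightarrow> \<Delta> p q = 0"
proof -
  define rep where "rep p = (SOME q. q \<in> P \<and> \<Delta> p q = 0)" for p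
  have rep: "rep p \<in> P \<and> \<Delta> p (rep p) = 0" if "p \<in> P" for p
    unfolding rep_def by (rule someI) (use that seg_dist_zero in blast)
  have "code p = code q \<longleftrightarrow> rep p = rep q"
    unfolding code_def rep_def[symmetric]
    using inj_onD[OF someI_ex[OF ex_inj_real], of "rep p" "rep q"] rep P by metis
  also have "\<dots> \<longleftrightarrow> \<Delta> p q = 0"
  proof
    assume "rep p = rep q"
    then show "\<Delta> p q = 0"
      using seg_dist_cong[of p "rep p" q] rep[of p] rep[of q] P seg_dist_sym[of q "rep q"] by simp
  next
    assume "\<Delta> p q = 0"
    then have "(\<lambda>r. r \<in> P \<and> \<Delta> p r = 0) = (\<lambda>r. r \<in> P \<and> \<Delta> q r = 0)"
      using seg_dist_cong[OF P] by auto
    then show "rep p = rep q" by (simp add: rep_def)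
  qed
  finally show ?thesis .
qed

definition tree :: "real set" where "tree = code ` P"

text \<open>The value 0 off the carrier is there because \<open>Metric_space\<close> asks for
  nonnegativity and symmetry on the whole type.\<close>

definition tree_dist :: "real \<Rightarrow> real \<Rightarrow> real" where
  "tree_dist x y = (if x \<in> tree \<and> y \<in> tree then \<Delta> (decode x) (decode y) else 0)"

text \<open>Restricted to \<open>tree\<close>, because the elements of \<open>BijGroup\<close> are
  extensional.\<close>

definition tree_act :: "'a \<Rightarrow> real \<Rightarrow> real" where
  "tree_act k = (\<lambda>x\<in>tree. code (shift k (decode x)))"

lemma decode_code:
  assumes "p \<in> P"
  shows "decode (code p) \<in> P" "\<Delta> (decode (code p)) p = 0"
proof -
  have *: "decode (code p) \<in> P \<and> code (decode (code p)) = code p"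
    unfolding decode_def by (rule someI) (use assms in blast)
  then show "decode (code p) \<in> P" "\<Delta> (decode (code p)) p = 0" using code_eq_iff[of "decode (code p)" p] assms by blast+
qed

lemma code_mem: "p \<in> P \<Longrightarrow> code p \<in> tree" by (simp add: tree_def)

lemma tree_dist_code:
  assumes "p \<in> P" "q \<in> P"
  shows "tree_dist (code p) (code q) = \<Delta> p q"
proof -
  note p = decode_code[OF assms(1)] and q = decode_code[OF assms(2)]
  have "\<Delta> (decode (code p)) (decode (code q)) = \<Delta> p (decode (code q))"
    by (rule seg_dist_cong[OF p(1) assms(1) q(1) p(2)])
  also have "\<dots> = \<Delta> p q"
    using seg_dist_cong[OF q(1) assms(2,1) q(2)] seg_dist_sym assms q(1) by metis
  finally show ?thesis using assms by (simp add: tree_dist_def code_mem)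
qed

lemma tree_act_code:
  assumes "k \<in> carrier F" "p \<in> P"
  shows "tree_act k (code p) = code (shift k p)"
proof -
  note p = decode_code[OF assms(2)]
  have "code (shift k (decode (code p))) = code (shift k p)"
    using assms p by (subst code_eq_iff) (auto simp: shift_mem seg_dist_shift)
  then show ?thesis using assms by (simp add: tree_act_def code_mem)
qed

lemma tree_cases:
  assumes "x \<in> tree" obtains p where "p \<in> P" "x = code p"
  using assms by (auto simp: tree_def)

lemma metric_tree: "Metric_space tree tree_dist"
proof
  fix x y
  show "0 \<le> tree_dist x y"
    by (auto simp: tree_dist_def intro!: seg_dist_nonneg elim!: tree_cases intro: decode_code)
  show "tree_dist x y = tree_dist y x"
    by (auto simp: tree_dist_def intro!: seg_dist_sym elim!: tree_cases intro: decode_code)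
next
  fix x y assume "x \<in> tree" "y \<in> tree"
  then show "(tree_dist x y = 0) = (x = y)"
    by (elim tree_cases) (simp add: tree_dist_code code_eq_iff)
next
  fix x y z assume "x \<in> tree" "y \<in> tree" "z \<in> tree"
  then show "tree_dist x z \<le> tree_dist x y + tree_dist y z"
    by (elim tree_cases) (simp add: tree_dist_code seg_dist_triangle)
qed

lemma four_point_tree: "four_point tree tree_dist"
  unfolding four_point_def
  by (intro ballI; elim tree_cases) (simp add: tree_dist_code four_pointD[OF four_point_seg])

lemma base_mem: "(\<one>, \<one>, 0) \<in> P" by (simp add: vertex_mem)

lemma real_tree_tree: "real_tree tree tree_dist"
proof (rule real_treeI[OF metric_tree _ four_point_tree])
  show "tree \<noteq> {}" using base_mem by (auto simp: tree_def)
  fix x y assume "x \<in> tree" "y \<in> tree"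
  then obtain p q where P: "p \<in> P" "q \<in> P" and xy: "x = code p" "y = code q" by (auto elim!: tree_cases)
  obtain a b \<alpha> where ab: "a \<in> carrier F" "b \<in> carrier F" "0 \<le> \<alpha>" "\<alpha> + \<Delta> p q \<le> D a b"
    "\<Delta> p (a, b, \<alpha>) = 0" "\<Delta> q (a, b, \<alpha> + \<Delta> p q) = 0" using common_segment[OF P] by metis
  define \<gamma> where "\<gamma> t = code (a, b, \<alpha> + t)" for t
  have mem: "(a, b, \<alpha> + t) \<in> P" if "t \<in> {0..\<Delta> p q}" for t
    using ab that by (simp add: seg_points_def)
  have d: "tree_dist x y = \<Delta> p q" "\<Delta> p q \<ge> 0" using P seg_dist_nonneg by (auto simp: xy tree_dist_code)
  have "geodesic_path tree tree_dist \<gamma> x y"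
    unfolding geodesic_path_def
  proof (intro conjI ballI)
    show "\<gamma> 0 = x" "\<gamma> (tree_dist x y) = y"
      using code_eq_iff[OF P(1) mem[of 0]] code_eq_iff[OF P(2) mem[of "\<Delta> p q"]] ab d
      by (auto simp: \<gamma>_def xy(1) d(1)) (simp add: xy)
    show "\<gamma> ` {0..tree_dist x y} \<subseteq> tree" using mem d by (auto simp: \<gamma>_def code_mem)
    fix s t assume "s \<in> {0..tree_dist x y}" "t \<in> {0..tree_dist x y}"
    then show "tree_dist (\<gamma> s) (\<gamma> t) = \<bar>s - t\<bar>"
      using mem[of s] mem[of t] ab seg_dist_same_segment[of a b "\<alpha> + s" "\<alpha> + t"] d
      by (simp add: \<gamma>_def tree_dist_code)
  qed
  then show "\<exists>S. geodesic_segment tree tree_dist x y S" unfolding geodesic_segment_iff by blast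
qed

lemma tree_act_mem: "k \<in> carrier F \<Longrightarrow> x \<in> tree \<Longrightarrow> tree_act k x \<in> tree"
  by (elim tree_cases) (simp add: tree_act_code shift_mem code_mem)

lemma tree_act_mult:
  "k \<in> carrier F \<Longrightarrow> l \<in> carrier F \<Longrightarrow> x \<in> tree \<Longrightarrow> tree_act (k \<otimes> l) x = tree_act k (tree_act l x)"
  by (elim tree_cases) (simp add: tree_act_code shift_mem shift_mult)

lemma tree_act_one: "x \<in> tree \<Longrightarrow> tree_act \<one> x = x"
  by (elim tree_cases) (simp add: tree_act_code shift_one)

lemma tree_act_isometry:
  "k \<in> carrier F \<Longrightarrow> x \<in> tree \<Longrightarrow> y \<in> tree \<Longrightarrow> tree_dist (tree_act k x) (tree_act k y) = tree_dist x y"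
  by (elim tree_cases) (simp add: tree_act_code shift_mem tree_dist_code seg_dist_shift)

lemma isometric_tree_act: "isometric_action F tree tree_dist tree_act"
  unfolding isometric_action_def
proof (intro conjI ballI)
  have Bij: "tree_act k \<in> Bij tree" if k: "k \<in> carrier F" for k
  proof -
    have "bij_betw (tree_act k) tree tree"
      by (rule bij_betwI[where g = "tree_act (inv k)"])
        (use k in \<open>auto simp: tree_act_mem tree_act_one simp flip: tree_act_mult\<close>)
    then show ?thesis by (simp add: Bij_def tree_act_def)
  qed
  show "group_action F tree tree_act"
  proof (intro group_action.intro group_hom.intro is_group group_BijGroup group_hom_axioms.intro homI)
    fix k l assume *: "k \<in> carrier F" "l \<in> carrier F"
    have "tree_act (k \<otimes> l) = compose tree (tree_act k) (tree_act l)"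
      using * by (auto simp: compose_def fun_eq_iff tree_act_mult) (simp add: tree_act_def)
    then show "tree_act (k \<otimes> l) = tree_act k \<otimes>\<^bsub>BijGroup tree\<^esub> tree_act l"
      using * Bij by (simp add: BijGroup_def)
  qed (simp add: BijGroup_def Bij)
qed (simp add: tree_act_isometry)

lemma vertex_orbit:
  assumes "k \<in> carrier F"
  shows "tree_act k (code (\<one>, \<one>, 0)) = code (k, k, 0)"
  using assms base_mem by (simp add: tree_act_code shift_def)

lemma translation_length_tree:
  assumes g: "g \<in> carrier F"
  shows "translation_length F tree tree_dist tree_act g = max 0 (D \<one> (g \<otimes> g) - D \<one> g)"
proof -
  let ?x = "code (\<one>, \<one>, 0)"
  have "tree_act g ?x = code (g, g, 0)" "tree_act g (tree_act g ?x) = code (g \<otimes> g, g \<otimes> g, 0)"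
    using vertex_orbit[OF g] g vertex_mem by (simp_all add: tree_act_code shift_def)
  then have "tree_dist ?x (tree_act g ?x) = D \<one> g" "tree_dist ?x (tree_act g (tree_act g ?x)) = D \<one> (g \<otimes> g)"
    using g base_mem by (simp_all add: vertex_mem tree_dist_code seg_dist_vertices)
  then show ?thesis
    using translation_length_real_tree(1)[OF real_tree_tree isometric_tree_act g code_mem[OF base_mem]] by simp
qed

lemma displacement_tree_ge:
  assumes "g \<in> carrier F" "x \<in> tree"
  shows "D \<one> (g \<otimes> g) - D \<one> g \<le> tree_dist x (tree_act g x)"
proof -
  interpret T: Metric_space tree tree_dist by (rule metric_tree)
  have "translation_length F tree tree_dist tree_act g \<le> tree_dist x (tree_act g x)"
    using assms by (auto simp: translation_length_def intro!: cINF_lower bdd_belowI[of _ 0])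
  then show ?thesis using assms by (simp add: translation_length_tree)
qed

text \<open>Since \<^term>\<open>u\<close> and \<^term>\<open>v\<close> may be taken far away from \<^term>\<open>g\<close> and \<^term>\<open>h\<close>, the segment from
  \<^term>\<open>g\<close> to \<^term>\<open>h\<close> also lies between the translates by \<^term>\<open>u\<close> and \<^term>\<open>v\<close> of any point.\<close>

lemma minimal_tree_act:
  assumes ext: "\<And>g h R. g \<in> carrier F \<Longrightarrow> h \<in> carrier F \<Longrightarrow> \<exists>u\<in>carrier F. \<exists>v\<in>carrier F.
      D u v = D u g + D g h + D h v \<and> D u g > R \<and> D h v > R"
  shows "minimal_action F tree tree_dist tree_act"
  unfolding minimal_action_def
proof (intro allI impI, elim conjE)
  interpret T: Metric_space tree tree_dist by (rule metric_tree)
  note fp = four_pointD[OF four_point_tree]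
  fix N assume N: "N \<subseteq> tree" "real_tree N tree_dist" "\<forall>g\<in>carrier F. tree_act g ` N \<subseteq> N"
  obtain p where p: "p \<in> N" using N(2) by (auto simp: real_tree_def)
  let ?o = "code (\<one>, \<one>, 0)"
  \<comment> \<open>By equivariance, every vertex \<open>code (k, k, 0)\<close> is at distance
    \<open>R\<close> from the translate of \<open>p\<close> by \<open>k\<close>. Hence
    \<open>u\<close> and \<open>v\<close> have to be farther than \<open>R\<close> from the
    segment.\<close>
  define R where "R = tree_dist ?o p"
  have "q \<in> N" if "q \<in> tree" for q
  proof -
    obtain g h s where q: "q = code (g, h, s)" "(g, h, s) \<in> P"
      using tree_cases[OF \<open>q \<in> tree\<close>] by (metis prod_cases3)
    then have gh: "g \<in> carrier F" "h \<in> carrier F" "0 \<le> s" "s \<le> D g h" by (auto simp: seg_points_def)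
    obtain u v where uv: "u \<in> carrier F" "v \<in> carrier F" "D u v = D u g + D g h + D h v" "D u g > R" "D h v > R"
      using ext gh by metis
    let ?u = "code (u, u, 0)" and ?v = "code (v, v, 0)"
    have qu: "tree_dist q ?u \<ge> D u g + s" "tree_dist q ?v \<ge> D h v + (D g h - s)" "tree_dist q ?u + tree_dist q ?v = D u v"
    proof -
      have 1: "tree_dist q (code (w, w, 0)) = max (D w g - s) (D w h - (D g h - s))" if w: "w \<in> carrier F" for w
      proof -
        have "tree_dist q (code (w, w, 0)) = \<Delta> (w, w, 0) (g, h, s)"
          unfolding q(1) tree_dist_code[OF q(2) vertex_mem[OF w]] by (rule seg_dist_sym[OF q(2) vertex_mem[OF w]])
        then show ?thesis by (simp add: seg_dist_segment[OF gh(1,2)] seg_dist_vertices gh(1,2) w)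
      qed
      have tri: "D a c \<le> D a b + D b c" if "a \<in> carrier F" "b \<in> carrier F" "c \<in> carrier F" for a b c
        using four_point_triangle[OF four_point zero sym that] .
      note 2 = tri[OF uv(1) gh(1,2)] tri[OF uv(1) gh(2) uv(2)] tri[OF gh(1,2) uv(2)] tri[OF uv(1) gh(1) uv(2)]
      have 3: "D v h = D h v" "D v g = D g v" using sym uv gh by auto
      show "tree_dist q ?u \<ge> D u g + s" "tree_dist q ?v \<ge> D h v + (D g h - s)" "tree_dist q ?u + tree_dist q ?v = D u v"
        using 2 3 uv gh by (auto simp: 1)
    qed
    have M: "?u \<in> tree" "?v \<in> tree" "p \<in> tree" "?o \<in> tree" using uv vertex_mem base_mem p N by (auto simp: code_mem)
    define up where "up = tree_act u p"
    define vp where "vp = tree_act v p"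
    have upvp: "up \<in> N" "vp \<in> N" "up \<in> tree" "vp \<in> tree" using p N uv tree_act_mem by (auto simp: up_def vp_def)
    have du: "tree_dist ?u up = R" "tree_dist ?v vp = R"
      using tree_act_isometry[OF uv(1) M(4,3)] tree_act_isometry[OF uv(2) M(4,3)] uv
      by (simp_all add: vertex_orbit up_def vp_def R_def)
    have duv: "tree_dist ?u ?v = D u v" using uv vertex_mem by (simp add: tree_dist_code seg_dist_vertices)
    have "D u v + tree_dist up q \<le> max (R + tree_dist q ?v) (tree_dist q ?u + tree_dist up ?v)"
      using fp[OF M(1,2) upvp(3) \<open>q \<in> tree\<close>] du duv by (auto simp: T.commute)
    moreover have "tree_dist up q \<ge> tree_dist q ?u - R"
      using T.triangle[OF \<open>q \<in> tree\<close> upvp(3) M(1)] du by (simp add: T.commute)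
    ultimately have 4: "tree_dist up ?v \<ge> tree_dist up q + tree_dist q ?v"
      using qu uv gh by (auto simp: T.commute)
    have "tree_dist up ?v + tree_dist vp q \<le> max (tree_dist up vp + tree_dist q ?v) (tree_dist up q + R)"
      using fp[OF upvp(3) M(2) upvp(4) \<open>q \<in> tree\<close>] du by (auto simp: T.commute)
    moreover have "tree_dist vp q \<ge> tree_dist q ?v - R"
      using T.triangle[OF \<open>q \<in> tree\<close> upvp(4) M(2)] du by (simp add: T.commute)
    ultimately have "tree_dist up vp \<ge> tree_dist up q + tree_dist q vp"
      using 4 qu uv gh by (auto simp: T.commute)
    then have between: "tree_dist up vp = tree_dist up q + tree_dist q vp"
      using T.triangle[OF upvp(3) \<open>q \<in> tree\<close> upvp(4)] by simp
    interpret N: Metric_space N tree_dist using N(2) by (simp add: real_tree_def)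
    obtain \<gamma> where \<gamma>: "geodesic_path N tree_dist \<gamma> up vp" using real_tree_geodesic_path[OF N(2) upvp(1,2)] .
    define m where "m = \<gamma> (tree_dist up q)"
    have t: "tree_dist up q \<in> {0..tree_dist up vp}" using between by simp
    have m: "m \<in> N" "tree_dist up m = tree_dist up q" "tree_dist m vp = tree_dist q vp"
      using geodesic_path_mem[OF \<gamma> t] N.geodesic_path_ends[OF \<gamma> t] between by (auto simp: m_def)
    \<comment> \<open>The geodesic was taken inside \<open>N\<close>. A point between
      \<open>up\<close> and \<open>vp\<close> is determined by its distances to them, so
      \<open>m = q\<close>.\<close>
    have "tree_dist m q + tree_dist up vp \<le> max (tree_dist m up + tree_dist q vp) (tree_dist m vp + tree_dist q up)"
      by (rule fp) (use m N upvp that in auto)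
    then have "tree_dist m q \<le> 0" using m between by (simp add: T.commute)
    then have "m = q" using m(1) N(1) that by (metis T.nonneg T.zero antisym subsetD)
    then show "q \<in> N" using m by simp
  qed
  then show "N = tree" using N by blast
qed

text \<open>The uniform bound \<epsilon> serves twice: every nontrivial element moves every point by
  at least \<epsilon>, so the action is free, and distinct points of an orbit are at least
  \<epsilon> apart, so it is discrete.\<close>

theorem length_function_mem_cv:
  assumes ext: "\<And>g h R. g \<in> carrier F \<Longrightarrow> h \<in> carrier F \<Longrightarrow> \<exists>u\<in>carrier F. \<exists>v\<in>carrier F.
      D u v = D u g + D g h + D h v \<and> D u g > R \<and> D h v > R"
    and pos: "\<epsilon> > 0" "\<And>g. g \<in> carrier F \<Longrightarrow> g \<noteq> \<one> \<Longrightarrow> D \<one> (g \<otimes> g) - D \<one> g \<ge> \<epsilon>"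
  shows "(\<lambda>g\<in>carrier F. D \<one> (g \<otimes> g) - D \<one> g) \<in> cv F"
proof -
  interpret T: Metric_space tree tree_dist by (rule metric_tree)
  have move: "tree_dist x (tree_act g x) \<ge> \<epsilon>" if "g \<in> carrier F" "x \<in> tree" "g \<noteq> \<one>" for g x
    using displacement_tree_ge[OF that(1,2)] pos(2)[OF that(1,3)] by linarith
  have "translation_length F tree tree_dist tree_act = (\<lambda>g\<in>carrier F. D \<one> (g \<otimes> g) - D \<one> g)"
  proof
    fix g
    show "translation_length F tree tree_dist tree_act g = (\<lambda>g\<in>carrier F. D \<one> (g \<otimes> g) - D \<one> g) g"
    proof (cases "g \<in> carrier F")
      case True
      moreover have "D \<one> (g \<otimes> g) - D \<one> g \<ge> 0"
        using pos(1) pos(2)[of g] True zero[of \<one>] by (cases "g = \<one>") force+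
      ultimately show ?thesis by (simp add: translation_length_tree)
    qed (simp add: translation_length_def)
  qed
  moreover have "free_action F tree tree_act"
    unfolding free_action_def using move pos(1) by force
  moreover have "discrete_action F tree tree_dist tree_act"
    unfolding discrete_action_def
  proof
    fix x assume x: "x \<in> tree"
    let ?O = "orbit F tree_act x"
    have O: "?O \<subseteq> tree" using x tree_act_mem by (auto simp: orbit_def)
    have sep: "y = z" if yz: "y \<in> ?O" "z \<in> ?O" "tree_dist y z < \<epsilon>" for y z
    proof -
      obtain g h where gh: "g \<in> carrier F" "h \<in> carrier F" "y = tree_act g x" "z = tree_act h x"
        using yz by (auto simp: orbit_def)
      have "tree_dist y z = tree_dist x (tree_act (inv g \<otimes> h) x)"
        using tree_act_isometry[of g x "tree_act (inv g \<otimes> h) x"] gh x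
        by (simp add: tree_act_mem inv_solve_left' flip: tree_act_mult m_assoc)
      then have "inv g \<otimes> h = \<one>" using move[of "inv g \<otimes> h" x] gh x yz(3) by force
      then show ?thesis using gh by (metis inv_closed inv_equality inv_inv)
    qed
    have "openin (subtopology T.mtopology ?O) {y}" if y: "y \<in> ?O" for y
    proof -
      have "{y} = T.mball y \<epsilon> \<inter> ?O" using y O sep[OF y, symmetric] pos(1) by (auto simp: T.in_mball)
      then show ?thesis by (auto simp: openin_subtopology)
    qed
    then have "discrete_topology ?O = subtopology T.mtopology ?O"
      unfolding discrete_topology_unique using O by (auto simp: Int_absorb1)
    then show "subtopology T.mtopology ?O = discrete_topology ?O" by simp
  qed
  ultimately show ?thesis
    unfolding cv_def using real_tree_tree isometric_tree_act minimal_tree_act[OF ext]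
    by (intro CollectI exI[of _ tree] exI[of _ tree_dist] exI[of _ tree_act]) auto
qed

end

section \<open>Free groups and their Cayley trees\<close>

definition linv :: "'a \<times> bool \<Rightarrow> 'a \<times> bool" where
  "linv l = (fst l, \<not> snd l)"

definition winv :: "('a \<times> bool) list \<Rightarrow> ('a \<times> bool) list" where
  "winv w = rev (map linv w)"

definition lcons :: "'a \<times> bool \<Rightarrow> ('a \<times> bool) list \<Rightarrow> ('a \<times> bool) list" where
  "lcons l w = (if w \<noteq> [] \<and> hd w = linv l then tl w else l # w)"

definition wt :: "('a \<Rightarrow> real) \<Rightarrow> ('a \<times> bool) list \<Rightarrow> real" where
  "wt L w = (\<Sum>l\<leftarrow>w. L (fst l))"

abbreviation "lcp \<equiv> longest_common_prefix"

lemma linv_linv [simp]: "linv (linv l) = l" by (simp add: linv_def)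
lemma fst_linv [simp]: "fst (linv l) = fst l" by (simp add: linv_def)
lemma linv_neq [simp]: "linv l \<noteq> l" "l \<noteq> linv l" by (auto simp: linv_def prod_eq_iff)
lemma linv_eq_iff [simp]: "linv l = linv m \<longleftrightarrow> l = m" by (metis linv_linv)

lemma winv_simps [simp]: "winv [] = []" "winv (l # w) = winv w @ [linv l]" "winv (u @ v) = winv v @ winv u"
  "winv (winv w) = w" "length (winv w) = length w" "winv w = [] \<longleftrightarrow> w = []" "fst ` set (winv w) = fst ` set w"
  by (auto simp: winv_def rev_map o_def image_image)

lemma wt_simps [simp]: "wt L [] = 0" "wt L (l # w) = L (fst l) + wt L w" "wt L (u @ v) = wt L u + wt L v"
  by (auto simp: wt_def)

lemma wt_winv [simp]: "wt L (winv w) = wt L w"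
  by (induction w) auto

lemma wt_one: "wt (\<lambda>_. 1) w = length w"
  by (induction w) auto

lemma wt_replicate [simp]: "wt L (replicate n l) = n * L (fst l)"
  by (induction n) (auto simp: algebra_simps)

lemma wt_nonneg: "(\<And>x. L x \<ge> 0) \<Longrightarrow> wt L w \<ge> 0"
  unfolding wt_def by (rule sum_list_nonneg) auto

lemma reduced_word_altdef: "reduced_word w \<longleftrightarrow> successively (\<lambda>l m. m \<noteq> linv l) w"
proof -
  have "(\<lambda>(x, b) (y, c). \<not> (x = y \<and> b \<noteq> c)) = (\<lambda>l m :: 'a \<times> bool. m \<noteq> linv l)"
    by (auto simp: linv_def fun_eq_iff)
  then show ?thesis unfolding reduced_word_def by metis
qed

lemma reduced_word_Nil [simp]: "reduced_word []"
  by (simp add: reduced_word_altdef)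

lemma reduced_word_Cons: "reduced_word (l # w) \<longleftrightarrow> reduced_word w \<and> (w \<noteq> [] \<longrightarrow> hd w \<noteq> linv l)"
  by (auto simp: reduced_word_altdef successively_Cons)

lemma reduced_word_append: "reduced_word (u @ v) \<longleftrightarrow>
    reduced_word u \<and> reduced_word v \<and> (u \<noteq> [] \<longrightarrow> v \<noteq> [] \<longrightarrow> hd v \<noteq> linv (last u))"
  by (auto simp: reduced_word_altdef successively_append_iff)

lemma reduced_word_winv [simp]: "reduced_word (winv w) \<longleftrightarrow> reduced_word w"
proof -
  have "(\<lambda>x y. x \<noteq> linv y) = (\<lambda>l m :: 'a \<times> bool. m \<noteq> linv l)"
    by (intro ext) (metis linv_linv)
  then have "successively (\<lambda>x y. x \<noteq> linv y) w = successively (\<lambda>l m. m \<noteq> linv l) w"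
    by (rule arg_cong)
  then show ?thesis
    by (simp add: reduced_word_altdef winv_def successively_map)
qed

lemma reduced_word_replicate [simp]: "reduced_word (replicate n l)"
  by (induction n) (auto simp: reduced_word_Cons hd_replicate)

lemma last_winv: "w \<noteq> [] \<Longrightarrow> last (winv w) = linv (hd w)"
  by (simp add: winv_def last_rev hd_map)

lemma reduced_lcons: "reduced_word w \<Longrightarrow> reduced_word (lcons l w)"
  by (cases w) (auto simp: lcons_def reduced_word_Cons)

lemma lcp_split:
  obtains u v where "x = lcp x y @ u" "y = lcp x y @ v" "u = [] \<or> v = [] \<or> hd u \<noteq> hd v"
proof -
  obtain u v where uv: "x = lcp x y @ u" "y = lcp x y @ v"
    using longest_common_prefix_prefix1[of x y] longest_common_prefix_prefix2[of x y] by (auto simp: prefix_def)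
  have "u = [] \<or> v = [] \<or> hd u \<noteq> hd v"
  proof (rule ccontr)
    assume "\<not> ?thesis"
    then obtain a u' v' where "u = a # u'" "v = a # v'" by (metis list.collapse)
    then have "prefix (lcp x y @ [a]) x" "prefix (lcp x y @ [a]) y"
      using uv by (metis append.assoc append_Cons append_Nil prefixI)+
    then have "prefix (lcp x y @ [a]) (lcp x y)" by (rule longest_common_prefix_max_prefix)
    then show False by (auto dest: prefix_length_le)
  qed
  then show thesis using uv that by blast
qed

lemma lcp_commute: "lcp x y = lcp y x"
  by (induction x y rule: longest_common_prefix.induct) auto

lemma lcp_self [simp]: "lcp x x = x"
  by (induction x) auto

lemma wt_prefix_le: "(\<And>x. L x \<ge> 0) \<Longrightarrow> prefix u v \<Longrightarrow> wt L u \<le> wt L v"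
  using wt_nonneg[of L] by (auto simp: prefix_def)

text \<open>Both \<open>lcp x y\<close> and \<open>lcp y z\<close> are prefixes of \<open>y\<close>,
  hence comparable, and the shorter one is a prefix of \<open>x\<close> and of
  \<open>z\<close>.\<close>

lemma lcp_ultrametric: "prefix (lcp x y) (lcp x z) \<or> prefix (lcp y z) (lcp x z)"
proof -
  have "prefix (lcp x y) (lcp y z) \<or> prefix (lcp y z) (lcp x y)"
    by (meson longest_common_prefix_prefix1 longest_common_prefix_prefix2 prefix_same_cases)
  then show ?thesis
    by (meson longest_common_prefix_max_prefix longest_common_prefix_prefix1 longest_common_prefix_prefix2 prefix_order.trans)
qed

lemma wt_lcp_ultrametric:
  assumes "\<And>x. L x \<ge> 0"
  shows "min (wt L (lcp x y)) (wt L (lcp y z)) \<le> wt L (lcp x z)"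
  using lcp_ultrametric[of x y z] wt_prefix_le[of L, OF assms] by (auto simp: min_le_iff_disj)

lemma length_lcp_ultrametric: "min (length (lcp x y)) (length (lcp y z)) \<le> length (lcp x z)"
  using lcp_ultrametric[of x y z] by (auto simp: min_le_iff_disj dest: prefix_length_le)

lemma prefix_lcp_iff: "prefix w (lcp x y) \<longleftrightarrow> prefix w x \<and> prefix w y"
  by (meson longest_common_prefix_max_prefix longest_common_prefix_prefix1 longest_common_prefix_prefix2 prefix_order.trans)

text \<open>Cyclic reduction: the conjugating part is the common prefix of \<open>w\<close> and its
  inverse. It is shorter than half of \<open>w\<close>, since at the middle the reflection would
  produce two adjacent inverse letters (even length) or a letter that is its own inverse (odd
  length).\<close>

lemma reduced_word_conjugate:
  assumes w: "reduced_word w" "w \<noteq> []"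
  obtains c where "c \<noteq> []" "w = lcp (winv w) w @ c @ winv (lcp (winv w) w)"
proof -
  define p n where "p = lcp (winv w) w" and "n = length w"
  obtain r where r: "w = p @ r" using longest_common_prefix_prefix2[of "winv w" w] by (auto simp: p_def prefix_def)
  obtain r' where r': "winv w = p @ r'" using longest_common_prefix_prefix1[of "winv w" w] by (auto simp: p_def prefix_def)
  have nth: "w ! i = linv (w ! (n - 1 - i))" if "i < length p" for i
  proof -
    have "length p \<le> n" using r by (simp add: n_def)
    have "w ! i = winv w ! i" unfolding r' using r that by (simp add: nth_append)
    also have "\<dots> = linv (w ! (n - 1 - i))"
      using that \<open>length p \<le> n\<close> by (simp add: winv_def rev_nth n_def)
    finally show ?thesis .
  qed
  have short: "2 * length p < n"
  proof (rule ccontr)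
    assume *: "\<not> 2 * length p < n"
    have n: "n > 0" using w by (simp add: n_def)
    show False
    proof (cases "even n")
      case True
      then obtain k where k: "n = 2 * k" "k > 0" using n by (auto elim!: evenE)
      then have "w ! (k - 1) = linv (w ! k)" using nth[of "k - 1"] * by simp
      moreover have "w ! Suc (k - 1) \<noteq> linv (w ! (k - 1))"
        using w(1) k successively_nth[of "\<lambda>l m. m \<noteq> linv l" w "k - 1"] by (simp add: n_def reduced_word_altdef)
      ultimately show False using k by simp
    next
      case False
      then obtain k where "n = 2 * k + 1" by (auto elim!: oddE)
      then have "w ! k = linv (w ! k)" using nth[of k] * by simp
      then show False by simp
    qed
  qed
  have "w = winv r' @ winv p" using arg_cong[OF r', of winv] by simp
  then have "p @ r = winv r' @ winv p" using r by simp
  moreover have "length r' = length r" "length p < length r"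
    using arg_cong[OF r', of length] arg_cong[OF r, of length] short by (simp_all add: n_def)
  ultimately obtain c where c: "r = c @ winv p"
    by (auto simp: append_eq_append_conv2)
  then have "c \<noteq> []" "w = p @ c @ winv p" using short r by (auto simp: n_def)
  then show thesis unfolding p_def by (rule that)
qed

section \<open>Normal forms and weighted norms in a free group\<close>

locale free_group =
  fixes F :: "('a, 'b) monoid_scheme" (structure) and X :: "'a set"
  assumes basis: "free_basis F X"
begin

sublocale group F using basis by (simp add: free_basis_def)

lemma X_carrier: "x \<in> X \<Longrightarrow> x \<in> carrier F" using basis by (auto simp: free_basis_def)

definition lval :: "'a \<times> bool \<Rightarrow> 'a" where "lval l = (if snd l then fst l else inv (fst l))"

definition words :: "('a \<times> bool) list set" where "words = {w. fst ` set w \<subseteq> X}"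

abbreviation "wv \<equiv> word_value F"

definition rw :: "'a \<Rightarrow> ('a \<times> bool) list" where
  "rw = inv_into {w \<in> words. reduced_word w} wv"

lemma words_simps [simp]: "[] \<in> words" "l # w \<in> words \<longleftrightarrow> fst l \<in> X \<and> w \<in> words"
  "u @ v \<in> words \<longleftrightarrow> u \<in> words \<and> v \<in> words" "winv w \<in> words \<longleftrightarrow> w \<in> words"
  by (auto simp: words_def image_Un)

lemma lval_closed: "fst l \<in> X \<Longrightarrow> lval l \<in> carrier F"
  by (auto simp: lval_def X_carrier)

lemma wv_Nil [simp]: "wv [] = \<one>" by (simp add: word_value_def)

lemma wv_Cons [simp]: "wv (l # w) = lval l \<otimes> wv w"
  by (cases l) (simp add: word_value_def lval_def)

lemma wv_closed [simp]: "w \<in> words \<Longrightarrow> wv w \<in> carrier F"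
  by (induction w) (auto simp: lval_closed)

lemma wv_append: "u \<in> words \<Longrightarrow> v \<in> words \<Longrightarrow> wv (u @ v) = wv u \<otimes> wv v"
  by (induction u) (auto simp: lval_closed m_assoc)

lemma lval_linv: "fst l \<in> X \<Longrightarrow> lval (linv l) = inv (lval l)"
  by (auto simp: lval_def linv_def X_carrier)

lemma wv_winv: "w \<in> words \<Longrightarrow> wv (winv w) = inv (wv w)"
  by (induction w) (auto simp: wv_append lval_linv lval_closed inv_mult_group)

lemma bij_wv: "bij_betw wv {w \<in> words. reduced_word w} (carrier F)"
  using basis by (simp add: free_basis_def words_def)

lemma rw_words [simp]: "g \<in> carrier F \<Longrightarrow> rw g \<in> words"
  and reduced_rw [simp]: "g \<in> carrier F \<Longrightarrow> reduced_word (rw g)"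
  using inv_into_into[of g wv "{w \<in> words. reduced_word w}"] bij_wv by (auto simp: rw_def bij_betw_def)

lemma wv_rw [simp]: "g \<in> carrier F \<Longrightarrow> wv (rw g) = g"
  using bij_wv by (auto simp: rw_def bij_betw_def intro: f_inv_into_f)

lemma rw_wv [simp]: "w \<in> words \<Longrightarrow> reduced_word w \<Longrightarrow> rw (wv w) = w"
  using bij_wv by (auto simp: rw_def bij_betw_def intro: inv_into_f_f)

lemma rw_one [simp]: "rw \<one> = []"
  using rw_wv[of "[]"] by simp

lemma rw_eq_Nil_iff: "g \<in> carrier F \<Longrightarrow> rw g = [] \<longleftrightarrow> g = \<one>"
  by (metis rw_one wv_Nil wv_rw)

lemma rw_inv: "g \<in> carrier F \<Longrightarrow> rw (inv g) = winv (rw g)"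
  by (metis rw_wv rw_words reduced_rw reduced_word_winv words_simps(4) wv_rw wv_winv)

lemma lcons_words: "w \<in> words \<Longrightarrow> fst l \<in> X \<Longrightarrow> lcons l w \<in> words"
  by (cases w) (auto simp: lcons_def)

lemma wv_lcons: "w \<in> words \<Longrightarrow> fst l \<in> X \<Longrightarrow> wv (lcons l w) = lval l \<otimes> wv w"
  by (cases w) (auto simp: lcons_def lval_linv lval_closed simp flip: m_assoc)

lemma rw_lval_mult: "g \<in> carrier F \<Longrightarrow> fst l \<in> X \<Longrightarrow> rw (lval l \<otimes> g) = lcons l (rw g)"
  by (metis lcons_words reduced_lcons reduced_rw rw_words rw_wv wv_lcons wv_rw)

lemma length_rw_wv: "w \<in> words \<Longrightarrow> length (rw (wv w)) \<le> length w"
proof (induction w)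
  case (Cons l w)
  have "length (lcons l v) \<le> Suc (length v)" for v by (auto simp: lcons_def)
  from this[of "rw (wv w)"] show ?case using Cons by (auto simp: rw_lval_mult)
qed simp

lemma word_length_eq: "g \<in> carrier F \<Longrightarrow> word_length F X g = length (rw g)"
  unfolding word_length_def
proof (rule Least_equality)
  assume g: "g \<in> carrier F"
  then show "\<exists>w. fst ` set w \<subseteq> X \<and> length w = length (rw g) \<and> wv w = g"
    using rw_words[OF g] by (intro exI[of _ "rw g"]) (auto simp: words_def)
  fix n assume "\<exists>w. fst ` set w \<subseteq> X \<and> length w = n \<and> wv w = g"
  then obtain w where "w \<in> words" "length w = n" "wv w = g" by (auto simp: words_def)
  then show "length (rw g) \<le> n" using length_rw_wv by blast
qed

text \<open>Once the common prefix is removed, the remainders do not begin with the same letter, so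
  \<open>winv u @ v\<close> is already reduced.\<close>

lemma rw_inv_mult:
  assumes "g \<in> carrier F" "h \<in> carrier F"
  obtains u v where "rw g = lcp (rw g) (rw h) @ u" "rw h = lcp (rw g) (rw h) @ v" "rw (inv g \<otimes> h) = winv u @ v"
proof -
  define p where "p = lcp (rw g) (rw h)"
  obtain u v where uv: "rw g = p @ u" "rw h = p @ v" "u = [] \<or> v = [] \<or> hd u \<noteq> hd v"
    unfolding p_def by (rule lcp_split)
  have W: "p \<in> words" "u \<in> words" "v \<in> words" "reduced_word u" "reduced_word v"
    using rw_words[OF assms(1)] rw_words[OF assms(2)] reduced_rw[OF assms(1)] reduced_rw[OF assms(2)] uv
    by (auto simp: reduced_word_append)
  have "g = wv p \<otimes> wv u" "h = wv p \<otimes> wv v" using wv_append W uv wv_rw assms by metis+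
  then have "inv g \<otimes> h = inv (wv u) \<otimes> wv v"
    using W by (simp add: inv_mult_group m_assoc flip: m_assoc[of "inv (wv p)" "wv p"])
  also have "\<dots> = wv (winv u @ v)" using W by (simp add: wv_append wv_winv)
  finally have "rw (inv g \<otimes> h) = rw (wv (winv u @ v))" by simp
  also have "\<dots> = winv u @ v"
    using W uv(3) by (intro rw_wv) (auto simp: reduced_word_append last_winv)
  finally show thesis using uv(1,2) unfolding p_def by (intro that)
qed

definition gnorm :: "('a \<Rightarrow> real) \<Rightarrow> 'a \<Rightarrow> real" where "gnorm L g = wt L (rw g)"

lemma gnorm_one [simp]: "gnorm L \<one> = 0" by (simp add: gnorm_def)

lemma gnorm_inv [simp]: "g \<in> carrier F \<Longrightarrow> gnorm L (inv g) = gnorm L g" by (simp add: gnorm_def rw_inv)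

lemma gnorm_inv_mult:
  assumes "g \<in> carrier F" "h \<in> carrier F"
  shows "gnorm L (inv g \<otimes> h) = gnorm L g + gnorm L h - 2 * wt L (lcp (rw g) (rw h))"
proof -
  obtain u v where "rw g = lcp (rw g) (rw h) @ u" "rw h = lcp (rw g) (rw h) @ v" "rw (inv g \<otimes> h) = winv u @ v"
    by (rule rw_inv_mult[OF assms])
  then have "wt L (rw g) = wt L (lcp (rw g) (rw h)) + wt L u" "wt L (rw h) = wt L (lcp (rw g) (rw h)) + wt L v"
    "wt L (rw (inv g \<otimes> h)) = wt L u + wt L v" by (metis wt_simps(3), metis wt_simps(3), metis wt_simps(3) wt_winv)
  then show ?thesis by (simp add: gnorm_def)
qed

text \<open>After translating \<open>m\<close> to the identity, Gromov products are weights of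
  common prefixes, and these satisfy the ultrametric inequality.\<close>

lemma four_point_gnorm:
  assumes L: "\<And>x. L x \<ge> 0"
  shows "four_point (carrier F) (\<lambda>g h. gnorm L (inv g \<otimes> h))"
  unfolding four_point_def
proof (intro ballI)
  fix g h k m assume *: "g \<in> carrier F" "h \<in> carrier F" "k \<in> carrier F" "m \<in> carrier F"
  define g' h' k' where "g' = inv m \<otimes> g" and "h' = inv m \<otimes> h" and "k' = inv m \<otimes> k"
  have C: "g' \<in> carrier F" "h' \<in> carrier F" "k' \<in> carrier F" using * by (auto simp: g'_def h'_def k'_def)
  have mm: "inv (inv m \<otimes> a) \<otimes> (inv m \<otimes> b) = inv a \<otimes> b" if "a \<in> carrier F" "b \<in> carrier F" for a b
    using that * by (simp add: inv_mult_group m_assoc flip: m_assoc[of m "inv m"])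
  have flip: "gnorm L (inv a \<otimes> m) = gnorm L (inv m \<otimes> a)" if "a \<in> carrier F" for a
    using gnorm_inv[of "inv m \<otimes> a" L] that * by (simp add: inv_mult_group)
  have "min (wt L (lcp (rw g') (rw k'))) (wt L (lcp (rw k') (rw h'))) \<le> wt L (lcp (rw g') (rw h'))"
    by (rule wt_lcp_ultrametric[OF L])
  then have "gnorm L (inv g' \<otimes> h') + gnorm L k' \<le> max (gnorm L (inv g' \<otimes> k') + gnorm L h') (gnorm L g' + gnorm L (inv h' \<otimes> k'))"
    using C by (auto simp: gnorm_inv_mult lcp_commute[of "rw k'"])
  then show "gnorm L (inv g \<otimes> h) + gnorm L (inv k \<otimes> m)
      \<le> max (gnorm L (inv g \<otimes> k) + gnorm L (inv h \<otimes> m)) (gnorm L (inv g \<otimes> m) + gnorm L (inv h \<otimes> k))"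
    using * mm flip by (auto simp: g'_def h'_def k'_def add.commute)
qed

text \<open>The difference is the weight of the cyclically reduced core of \<open>g\<close>: the
  conjugating part contributes twice to the norm of \<open>g\<close>, cancels in the middle of the
  square, and so contributes equally to both norms.\<close>

lemma gnorm_square_ge:
  assumes L: "\<And>x. x \<in> X \<Longrightarrow> L x \<ge> \<epsilon>" "\<epsilon> > 0" and g: "g \<in> carrier F" "g \<noteq> \<one>"
  shows "gnorm L (g \<otimes> g) - gnorm L g \<ge> \<epsilon>"
proof -
  have ne: "rw g \<noteq> []" using g by (simp add: rw_eq_Nil_iff)
  define p where "p = lcp (winv (rw g)) (rw g)"
  obtain c where c: "c \<noteq> []" "rw g = p @ c @ winv p"
    unfolding p_def by (rule reduced_word_conjugate[OF reduced_rw[OF g(1)] ne])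
  have "gnorm L (g \<otimes> g) = 2 * gnorm L g - 2 * wt L p"
    using gnorm_inv_mult[of "inv g" g L] g by (simp add: rw_inv p_def)
  moreover have "gnorm L g = 2 * wt L p + wt L c" by (simp add: gnorm_def c(2))
  moreover have "wt L c \<ge> \<epsilon>"
  proof -
    have cw: "c \<in> words" using rw_words[OF g(1)] c(2) by simp
    obtain l c' where lc: "c = l # c'" using c(1) by (cases c) auto
    have "wt L v \<ge> 0" if "v \<in> words" for v using that L by (induction v) force+
    then show ?thesis using cw L(1)[of "fst l"] by (simp add: lc add_increasing2)
  qed
  ultimately show ?thesis by linarith
qed

end

section \<open>Cayley trees as points of unprojectivized Outer space\<close>

locale fin_free_group = free_group +
  assumes finite_X: "finite X" and X_ne: "X \<noteq> {}"
begin

lemma countable_carrier: "countable (carrier F)"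
proof -
  have "words = lists (X \<times> UNIV)" by (fastforce simp: words_def lists_eq_set)
  then have "countable words" using finite_X by (simp add: countable_finite)
  then have "countable (wv ` {w \<in> words. reduced_word w})" by (auto intro: countable_subset)
  then show ?thesis using bij_wv by (simp add: bij_betw_def)
qed

text \<open>This is the length function of the Cayley tree in which an edge labelled
  \<open>x\<close> has length \<open>L x\<close>.\<close>

lemma gnorm_mem_cv:
  assumes L: "\<And>x. L x \<ge> \<epsilon>" "\<epsilon> > 0"
  shows "(\<lambda>g\<in>carrier F. gnorm L (g \<otimes> g) - gnorm L g) \<in> cv F"
proof -
  define D where "D g h = gnorm L (inv g \<otimes> h)" for g h
  have L0: "L x \<ge> 0" for x using L by (meson less_le_trans less_imp_le)
  interpret hyperbolic_group F D
  proof
    show "four_point (carrier F) D" unfolding D_def using four_point_gnorm[of L] L0 by simp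
    show "D x y = D y x" if "x \<in> carrier F" "y \<in> carrier F" for x y
      using gnorm_inv[of "inv x \<otimes> y" L] that by (simp add: D_def inv_mult_group)
    show "D (k \<otimes> g) (k \<otimes> h) = D g h" if "k \<in> carrier F" "g \<in> carrier F" "h \<in> carrier F" for k g h
      using that by (simp add: D_def inv_mult_group m_assoc flip: m_assoc[of "inv k" k])
  qed (auto simp: D_def countable_carrier)
  have D1: "D \<one> g = gnorm L g" if "g \<in> carrier F" for g using that by (simp add: D_def)
  have "(\<lambda>g\<in>carrier F. D \<one> (g \<otimes> g) - D \<one> g) \<in> cv F"
  proof (rule length_function_mem_cv)
    fix g h and R :: real assume gh: "g \<in> carrier F" "h \<in> carrier F"
    define w where "w = rw (inv g \<otimes> h)"
    have w: "w \<in> words" "reduced_word w" "wv w = inv g \<otimes> h" using gh by (auto simp: w_def)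
    \<comment> \<open>Repeating the first and the last letter of \<open>w\<close> prolongs it on
      both sides without cancellation; the empty word is prolonged by powers of any
      generator.\<close>
    obtain a b where ab: "fst a \<in> X" "fst b \<in> X" "\<And>n. reduced_word (replicate n a @ w @ replicate n b)"
    proof (cases "w = []")
      case True
      obtain x where "x \<in> X" using X_ne by blast
      then show thesis using that[of "(x, True)" "(x, True)"] True by (simp flip: replicate_add)
    next
      case False
      then have "fst (hd w) \<in> X" "fst (last w) \<in> X" using w(1) by (auto simp: words_def)
      moreover have "reduced_word (replicate n (hd w) @ w @ replicate n (last w))" for n
        using w False by (cases "n = 0") (auto simp: reduced_word_append)
      ultimately show thesis using that by blast
    qed
    obtain n :: nat where n: "n * \<epsilon> > R" using L(2) reals_Archimedean3 by blast
    have big: "n * L x > R" for x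
      using n L(1)[of x] mult_left_mono[of \<epsilon> "L x" "real n"] by simp
    define u v where "u = g \<otimes> inv (wv (replicate n a))" and "v = h \<otimes> wv (replicate n b)"
    have R: "replicate n a \<in> words" "replicate n b \<in> words" using ab by (auto simp: words_def)
    have uv: "u \<in> carrier F" "v \<in> carrier F" using gh R by (auto simp: u_def v_def)
    have "inv u \<otimes> v = wv (replicate n a) \<otimes> (inv g \<otimes> h) \<otimes> wv (replicate n b)"
      using gh R by (simp add: u_def v_def inv_mult_group m_assoc)
    also have "\<dots> = wv (replicate n a @ w @ replicate n b)"
      using R w by (simp add: wv_append m_assoc w(3)[symmetric] del: w(3))
    finally have "D u v = n * L (fst a) + wt L w + n * L (fst b)"
      using R w ab by (simp add: D_def gnorm_def)
    moreover have "inv u \<otimes> g = wv (replicate n a)" using gh R by (simp add: u_def inv_mult_group m_assoc)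
    then have "D u g = n * L (fst a)" using R by (simp add: D_def gnorm_def)
    moreover have "inv h \<otimes> v = wv (replicate n b)" using gh R by (simp add: v_def flip: m_assoc)
    then have "D h v = n * L (fst b)" using R by (simp add: D_def gnorm_def)
    moreover have "D g h = wt L w" by (simp add: D_def gnorm_def w_def)
    ultimately show "\<exists>u\<in>carrier F. \<exists>v\<in>carrier F. D u v = D u g + D g h + D h v \<and> D u g > R \<and> D h v > R"
      using uv big by (intro bexI[of _ u] bexI[of _ v]) auto
  next
    show "\<epsilon> > 0" by fact
    show "D \<one> (g \<otimes> g) - D \<one> g \<ge> \<epsilon>" if "g \<in> carrier F" "g \<noteq> \<one>" for g
      using gnorm_square_ge[of \<epsilon> L g] L that by (simp add: D1)
  qed
  moreover have "(\<lambda>g\<in>carrier F. D \<one> (g \<otimes> g) - D \<one> g) = (\<lambda>g\<in>carrier F. gnorm L (g \<otimes> g) - gnorm L g)"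
    by (auto simp: fun_eq_iff D1)
  ultimately show ?thesis by simp
qed

end

section \<open>Transvections of free groups\<close>

text \<open>The reduced word of the image of a reduced word under the automorphism that replaces the
  letter \<^term>\<open>c\<close> by \<^term>\<open>[c, b]\<close> and fixes all other generators.\<close>

fun transvect_word :: "'a \<times> bool \<Rightarrow> 'a \<times> bool \<Rightarrow> ('a \<times> bool) list \<Rightarrow> ('a \<times> bool) list" where
  "transvect_word c b [] = []"
| "transvect_word c b (l # w) =
    (if l = c then lcons c (lcons b (transvect_word c b w))
     else if l = linv c then lcons (linv b) (lcons (linv c) (transvect_word c b w))
     else lcons l (transvect_word c b w))"

abbreviation starts :: "'b list \<Rightarrow> 'b \<Rightarrow> bool" where
  "starts w l \<equiv> w \<noteq> [] \<and> hd w = l"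

text \<open>In \<^const>\<open>transvect_word\<close> only the letters \<^term>\<open>b\<close> and \<^term>\<open>linv b\<close> ever cancel; the
  following invariant describes the first letters of the result precisely enough to see this.\<close>

lemma transvect_word_invariant:
  assumes "reduced_word w" "fst b \<noteq> fst c"
  defines "h \<equiv> transvect_word c b w"
  shows "(starts h c \<longrightarrow> starts w c) \<and> (starts h (linv c) \<longrightarrow> starts w b) \<and>
    (starts h (linv b) \<longrightarrow> starts w (linv b) \<or> starts w (linv c) \<and> starts (tl h) (linv c)) \<and>
    (starts h (linv b) \<and> starts (tl h) (linv c) \<longrightarrow> starts w (linv c)) \<and>
    (starts h b \<longrightarrow> starts w b) \<and>
    (\<forall>m. fst m \<noteq> fst c \<and> fst m \<noteq> fst b \<and> starts h m \<longrightarrow> starts w m)"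
  using assms(1) unfolding h_def
proof (induction w)
  case (Cons l w)
  define h where "h = transvect_word c b w"
  have red: "reduced_word w" "w \<noteq> [] \<Longrightarrow> hd w \<noteq> linv l" using Cons.prems by (auto simp: reduced_word_Cons)
  note IH = Cons.IH[OF red(1), folded h_def]
  have ne: "b \<noteq> c" "b \<noteq> linv c" "linv b \<noteq> c" "linv b \<noteq> linv c" "c \<noteq> b" "linv c \<noteq> b" "c \<noteq> linv b" "linv c \<noteq> linv b"
    using assms(2) by auto
  consider "l = c" | "l = linv c" | "l = b" | "l = linv b" | "fst l \<noteq> fst c" "fst l \<noteq> fst b"
  proof -
    have "l = m \<or> l = linv m" if "fst l = fst m" for m :: "'a \<times> bool"
      using that by (auto simp: linv_def prod_eq_iff)
    then show thesis using that by blast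
  qed
  then show ?case
  proof cases
    case 1
    have "\<not> (h \<noteq> [] \<and> hd h = linv b \<and> starts (tl h) (linv c))" using IH red(2) 1 by auto
    then have "transvect_word c b (l # w) = c # lcons b h"
      using 1 ne by (auto simp: h_def[symmetric] lcons_def)
    then show ?thesis using 1 ne assms(2) by auto
  next
    case 2
    have "\<not> starts h c" using IH red(2) 2 by auto
    then have "transvect_word c b (l # w) = linv b # linv c # h"
      using 2 ne by (auto simp: h_def[symmetric] lcons_def)
    then show ?thesis using 2 ne assms(2) by (auto simp del: split_paired_All)
  next
    case 3
    then have eq: "transvect_word c b (l # w) = lcons b h" using ne by (simp add: h_def[symmetric])
    show ?thesis
    proof (cases "starts h (linv b)")
      case True
      then have "starts (tl h) (linv c)" using IH red(2) 3 by auto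
      then show ?thesis unfolding eq using True 3 ne assms(2) by (auto simp: lcons_def simp del: split_paired_All)
    next
      case False
      then show ?thesis unfolding eq using 3 ne assms(2) by (auto simp: lcons_def simp del: split_paired_All)
    qed
  next
    case 4
    have "\<not> starts h b" using IH red(2) 4 by auto
    then have "transvect_word c b (l # w) = linv b # h"
      using 4 ne by (auto simp: h_def[symmetric] lcons_def)
    moreover have "\<not> starts h (linv c)" using IH red(2) 4 by auto
    ultimately show ?thesis using 4 ne assms(2) by (auto simp del: split_paired_All)
  next
    case 5
    then have "l \<noteq> c" "l \<noteq> linv c" by auto
    moreover have "\<not> starts h (linv l)" using IH red(2) 5 by (metis fst_linv)
    ultimately have "transvect_word c b (l # w) = l # h"
      by (auto simp: h_def[symmetric] lcons_def)
    then show ?thesis using 5 assms(2) by auto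
  qed
qed simp

text \<open>By the invariant, the image of the tail never begins so as to cancel a letter of another
  generator put in front of it. The only \<open>lcons\<close> that remain are those for
  \<open>b\<close> and its inverse.\<close>

lemma transvect_word_Cons:
  assumes "reduced_word (l # w)" "fst b \<noteq> fst c"
  shows "transvect_word c b (l # w) =
    (if l = c then c # lcons b (transvect_word c b w)
     else if l = linv c then linv b # linv c # transvect_word c b w
     else if fst l = fst b then lcons l (transvect_word c b w)
     else l # transvect_word c b w)"
proof -
  define h where "h = transvect_word c b w"
  have red: "reduced_word w" "w \<noteq> [] \<Longrightarrow> hd w \<noteq> linv l" using assms(1) by (auto simp: reduced_word_Cons)
  note inv = transvect_word_invariant[OF red(1) assms(2), folded h_def]
  have ne: "b \<noteq> c" "b \<noteq> linv c" "linv b \<noteq> c" "linv b \<noteq> linv c" "c \<noteq> b" "linv c \<noteq> b" "c \<noteq> linv b" "linv c \<noteq> linv b"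
    using assms(2) by auto
  consider "l = c" | "l = linv c" | "fst l = fst b" "l \<noteq> c" "l \<noteq> linv c" | "fst l \<noteq> fst c" "fst l \<noteq> fst b"
  proof -
    have "l = c \<or> l = linv c" if "fst l = fst c" using that by (auto simp: linv_def prod_eq_iff)
    then show thesis using that by blast
  qed
  then show ?thesis
  proof cases
    case 1
    have "\<not> (starts h (linv b) \<and> starts (tl h) (linv c))" using inv red(2) 1 by auto
    then show ?thesis using 1 ne by (auto simp: h_def[symmetric] lcons_def)
  next
    case 2
    have "\<not> starts h c" using inv red(2) 2 by auto
    then show ?thesis using 2 ne by (auto simp: h_def[symmetric] lcons_def)
  next
    case 4
    then have "l \<noteq> c" "l \<noteq> linv c" by auto
    moreover have "\<not> starts h (linv l)" using inv red(2) 4 by (metis fst_linv)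
    ultimately show ?thesis using 4 by (auto simp: h_def[symmetric] lcons_def)
  qed simp
qed

text \<open>All letters that are inserted or cancelled are \<open>b\<close> or its inverse, and
  these have weight 0.\<close>

lemma wt_transvect_word:
  assumes "reduced_word w" "fst b \<noteq> fst c" "L (fst b) = 0"
  shows "wt L (transvect_word c b w) = wt L w"
  using assms(1)
proof (induction w)
  case (Cons l w)
  have "wt L (lcons m h) = wt L h" if "fst m = fst b" for m h
  proof (cases "starts h (linv m)")
    case True
    then show ?thesis using that assms(3) by (cases h) (auto simp: lcons_def)
  qed (use that assms(3) in \<open>auto simp: lcons_def\<close>)
  then show ?case
    using Cons assms(3) by (auto simp: transvect_word_Cons[OF Cons.prems assms(2)] reduced_word_Cons simp del: transvect_word.simps)
qed simp

text \<open>The \<open>b\<close> inserted after \<open>c\<close> survives unless the image of the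
  tail begins with \<open>linv b\<close>. By the invariant the tail would then begin with
  \<open>linv b\<close> or with \<open>linv c\<close>, and the latter is excluded because
  \<open>w\<close> is reduced.\<close>

lemma starts_transvect_word:
  assumes "reduced_word w" "fst b \<noteq> fst c" "prefix [c] w"
  shows "prefix [c] (transvect_word c b w)"
    and "\<not> prefix [c, linv b] w \<Longrightarrow> prefix [c, b] (transvect_word c b w)"
proof -
  obtain v where w: "w = c # v" using assms(3) by (cases w) auto
  note eq = transvect_word_Cons[OF assms(1)[unfolded w] assms(2), folded w]
  show "prefix [c] (transvect_word c b w)" by (simp add: eq)
  assume "\<not> prefix [c, linv b] w"
  then have 1: "\<not> starts v (linv b)" by (cases v) (auto simp: w)
  have red: "reduced_word v" "v \<noteq> [] \<Longrightarrow> hd v \<noteq> linv c" using assms(1) by (auto simp: w reduced_word_Cons)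
  have "\<not> starts (transvect_word c b v) (linv b)"
    using transvect_word_invariant[OF red(1) assms(2)] red(2) 1 by blast
  then show "prefix [c, b] (transvect_word c b w)" by (auto simp: eq lcons_def)
qed

section \<open>Homomorphic extension and transvections\<close>

context free_group
begin

definition hval :: "('a \<Rightarrow> 'a) \<Rightarrow> 'a \<times> bool \<Rightarrow> 'a" where
  "hval f l = (if snd l then f (fst l) else inv (f (fst l)))"

definition hext :: "('a \<Rightarrow> 'a) \<Rightarrow> 'a \<Rightarrow> 'a" where
  "hext f = (\<lambda>g\<in>carrier F. foldr (\<lambda>l h. hval f l \<otimes> h) (rw g) \<one>)"

lemma hval_closed: "(\<And>x. x \<in> X \<Longrightarrow> f x \<in> carrier F) \<Longrightarrow> fst l \<in> X \<Longrightarrow> hval f l \<in> carrier F"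
  by (simp add: hval_def)

lemma hval_linv: "(\<And>x. x \<in> X \<Longrightarrow> f x \<in> carrier F) \<Longrightarrow> fst l \<in> X \<Longrightarrow> hval f (linv l) = inv (hval f l)"
  by (simp add: hval_def linv_def)

lemma foldr_hval_closed:
  "(\<And>x. x \<in> X \<Longrightarrow> f x \<in> carrier F) \<Longrightarrow> w \<in> words \<Longrightarrow> foldr (\<lambda>l h. hval f l \<otimes> h) w \<one> \<in> carrier F"
  by (induction w) (auto simp: hval_closed)

text \<open>Compatibility with cancellation of the first letter is what makes \<open>hext\<close>,
  defined on normal forms, multiplicative.\<close>

lemma foldr_hval_lcons:
  assumes f: "\<And>x. x \<in> X \<Longrightarrow> f x \<in> carrier F" and "w \<in> words" "fst l \<in> X"
  shows "foldr (\<lambda>l h. hval f l \<otimes> h) (lcons l w) \<one> = hval f l \<otimes> foldr (\<lambda>l h. hval f l \<otimes> h) w \<one>"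
proof (cases "starts w (linv l)")
  case True
  then obtain v where "w = linv l # v" by (cases w) auto
  then show ?thesis
    using assms foldr_hval_closed[of f v] hval_closed[of f l]
    by (simp add: lcons_def hval_linv flip: m_assoc)
qed (auto simp: lcons_def)

lemma hext_one [simp]: "hext f \<one> = \<one>" by (simp add: hext_def)

lemma hext_closed: "(\<And>x. x \<in> X \<Longrightarrow> f x \<in> carrier F) \<Longrightarrow> g \<in> carrier F \<Longrightarrow> hext f g \<in> carrier F"
  by (simp add: hext_def foldr_hval_closed)

lemma hext_lval_mult:
  assumes "\<And>x. x \<in> X \<Longrightarrow> f x \<in> carrier F" "fst l \<in> X" "g \<in> carrier F"
  shows "hext f (lval l \<otimes> g) = hval f l \<otimes> hext f g"
  using assms by (simp add: hext_def lval_closed rw_lval_mult foldr_hval_lcons)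

lemma hext_hom:
  assumes f: "\<And>x. x \<in> X \<Longrightarrow> f x \<in> carrier F"
  shows "hext f \<in> hom F F"
proof (rule homI)
  fix g h assume gh: "g \<in> carrier F" "h \<in> carrier F"
  have "hext f (wv w \<otimes> h) = hext f (wv w) \<otimes> hext f h" if "w \<in> words" for w
    using that
  proof (induction w)
    case (Cons l w)
    then show ?case
      using gh(2) f by (simp add: m_assoc lval_closed hext_lval_mult hval_closed hext_closed)
  qed (use gh hext_closed[OF f] in simp)
  from this[of "rw g"] show "hext f (g \<otimes> h) = hext f g \<otimes> hext f h" using gh by simp
qed (use hext_closed[OF f] in simp)

text \<open>\<open>b\<close> is a signed letter so that the inverse map is again of this form, with
  \<open>linv b\<close>.\<close>

definition transvection :: "'a \<Rightarrow> 'a \<times> bool \<Rightarrow> 'a \<Rightarrow> 'a" where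
  "transvection y b = hext (\<lambda>x. if x = y then y \<otimes> lval b else x)"

context
  fixes y :: 'a and b :: "'a \<times> bool" assumes y: "y \<in> X" and b: "fst b \<in> X" and ne: "fst b \<noteq> y"
begin

lemma transvection_image: "x \<in> X \<Longrightarrow> (if x = y then y \<otimes> lval b else x) \<in> carrier F"
  using y b by (simp add: X_carrier lval_closed)

lemma transvection_hom: "transvection y b \<in> hom F F"
  unfolding transvection_def by (rule hext_hom[OF transvection_image])

lemma transvection_closed: "g \<in> carrier F \<Longrightarrow> transvection y b g \<in> carrier F"
  using transvection_hom by (auto simp: hom_def)

lemma transvection_lval_mult:
  assumes "fst l \<in> X" "g \<in> carrier F"
  shows "transvection y b (lval l \<otimes> g) =
    (if l = (y, True) then lval (y, True) \<otimes> (lval b \<otimes> transvection y b g)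
     else if l = linv (y, True) then lval (linv b) \<otimes> (lval (linv (y, True)) \<otimes> transvection y b g)
     else lval l \<otimes> transvection y b g)"
proof -
  have "hval (\<lambda>x. if x = y then y \<otimes> lval b else x) l =
    (if l = (y, True) then y \<otimes> lval b else if l = linv (y, True) then inv (lval b) \<otimes> inv y else lval l)"
    using y b by (cases l) (auto simp: hval_def linv_def lval_def X_carrier inv_mult_group)
  moreover have "transvection y b g \<in> carrier F" by (rule transvection_closed[OF assms(2)])
  ultimately show ?thesis
    unfolding transvection_def using assms y b
    by (auto simp: hext_lval_mult[OF transvection_image] m_assoc lval_closed X_carrier lval_linv)
      (auto simp: lval_def X_carrier)
qed

lemma rw_transvection:
  assumes "g \<in> carrier F"
  shows "rw (transvection y b g) = transvect_word (y, True) b (rw g)"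
proof -
  have "rw (transvection y b (wv w)) = transvect_word (y, True) b w" if "w \<in> words" for w
    using that
  proof (induction w)
    case Nil
    then show ?case by (simp add: transvection_def)
  next
    case (Cons l w)
    then have "transvection y b (wv w) \<in> carrier F" "wv w \<in> carrier F" by (auto simp: transvection_closed)
    then show ?case
      using Cons y b by (simp add: transvection_lval_mult rw_lval_mult lval_closed)
  qed
  from this[of "rw g"] show ?thesis using assms by simp
qed

end

lemma transvection_inverse:
  assumes y: "y \<in> X" and b: "fst b \<in> X" "fst b \<noteq> y" and g: "g \<in> carrier F"
  shows "transvection y (linv b) (transvection y b g) = g"
proof -
  have b': "fst (linv b) \<in> X" "fst (linv b) \<noteq> y" using b by auto
  note lv = transvection_lval_mult[OF y b] transvection_lval_mult[OF y b']
  note cl = transvection_closed[OF y b] transvection_closed[OF y b']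
  have "transvection y (linv b) (transvection y b (wv w)) = wv w" if "w \<in> words" for w
    using that
  proof (induction w)
    case Nil
    then show ?case by (simp add: transvection_def)
  next
    case (Cons l w)
    define h where "h = transvection y b (wv w)"
    have h: "h \<in> carrier F" "transvection y (linv b) h = wv w" using Cons cl by (auto simp: h_def)
    have bn: "b \<noteq> (y, True)" "b \<noteq> linv (y, True)" "linv b \<noteq> (y, True)" "linv b \<noteq> linv (y, True)"
      using b(2) by (auto simp: linv_def)
    have yX: "fst (y, True) \<in> X" "fst (linv (y, True)) \<in> X" using y by (auto simp: linv_def)
    have ww: "wv w \<in> carrier F" "fst l \<in> X" using Cons by auto
    note C = lval_closed[OF yX(1)] lval_closed[OF yX(2)] lval_closed[OF b(1)] lval_closed[OF b'(1)] lval_closed[OF ww(2)]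
    have canc: "lval b \<otimes> (lval (linv b) \<otimes> a) = a" "lval (linv b) \<otimes> (lval b \<otimes> a) = a" if "a \<in> carrier F" for a
      using that b C by (simp_all add: lval_linv flip: m_assoc)
    consider "l = (y, True)" | "l = linv (y, True)" | "l \<noteq> (y, True)" "l \<noteq> linv (y, True)" by blast
    then show ?case
    proof cases
      case 1
      then show ?thesis
        using h ww C yX b b' bn canc cl by (simp add: lv h_def[symmetric])
    next
      case 2
      then show ?thesis
        using h ww C yX b b' bn canc cl by (simp add: lv h_def[symmetric])
    next
      case 3
      then show ?thesis
        using h ww C cl by (simp add: lv h_def[symmetric])
    qed
  qed
  from this[of "rw g"] show ?thesis using g by simp
qed

lemma transvection_inverse':
  assumes "y \<in> X" "fst b \<in> X" "fst b \<noteq> y" "g \<in> carrier F"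
  shows "transvection y b (transvection y (linv b) g) = g"
  using transvection_inverse[of y "linv b" g] assms by simp

lemma transvection_auto:
  assumes "y \<in> X" "fst b \<in> X" "fst b \<noteq> y"
  shows "transvection y b \<in> auto F"
proof -
  have "bij_betw (transvection y b) (carrier F) (carrier F)"
    by (rule bij_betwI[where g = "transvection y (linv b)"])
      (use assms transvection_closed[of y b] transvection_closed[of y "linv b"] in
        \<open>auto simp: transvection_inverse transvection_inverse'\<close>)
  moreover have "transvection y b \<in> extensional (carrier F)" by (simp add: transvection_def hext_def)
  ultimately show ?thesis using transvection_hom[OF assms] by (simp add: auto_def Bij_def)
qed

lemma gnorm_transvection:
  assumes "y \<in> X" "fst b \<in> X" "fst b \<noteq> y" "L (fst b) = 0" "g \<in> carrier F"
  shows "gnorm L (transvection y b g) = gnorm L g"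
  using assms by (simp add: gnorm_def rw_transvection wt_transvect_word)

text \<open>The backward direction is the forward one for the inverse transvection.\<close>

lemma prefix_transvection_iff:
  assumes "y \<in> X" "fst b \<in> X" "fst b \<noteq> y" "g \<in> carrier F"
  shows "prefix [(y, True)] (rw (transvection y b g)) \<longleftrightarrow> prefix [(y, True)] (rw g)"
proof -
  have *: "prefix [(y, True)] (rw (transvection y b g))"
    if "prefix [(y, True)] (rw g)" "fst b \<in> X" "fst b \<noteq> y" "g \<in> carrier F" for b g
    using starts_transvect_word(1)[of "rw g" b "(y, True)"] that assms(1) by (simp add: rw_transvection)
  show ?thesis
    using *[of g b] *[of "transvection y b g" "linv b"] assms
    by (auto simp: transvection_inverse transvection_closed)
qed

lemma prefix_transvection:
  assumes "y \<in> X" "fst b \<in> X" "fst b \<noteq> y" "g \<in> carrier F"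
    and "prefix [(y, True)] (rw g)" "\<not> prefix [(y, True), linv b] (rw g)"
  shows "prefix [(y, True), b] (rw (transvection y b g))"
  using starts_transvect_word(2)[of "rw g" b "(y, True)"] assms by (simp add: rw_transvection)

end

section \<open>The boundary of a free group\<close>

context free_group
begin

text \<open>Gromov products at the identity are lengths of common prefixes
  (\<open>gromov_product_eq\<close>), so this is their divergence to infinity in both
  indices.\<close>

definition conv :: "(nat \<Rightarrow> 'a) \<Rightarrow> (nat \<Rightarrow> 'a) \<Rightarrow> bool" where
  "conv u v \<longleftrightarrow> (\<forall>n. \<exists>N. \<forall>i\<ge>N. \<forall>j\<ge>N. n \<le> length (lcp (rw (u i)) (rw (v j))))"

definition rays :: "(nat \<Rightarrow> 'a) set" where
  "rays = {u. range u \<subseteq> carrier F \<and> conv u u}"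

definition ends :: "(nat \<Rightarrow> 'a) set set" where
  "ends = gromov_boundary (carrier F) (word_dist F X) \<one>"

text \<open>The ends whose ray from the identity begins with \<open>w\<close>. One representative
  may be tested, since by \<open>cyl_iff\<close> all of them agree.\<close>

definition cyl :: "('a \<times> bool) list \<Rightarrow> (nat \<Rightarrow> 'a) set set" where
  "cyl w = {\<zeta> \<in> ends. \<exists>u\<in>\<zeta>. \<forall>\<^sub>F i in sequentially. prefix w (rw (u i))}"

lemma length_rw_inv_mult:
  assumes "g \<in> carrier F" "h \<in> carrier F"
  shows "real (length (rw (inv g \<otimes> h))) = length (rw g) + length (rw h) - 2 * real (length (lcp (rw g) (rw h)))"
  using gnorm_inv_mult[OF assms, of "\<lambda>_. 1"] by (simp add: gnorm_def wt_one)

lemma gromov_product_eq: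
  assumes "g \<in> carrier F" "h \<in> carrier F"
  shows "gromov_product (word_dist F X) \<one> g h = length (lcp (rw g) (rw h))"
  using assms by (simp add: gromov_product_def word_dist_def word_length_eq length_rw_inv_mult rw_inv)

lemma gromov_product_at_top_iff:
  assumes "range u \<subseteq> carrier F" "range v \<subseteq> carrier F"
  shows "filterlim (\<lambda>(i, j). gromov_product (word_dist F X) \<one> (u i) (v j)) at_top (sequentially \<times>\<^sub>F sequentially)
     \<longleftrightarrow> conv u v"
proof -
  have "(\<lambda>(i, j). gromov_product (word_dist F X) \<one> (u i) (v j)) = (\<lambda>(i, j). real (length (lcp (rw (u i)) (rw (v j)))))"
  proof -
    have "u i \<in> carrier F" "v i \<in> carrier F" for i using assms by auto
    then show ?thesis by (simp add: fun_eq_iff gromov_product_eq)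
  qed
  moreover have "filterlim (\<lambda>(i, j). real (length (lcp (rw (u i)) (rw (v j))))) at_top (sequentially \<times>\<^sub>F sequentially)
    \<longleftrightarrow> conv u v"
  proof
    assume "filterlim (\<lambda>(i, j). real (length (lcp (rw (u i)) (rw (v j))))) at_top (sequentially \<times>\<^sub>F sequentially)"
    then have "\<forall>\<^sub>F p in sequentially \<times>\<^sub>F sequentially. real n \<le> (case p of (i, j) \<Rightarrow> real (length (lcp (rw (u i)) (rw (v j)))))" for n
      unfolding filterlim_at_top by blast
    then show "conv u v" unfolding conv_def eventually_prod_sequentially prod.case of_nat_le_iff by blast
  next
    assume c: "conv u v"
    show "filterlim (\<lambda>(i, j). real (length (lcp (rw (u i)) (rw (v j))))) at_top (sequentially \<times>\<^sub>F sequentially)"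
      unfolding filterlim_at_top
    proof
      fix Z :: real
      obtain n :: nat where n: "Z \<le> n" using real_arch_simple by blast
      obtain N where N: "\<forall>i\<ge>N. \<forall>j\<ge>N. n \<le> length (lcp (rw (u i)) (rw (v j)))" using c unfolding conv_def by blast
      have "Z \<le> real (length (lcp (rw (u i)) (rw (v j))))" if "i \<ge> N" "j \<ge> N" for i j
        using n N[rule_format, OF that] by linarith
      then show "\<forall>\<^sub>F p in sequentially \<times>\<^sub>F sequentially. Z \<le> (case p of (i, j) \<Rightarrow> real (length (lcp (rw (u i)) (rw (v j)))))"
        unfolding eventually_prod_sequentially prod.case by blast
    qed
  qed
  ultimately show ?thesis by simp
qed

lemma gromov_seqs_eq: "gromov_seqs (carrier F) (word_dist F X) \<one> = rays"
  unfolding gromov_seqs_def rays_def using gromov_product_at_top_iff by blast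

lemma gromov_rel_eq: "gromov_rel (carrier F) (word_dist F X) \<one> = {(u, v). u \<in> rays \<and> v \<in> rays \<and> conv u v}"
  unfolding gromov_rel_def gromov_seqs_eq using gromov_product_at_top_iff by (auto simp: rays_def)

lemma rays_carrier: "u \<in> rays \<Longrightarrow> u i \<in> carrier F" by (auto simp: rays_def)

lemma conv_sym: "conv u v \<Longrightarrow> conv v u"
  unfolding conv_def by (subst lcp_commute) blast

lemma conv_trans:
  assumes "conv u v" "conv v t" shows "conv u t"
  unfolding conv_def
proof
  fix n
  obtain N1 where N1: "\<forall>i\<ge>N1. \<forall>j\<ge>N1. n \<le> length (lcp (rw (u i)) (rw (v j)))"
    using assms(1) unfolding conv_def by blast
  obtain N2 where N2: "\<forall>i\<ge>N2. \<forall>j\<ge>N2. n \<le> length (lcp (rw (v i)) (rw (t j)))"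
    using assms(2) unfolding conv_def by blast
  have "n \<le> length (lcp (rw (u i)) (rw (t j)))" if ij: "i \<ge> max N1 N2" "j \<ge> max N1 N2" for i j
  proof -
    define k where "k = max N1 N2"
    have k: "N1 \<le> k" "N2 \<le> k" "N1 \<le> i" "N2 \<le> j" using ij by (auto simp: k_def)
    have "n \<le> length (lcp (rw (u i)) (rw (v k)))" "n \<le> length (lcp (rw (v k)) (rw (t j)))"
      using N1[rule_format, OF k(3,1)] N2[rule_format, OF k(2,4)] .
    then show ?thesis using length_lcp_ultrametric[of "rw (u i)" "rw (v k)" "rw (t j)"] by linarith
  qed
  then show "\<exists>N. \<forall>i\<ge>N. \<forall>j\<ge>N. n \<le> length (lcp (rw (u i)) (rw (t j)))" by blast
qed

lemma conv_eventually: "conv u v \<Longrightarrow> \<forall>\<^sub>F i in sequentially. n \<le> length (lcp (rw (u i)) (rw (v i)))"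
  unfolding conv_def eventually_sequentially by meson

lemma ends_eq: "ends = rays // gromov_rel (carrier F) (word_dist F X) \<one>"
  by (simp add: ends_def gromov_boundary_def gromov_seqs_eq)

lemma class_mem_ends: "u \<in> rays \<Longrightarrow> {v \<in> rays. conv u v} \<in> ends"
  unfolding ends_eq quotient_def gromov_rel_eq by auto

lemma ends_class:
  assumes "\<zeta> \<in> ends" "u \<in> \<zeta>"
  shows "u \<in> rays" "\<zeta> = {v \<in> rays. conv u v}"
proof -
  obtain v where "v \<in> rays" and \<zeta>: "\<zeta> = {t \<in> rays. conv v t}"
    using assms(1) unfolding ends_eq quotient_def gromov_rel_eq by auto
  then show u: "u \<in> rays" using assms(2) by simp
  have "conv v t \<longleftrightarrow> conv u t" for t
    using assms(2) \<zeta> conv_trans[of u v t] conv_trans[of v u t] conv_sym[of v u] by blast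
  then show "\<zeta> = {v \<in> rays. conv u v}" using \<zeta> by simp
qed

lemma ends_mem: "\<zeta> \<in> ends \<Longrightarrow> u \<in> \<zeta> \<Longrightarrow> u \<in> rays"
  by (rule ends_class)

lemma ends_nonempty:
  assumes "\<zeta> \<in> ends"
  obtains u where "u \<in> rays" "u \<in> \<zeta>"
proof -
  obtain v where "v \<in> rays" "\<zeta> = {t \<in> rays. conv v t}"
    using assms unfolding ends_eq quotient_def gromov_rel_eq by auto
  then show thesis using that[of v] by (simp add: rays_def)
qed

lemma ends_conv: "\<zeta> \<in> ends \<Longrightarrow> u \<in> \<zeta> \<Longrightarrow> v \<in> \<zeta> \<Longrightarrow> conv u v"
  using ends_class(2)[of \<zeta> u] by blast

lemma ends_eqI:
  assumes "\<zeta> \<in> ends" "\<xi> \<in> ends" "u \<in> \<zeta>" "v \<in> \<xi>" "conv u v"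
  shows "\<zeta> = \<xi>"
proof -
  have "v \<in> \<zeta>" using ends_class(2)[OF assms(1,3)] ends_mem[OF assms(2,4)] assms(5) by blast
  then show ?thesis using ends_class(2)[OF assms(1)] ends_class(2)[OF assms(2,4)] by blast
qed

lemma prefix_of_lcp: "prefix w a \<Longrightarrow> length w \<le> length (lcp a b) \<Longrightarrow> prefix w b"
  using prefix_length_prefix[of w a "lcp a b"] prefix_order.trans[of w "lcp a b" b]
  by (simp add: longest_common_prefix_prefix1 longest_common_prefix_prefix2)

lemma cyl_iff:
  assumes "\<zeta> \<in> ends" "u \<in> \<zeta>"
  shows "\<zeta> \<in> cyl w \<longleftrightarrow> (\<forall>\<^sub>F i in sequentially. prefix w (rw (u i)))"
proof
  assume "\<zeta> \<in> cyl w"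
  then obtain v where v: "v \<in> \<zeta>" "\<forall>\<^sub>F i in sequentially. prefix w (rw (v i))" by (auto simp: cyl_def)
  show "\<forall>\<^sub>F i in sequentially. prefix w (rw (u i))"
    using v(2) conv_eventually[OF ends_conv[OF assms(1) v(1) assms(2)], of "length w"]
    by eventually_elim (rule prefix_of_lcp)
qed (use assms in \<open>auto simp: cyl_def\<close>)

lemma cyl_subset: "cyl w \<subseteq> ends" by (auto simp: cyl_def)

lemma cyl_Nil: "cyl [] = ends" by (auto simp: cyl_def elim: ends_nonempty)

lemma cyl_cases:
  assumes "\<zeta> \<in> cyl w"
  obtains u i where "\<zeta> \<in> ends" "u \<in> \<zeta>" "u i \<in> carrier F" "prefix w (rw (u i))"
proof -
  obtain u where u: "\<zeta> \<in> ends" "u \<in> \<zeta>" "\<forall>\<^sub>F i in sequentially. prefix w (rw (u i))" using assms by (auto simp: cyl_def)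
  from u(3) obtain i where "prefix w (rw (u i))" by (auto simp: eventually_sequentially)
  then show thesis using that u rays_carrier ends_mem by blast
qed

lemma cyl_prefix_mono: "prefix v w \<Longrightarrow> cyl w \<subseteq> cyl v"
  unfolding cyl_def using prefix_order.trans[of v w] by (force elim: eventually_mono)

lemma cyl_comparable:
  assumes "\<zeta> \<in> cyl v" "\<zeta> \<in> cyl w"
  shows "prefix v w \<or> prefix w v"
proof -
  obtain u where u: "\<zeta> \<in> ends" "u \<in> \<zeta>" using assms(1) by (auto simp: cyl_def)
  have "\<forall>\<^sub>F i in sequentially. prefix v (rw (u i)) \<and> prefix w (rw (u i))"
    using assms cyl_iff[OF u] by (simp add: eventually_conj)
  then obtain i where "prefix v (rw (u i))" "prefix w (rw (u i))" by (auto simp: eventually_sequentially)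
  then show ?thesis by (rule prefix_same_cases)
qed

lemma cyl_same_length: "\<zeta> \<in> cyl v \<Longrightarrow> \<zeta> \<in> cyl w \<Longrightarrow> length v = length w \<Longrightarrow> v = w"
  using cyl_comparable[of \<zeta> v w] by (auto simp: prefix_def)

lemma ends_prefix:
  assumes "\<zeta> \<in> ends"
  obtains w where "length w = n" "\<zeta> \<in> cyl w"
proof -
  obtain u where u: "u \<in> rays" "u \<in> \<zeta>" using assms by (rule ends_nonempty)
  then have "conv u u" by (simp add: rays_def)
  then obtain N where N: "\<forall>i\<ge>N. \<forall>j\<ge>N. n \<le> length (lcp (rw (u i)) (rw (u j)))" unfolding conv_def by blast
  define w where "w = take n (rw (u N))"
  have "n \<le> length (rw (u N))" using N by (metis lcp_self order_refl)
  then have w: "length w = n" by (simp add: w_def)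
  moreover have "prefix w (rw (u j))" if j: "j \<ge> N" for j
  proof (rule prefix_of_lcp)
    show "prefix w (rw (u N))" by (simp add: w_def take_is_prefix)
    show "length w \<le> length (lcp (rw (u N)) (rw (u j)))" using N j w by simp
  qed
  then have "\<zeta> \<in> cyl w" using u cyl_iff[OF assms u(2)] by (auto simp: eventually_sequentially)
  ultimately show thesis using that by blast
qed

lemma cyl_words: "\<zeta> \<in> cyl w \<Longrightarrow> w \<in> words \<and> reduced_word w"
proof (erule cyl_cases)
  fix u and i :: nat assume *: "u i \<in> carrier F" "prefix w (rw (u i))"
  then obtain v where "rw (u i) = w @ v" by (auto simp: prefix_def)
  then show "w \<in> words \<and> reduced_word w"
    using rw_words[OF *(1)] reduced_rw[OF *(1)] by (simp add: reduced_word_append)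
qed

lemma boundary_product_cyl:
  assumes "\<zeta> \<in> cyl w" "\<xi> \<in> cyl w"
  shows "boundary_product (word_dist F X) \<one> \<zeta> \<xi> \<ge> ereal (length w)"
proof -
  obtain u v where uv: "\<zeta> \<in> ends" "\<xi> \<in> ends" "u \<in> \<zeta>" "v \<in> \<xi>" using assms by (metis cyl_cases)
  have "\<forall>\<^sub>F i in sequentially. prefix w (rw (u i))" "\<forall>\<^sub>F i in sequentially. prefix w (rw (v i))"
    using cyl_iff uv assms by blast+
  then have "\<forall>\<^sub>F p in sequentially \<times>\<^sub>F sequentially. prefix w (rw (u (fst p))) \<and> prefix w (rw (v (snd p)))"
    by (rule eventually_prodI)
  then have "\<forall>\<^sub>F p in sequentially \<times>\<^sub>F sequentially. ereal (length w) \<le>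
      (case p of (i, j) \<Rightarrow> ereal (gromov_product (word_dist F X) \<one> (u i) (v j)))"
  proof eventually_elim
    case (elim p)
    then have "length w \<le> length (lcp (rw (u (fst p))) (rw (v (snd p))))"
      by (simp add: prefix_lcp_iff prefix_length_le)
    then show ?case using uv by (simp add: split_beta gromov_product_eq rays_carrier ends_mem)
  qed
  then have "ereal (length w) \<le> Liminf (sequentially \<times>\<^sub>F sequentially)
      (\<lambda>(i, j). ereal (gromov_product (word_dist F X) \<one> (u i) (v j)))" by (rule Liminf_bounded)
  also have "\<dots> \<le> boundary_product (word_dist F X) \<one> \<zeta> \<xi>"
    unfolding boundary_product_def by (rule SUP_upper2[of "(u, v)"]) (use uv in auto)
  finally show ?thesis .
qed

lemma cyl_boundary_product:
  assumes "\<zeta> \<in> cyl w" "\<xi> \<in> ends" "boundary_product (word_dist F X) \<one> \<zeta> \<xi> > ereal (length w)"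
  shows "\<xi> \<in> cyl w"
proof -
  have \<zeta>: "\<zeta> \<in> ends" using assms(1) cyl_subset by blast
  obtain u v where uv: "u \<in> \<zeta>" "v \<in> \<xi>" "ereal (length w) < Liminf (sequentially \<times>\<^sub>F sequentially)
      (\<lambda>(i, j). ereal (gromov_product (word_dist F X) \<one> (u i) (v j)))"
    using assms(3) unfolding boundary_product_def less_SUP_iff by auto
  have "\<forall>\<^sub>F p in sequentially \<times>\<^sub>F sequentially. ereal (length w) <
      (case p of (i, j) \<Rightarrow> ereal (gromov_product (word_dist F X) \<one> (u i) (v j)))"
    using uv(3) by (rule less_LiminfD)
  then obtain N where "\<forall>i\<ge>N. \<forall>j\<ge>N. length w < gromov_product (word_dist F X) \<one> (u i) (v j)"
    by (auto simp: eventually_prod_sequentially)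
  then have "\<forall>\<^sub>F i in sequentially. length w \<le> length (lcp (rw (u i)) (rw (v i)))"
    unfolding eventually_sequentially
    using uv \<zeta> assms(2) by (intro exI[of _ N]) (auto simp: gromov_product_eq rays_carrier ends_mem less_imp_le)
  moreover have "\<forall>\<^sub>F i in sequentially. prefix w (rw (u i))" using cyl_iff[OF \<zeta> uv(1)] assms(1) by simp
  ultimately have "\<forall>\<^sub>F i in sequentially. prefix w (rw (v i))" by eventually_elim (metis prefix_of_lcp)
  then show ?thesis using cyl_iff[OF assms(2) uv(2)] by simp
qed

text \<open>Two inclusions make the neighbourhood systems equivalent: a cylinder over a word longer
  than \<open>r\<close> lies in the neighbourhood of level \<open>r\<close> of each of its points,
  and the neighbourhood of level \<open>length w\<close> of a point of \<open>cyl w\<close> lies in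
  \<open>cyl w\<close>.\<close>

lemma openin_bdry_iff:
  "openin (bdry F X) U \<longleftrightarrow> U \<subseteq> ends \<and> (\<forall>\<zeta>\<in>U. \<exists>w. \<zeta> \<in> cyl w \<and> cyl w \<subseteq> U)"
proof -
  have "(\<exists>r::real. {\<xi> \<in> ends. boundary_product (word_dist F X) \<one> \<zeta> \<xi> > ereal r} \<subseteq> U) \<longleftrightarrow> (\<exists>w. \<zeta> \<in> cyl w \<and> cyl w \<subseteq> U)"
    if "\<zeta> \<in> ends" for \<zeta>
  proof
    assume "\<exists>r::real. {\<xi> \<in> ends. boundary_product (word_dist F X) \<one> \<zeta> \<xi> > ereal r} \<subseteq> U"
    then obtain r :: real where r: "{\<xi> \<in> ends. boundary_product (word_dist F X) \<one> \<zeta> \<xi> > ereal r} \<subseteq> U" ..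
    obtain n :: nat where "r < n" using reals_Archimedean2 by blast
    obtain w where w: "length w = n" "\<zeta> \<in> cyl w" using ends_prefix[OF \<open>\<zeta> \<in> ends\<close>] .
    have "cyl w \<subseteq> U"
    proof
      fix \<xi> assume \<xi>: "\<xi> \<in> cyl w"
      have "ereal r < ereal (length w)" using \<open>r < n\<close> w by simp
      also have "\<dots> \<le> boundary_product (word_dist F X) \<one> \<zeta> \<xi>" by (rule boundary_product_cyl[OF w(2) \<xi>])
      finally show "\<xi> \<in> U" using r \<xi> cyl_subset by blast
    qed
    then show "\<exists>w. \<zeta> \<in> cyl w \<and> cyl w \<subseteq> U" using w by blast
  next
    assume "\<exists>w. \<zeta> \<in> cyl w \<and> cyl w \<subseteq> U"
    then obtain w where w: "\<zeta> \<in> cyl w" "cyl w \<subseteq> U" by blast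
    show "\<exists>r::real. {\<xi> \<in> ends. boundary_product (word_dist F X) \<one> \<zeta> \<xi> > ereal r} \<subseteq> U"
      using cyl_boundary_product[OF w(1)] w(2) by (intro exI[of _ "real (length w)"]) auto
  qed
  then show ?thesis
    unfolding bdry_def openin_gromov_topology ends_def[symmetric] by blast
qed

lemma openin_cyl: "openin (bdry F X) (cyl w)"
  using cyl_subset by (auto simp: openin_bdry_iff)

lemma openin_ends: "openin (bdry F X) ends"
  using cyl_Nil by (auto simp: openin_bdry_iff)

lemma topspace_bdry: "topspace (bdry F X) = ends"
  using openin_ends openin_topspace by (metis openin_bdry_iff openin_subset subset_antisym)

lemma openin_compl_cyl: "openin (bdry F X) (ends - cyl w)"
  unfolding openin_bdry_iff
proof (intro conjI ballI)
  fix \<zeta> assume \<zeta>: "\<zeta> \<in> ends - cyl w"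
  obtain v where v: "length v = length w" "\<zeta> \<in> cyl v" using ends_prefix[of \<zeta>] \<zeta> by blast
  then show "\<exists>v. \<zeta> \<in> cyl v \<and> cyl v \<subseteq> ends - cyl w"
    using \<zeta> cyl_same_length cyl_subset by (intro exI[of _ v]) blast
qed auto

lemma closedin_cyl: "closedin (bdry F X) (cyl w)"
  using openin_compl_cyl cyl_subset by (simp add: closedin_def topspace_bdry)

lemma closedin_compl_cyl: "closedin (bdry F X) (ends - cyl w)"
  using openin_cyl openin_ends topspace_bdry by (metis closedin_diff closedin_topspace)

text \<open>The finite words, read as group elements, form a sequence that converges to the end
  described by the infinite word.\<close>

lemma class_of_prefixes:
  assumes "\<And>n. W n \<in> words \<and> reduced_word (W n) \<and> length (W n) = n \<and> prefix (W n) (W (Suc n))"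
  shows "\<exists>\<zeta>\<in>ends. \<forall>n. \<zeta> \<in> cyl (W n)"
proof -
  define u where "u n = wv (W n)" for n
  have mono: "prefix (W m) (W n)" if "m \<le> n" for m n
    using that by (induction n rule: dec_induct) (use assms prefix_order.trans in blast)+
  have rw: "rw (u n) = W n" "u n \<in> carrier F" for n using assms by (auto simp: u_def)
  have "n \<le> length (lcp (rw (u i)) (rw (u j)))" if "i \<ge> n" "j \<ge> n" for n i j
    using mono[OF that(1)] mono[OF that(2)] assms[of n] prefix_length_le[of "W n" "lcp (W i) (W j)"]
    by (simp add: rw prefix_lcp_iff)
  then have u: "u \<in> rays" using rw by (auto simp: rays_def conv_def)
  then have uc: "u \<in> {v \<in> rays. conv u v}" by (auto simp: rays_def)
  show ?thesis
    by (rule bexI[OF _ class_mem_ends[OF u]])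
      (use mono rw in \<open>auto simp: cyl_iff[OF class_mem_ends[OF u] uc] eventually_sequentially\<close>)
qed

end

section \<open>Compactness of the boundary\<close>

text \<open>Koenig's lemma: as \<open>X\<close> is finite, a cylinder without finite subcover has a
  one-letter extension without one. The infinite word so obtained is an end, and a member of the
  cover around this end contains one of these cylinders.\<close>

lemma (in fin_free_group) compact_space_bdry: "compact_space (bdry F X)"
  unfolding compact_space_def compactin_def topspace_bdry
proof (intro conjI allI impI; (elim conjE)?)
  fix \<U> assume U: "\<forall>U\<in>\<U>. openin (bdry F X) U" "ends \<subseteq> \<Union>\<U>"
  define good where "good A \<longleftrightarrow> (\<exists>\<F>. finite \<F> \<and> \<F> \<subseteq> \<U> \<and> A \<subseteq> \<Union>\<F>)" for A
  have good_UN: "good (\<Union>i\<in>I. A i)" if I: "finite I" "\<And>i. i \<in> I \<Longrightarrow> good (A i)" for I :: "('a \<times> bool) set" and A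
  proof -
    have "\<exists>G. \<forall>i\<in>I. finite (G i) \<and> G i \<subseteq> \<U> \<and> A i \<subseteq> \<Union>(G i)"
      by (rule bchoice) (use I(2) in \<open>simp add: good_def\<close>)
    then obtain G where G: "\<forall>i\<in>I. finite (G i) \<and> G i \<subseteq> \<U> \<and> A i \<subseteq> \<Union>(G i)" ..
    have "finite (\<Union>i\<in>I. G i)" using G I(1) by blast
    moreover have "(\<Union>i\<in>I. G i) \<subseteq> \<U>" using G by blast
    moreover have "(\<Union>i\<in>I. A i) \<subseteq> \<Union>(\<Union>i\<in>I. G i)"
    proof
      fix x assume "x \<in> (\<Union>i\<in>I. A i)"
      then obtain i where i: "i \<in> I" "x \<in> A i" by blast
      then have "x \<in> \<Union>(G i)" using bspec[OF G i(1)] by (meson subsetD)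
      then show "x \<in> \<Union>(\<Union>i\<in>I. G i)" using i(1) by (meson UN_I UnionE UnionI)
    qed
    ultimately show ?thesis unfolding good_def by blast
  qed
  have step: "\<exists>l. \<not> good (cyl (w @ [l]))" if "\<not> good (cyl w)" for w
  proof (rule ccontr)
    assume *: "\<not> ?thesis"
    have "good (\<Union>l\<in>X \<times> UNIV. cyl (w @ [l]))"
      by (rule good_UN) (use finite_X * in auto)
    moreover have "cyl w \<subseteq> (\<Union>l\<in>X \<times> UNIV. cyl (w @ [l]))"
    proof
      fix \<zeta> assume \<zeta>: "\<zeta> \<in> cyl w"
      then have "\<zeta> \<in> ends" using cyl_subset by blast
      then obtain v where v: "length v = Suc (length w)" "\<zeta> \<in> cyl v" by (rule ends_prefix)
      then have "prefix w v" using cyl_comparable[OF \<zeta> v(2)] prefix_length_le by fastforce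
      then obtain r where r: "v = w @ r" by (auto simp: prefix_def)
      then obtain l where "r = [l]" using v(1) by (cases r) auto
      with r have "v = w @ [l]" by simp
      then show "\<zeta> \<in> (\<Union>l\<in>X \<times> UNIV. cyl (w @ [l]))"
        using v(2) cyl_words[OF v(2)] by (cases l) force
    qed
    ultimately show False using that unfolding good_def by (meson order_trans)
  qed
  show "\<exists>\<F>. finite \<F> \<and> \<F> \<subseteq> \<U> \<and> ends \<subseteq> \<Union>\<F>"
  proof (rule ccontr)
    assume "\<not> ?thesis"
    then have "\<not> good (cyl [])" by (simp add: good_def cyl_Nil)
    then have "\<exists>W. \<forall>n. (\<not> good (cyl (W n)) \<and> length (W n) = n) \<and> (\<exists>l. W (Suc n) = W n @ [l])"
      by (intro dependent_nat_choice[where P = "\<lambda>n w. \<not> good (cyl w) \<and> length w = n" and Q = "\<lambda>n w v. \<exists>l. v = w @ [l]"])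
        (use step in force)+
    then obtain W where W: "\<And>n. \<not> good (cyl (W n))" "\<And>n. length (W n) = n" "\<And>n. \<exists>l. W (Suc n) = W n @ [l]" by blast
    have "W n \<in> words \<and> reduced_word (W n) \<and> length (W n) = n \<and> prefix (W n) (W (Suc n))" for n
    proof -
      \<comment> \<open>The empty set has a finite subcover, so these cylinders are nonempty, and
        therefore the words of the branch are reduced words over \<open>X\<close>.\<close>
      have "cyl (W n) \<noteq> {}" using W(1)[of n] unfolding good_def by force
      then show ?thesis using cyl_words W(2,3)[of n] by auto
    qed
    then obtain \<zeta> where \<zeta>: "\<zeta> \<in> ends" "\<And>n. \<zeta> \<in> cyl (W n)" using class_of_prefixes[of W] by blast
    obtain V w where V: "V \<in> \<U>" "\<zeta> \<in> cyl w" "cyl w \<subseteq> V" using U \<zeta>(1) openin_bdry_iff by (meson UnionE subsetD)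
    have "w = W (length w)" using cyl_same_length[OF V(2) \<zeta>(2)] W(2) by simp
    then have "good (cyl (W (length w)))" unfolding good_def using V by (intro exI[of _ "{V}"]) auto
    then show False using W(1) by blast
  qed
qed simp

section \<open>Boundary maps induced by maps of the group\<close>

context free_group
begin

text \<open>The second clause is uniform continuity measured by common prefixes. The inverse is part
  of the predicate so that everything holds for both maps, and multiplicativity is left out because
  left translations have to be covered along with transvections.\<close>

definition end_homeo :: "('a \<Rightarrow> 'a) \<Rightarrow> ('a \<Rightarrow> 'a) \<Rightarrow> bool" where
  "end_homeo f g \<longleftrightarrow> (\<forall>(p, q)\<in>{(f, g), (g, f)}. (\<forall>a\<in>carrier F. p a \<in> carrier F \<and> q (p a) = a) \<and>
     (\<forall>n. \<exists>m. \<forall>a\<in>carrier F. \<forall>b\<in>carrier F.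
        m \<le> length (lcp (rw a) (rw b)) \<longrightarrow> n \<le> length (lcp (rw (p a)) (rw (p b)))))"

lemma end_homeo_sym: "end_homeo f g \<Longrightarrow> end_homeo g f"
  by (auto simp: end_homeo_def)

lemma end_homeo_closed: "end_homeo f g \<Longrightarrow> a \<in> carrier F \<Longrightarrow> f a \<in> carrier F"
  and end_homeo_inverse: "end_homeo f g \<Longrightarrow> a \<in> carrier F \<Longrightarrow> g (f a) = a"
  and end_homeo_unif: "end_homeo f g \<Longrightarrow> \<exists>m. \<forall>a\<in>carrier F. \<forall>b\<in>carrier F.
        m \<le> length (lcp (rw a) (rw b)) \<longrightarrow> n \<le> length (lcp (rw (f a)) (rw (f b)))"
  by (auto simp: end_homeo_def)

lemma end_homeo_conv:
  assumes f: "end_homeo f g" and uv: "range u \<subseteq> carrier F" "range v \<subseteq> carrier F" "conv u v"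
  shows "conv (f \<circ> u) (f \<circ> v)"
  unfolding conv_def
proof
  fix n
  obtain m where m: "\<forall>a\<in>carrier F. \<forall>b\<in>carrier F.
        m \<le> length (lcp (rw a) (rw b)) \<longrightarrow> n \<le> length (lcp (rw (f a)) (rw (f b)))"
    using end_homeo_unif[OF f] by blast
  obtain N where N: "\<forall>i\<ge>N. \<forall>j\<ge>N. m \<le> length (lcp (rw (u i)) (rw (v j)))"
    using uv(3) unfolding conv_def by blast
  have "n \<le> length (lcp (rw ((f \<circ> u) i)) (rw ((f \<circ> v) j)))" if "i \<ge> N" "j \<ge> N" for i j
    using m N[rule_format, OF that] uv(1,2) by (simp add: range_subsetD)
  then show "\<exists>N. \<forall>i\<ge>N. \<forall>j\<ge>N. n \<le> length (lcp (rw ((f \<circ> u) i)) (rw ((f \<circ> v) j)))" by blast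
qed

lemma end_homeo_rays:
  assumes "end_homeo f g" "u \<in> rays"
  shows "f \<circ> u \<in> rays"
  using assms end_homeo_conv[OF assms(1), of u u] end_homeo_closed[OF assms(1)] by (auto simp: rays_def)

lemma end_homeo_inverse_seq:
  assumes "end_homeo f g" "u \<in> rays"
  shows "g \<circ> (f \<circ> u) = u"
  using assms by (auto simp: fun_eq_iff end_homeo_inverse rays_carrier)

text \<open>\<open>bdry2_map\<close> takes plain images of equivalence classes. Such an image is a
  whole class, because \<open>g\<close> brings every sequence equivalent to
  \<open>f \<circ> u\<close> back into \<zeta>.\<close>

lemma end_homeo_image:
  assumes f: "end_homeo f g" and \<zeta>: "\<zeta> \<in> ends" "u \<in> \<zeta>"
  shows "(\<circ>) f ` \<zeta> \<in> ends" "f \<circ> u \<in> (\<circ>) f ` \<zeta>"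
proof -
  have range: "range v \<subseteq> carrier F" if "v \<in> rays" for v using that by (simp add: rays_def)
  have u: "u \<in> rays" using ends_mem \<zeta> .
  have fu: "f \<circ> u \<in> rays" using end_homeo_rays[OF f u] .
  have "(\<circ>) f ` \<zeta> = {v \<in> rays. conv (f \<circ> u) v}"
  proof (intro equalityI subsetI)
    fix t assume "t \<in> (\<circ>) f ` \<zeta>"
    then obtain v where v: "v \<in> \<zeta>" "t = f \<circ> v" by blast
    then have "v \<in> rays" "conv u v" using ends_mem[OF \<zeta>(1)] ends_conv[OF \<zeta>] by auto
    then show "t \<in> {v \<in> rays. conv (f \<circ> u) v}"
      using end_homeo_rays[OF f] end_homeo_conv[OF f range[OF u] range] v(2) by simp
  next
    fix v assume "v \<in> {v \<in> rays. conv (f \<circ> u) v}"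
    then have v: "v \<in> rays" "conv (f \<circ> u) v" by auto
    have "conv (g \<circ> (f \<circ> u)) (g \<circ> v)"
      by (rule end_homeo_conv[OF end_homeo_sym[OF f] range[OF fu] range[OF v(1)] v(2)])
    then have "g \<circ> v \<in> \<zeta>"
      using end_homeo_rays[OF end_homeo_sym[OF f] v(1)] ends_class(2)[OF \<zeta>] end_homeo_inverse_seq[OF f u] by simp
    moreover have "v = f \<circ> (g \<circ> v)" using end_homeo_inverse_seq[OF end_homeo_sym[OF f] v(1)] by simp
    ultimately show "v \<in> (\<circ>) f ` \<zeta>" by blast
  qed
  then show "(\<circ>) f ` \<zeta> \<in> ends" using class_mem_ends[OF fu] by simp
  show "f \<circ> u \<in> (\<circ>) f ` \<zeta>" using \<zeta>(2) by blast
qed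

lemma end_homeo_image_cyl_iff:
  assumes "end_homeo f g" "\<zeta> \<in> ends" "u \<in> \<zeta>"
  shows "(\<circ>) f ` \<zeta> \<in> cyl w \<longleftrightarrow> (\<forall>\<^sub>F i in sequentially. prefix w (rw (f (u i))))"
  using cyl_iff[OF end_homeo_image[OF assms]] by simp

lemma end_homeo_image_mem: "end_homeo f g \<Longrightarrow> \<zeta> \<in> ends \<Longrightarrow> (\<circ>) f ` \<zeta> \<in> ends"
  using end_homeo_image(1) ends_nonempty by metis

lemma end_homeo_image_inverse:
  assumes f: "end_homeo f g" and \<zeta>: "\<zeta> \<in> ends"
  shows "(\<circ>) g ` (\<circ>) f ` \<zeta> = \<zeta>"
  using end_homeo_inverse_seq[OF f ends_mem[OF \<zeta>]] by (force simp: image_image)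

lemma continuous_end_homeo:
  assumes f: "end_homeo f g"
  shows "continuous_map (bdry F X) (bdry F X) ((`) ((\<circ>) f))"
  unfolding continuous_map_def topspace_bdry
proof (intro conjI allI impI)
  show "(`) ((\<circ>) f) \<in> ends \<rightarrow> ends" using end_homeo_image_mem[OF f] by auto
  fix U assume U: "openin (bdry F X) U"
  show "openin (bdry F X) {\<zeta> \<in> ends. (\<circ>) f ` \<zeta> \<in> U}"
    unfolding openin_bdry_iff
  proof (intro conjI ballI)
    fix \<zeta> assume "\<zeta> \<in> {\<zeta> \<in> ends. (\<circ>) f ` \<zeta> \<in> U}"
    then have \<zeta>: "\<zeta> \<in> ends" "(\<circ>) f ` \<zeta> \<in> U" by auto
    obtain w where w: "(\<circ>) f ` \<zeta> \<in> cyl w" "cyl w \<subseteq> U" using U \<zeta>(2) unfolding openin_bdry_iff by blast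
    obtain m where m: "\<forall>a\<in>carrier F. \<forall>b\<in>carrier F.
        m \<le> length (lcp (rw a) (rw b)) \<longrightarrow> length w \<le> length (lcp (rw (f a)) (rw (f b)))"
      using end_homeo_unif[OF f] by blast
    obtain v where v: "length v = m" "\<zeta> \<in> cyl v" using ends_prefix[OF \<zeta>(1)] .
    obtain u where u: "u \<in> rays" "u \<in> \<zeta>" using ends_nonempty[OF \<zeta>(1)] .
    have "\<xi> \<in> {\<zeta> \<in> ends. (\<circ>) f ` \<zeta> \<in> U}" if \<xi>: "\<xi> \<in> cyl v" for \<xi>
    proof -
      have \<xi>e: "\<xi> \<in> ends" using \<xi> cyl_subset by blast
      obtain t where t: "t \<in> rays" "t \<in> \<xi>" using ends_nonempty[OF \<xi>e] .
      have 1: "\<forall>\<^sub>F i in sequentially. prefix v (rw (u i))" using v(2) cyl_iff[OF \<zeta>(1) u(2)] by simp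
      have 2: "\<forall>\<^sub>F i in sequentially. prefix v (rw (t i))" using \<xi> cyl_iff[OF \<xi>e t(2)] by simp
      have 3: "\<forall>\<^sub>F i in sequentially. prefix w (rw (f (u i)))"
        using w(1) end_homeo_image_cyl_iff[OF f \<zeta>(1) u(2)] by simp
      have "\<forall>\<^sub>F i in sequentially. prefix w (rw (f (t i)))"
        using 1 2 3
      proof eventually_elim
        case (elim i)
        then have "m \<le> length (lcp (rw (u i)) (rw (t i)))"
          using v(1) prefix_length_le[of v "lcp (rw (u i)) (rw (t i))"] by (simp add: prefix_lcp_iff)
        then have "length w \<le> length (lcp (rw (f (u i))) (rw (f (t i))))"
          using m rays_carrier[OF u(1)] rays_carrier[OF t(1)] by blast
        then show ?case using elim(3) by (rule prefix_of_lcp[rotated])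
      qed
      then have "(\<circ>) f ` \<xi> \<in> cyl w" using end_homeo_image_cyl_iff[OF f \<xi>e t(2)] by simp
      then show ?thesis using \<xi>e w(2) by blast
    qed
    then show "\<exists>v. \<zeta> \<in> cyl v \<and> cyl v \<subseteq> {\<zeta> \<in> ends. (\<circ>) f ` \<zeta> \<in> U}" using v(2) by blast
  qed auto
qed

lemma topspace_bdry2: "topspace (bdry2 F X) = {(\<zeta>, \<xi>). \<zeta> \<in> ends \<and> \<xi> \<in> ends \<and> \<zeta> \<noteq> \<xi>}"
  by (auto simp: bdry2_def topspace_bdry)

lemma bdry2_map_apply: "bdry2_map f (\<zeta>, \<xi>) = ((\<circ>) f ` \<zeta>, (\<circ>) f ` \<xi>)"
  by (simp add: bdry2_map_def)

lemma continuous_bdry2_map: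
  assumes f: "end_homeo f g"
  shows "continuous_map (bdry2 F X) (bdry2 F X) (bdry2_map f)"
  unfolding bdry2_def
proof (rule continuous_map_into_subtopology)
  have "continuous_map (prod_topology (bdry F X) (bdry F X)) (prod_topology (bdry F X) (bdry F X)) (bdry2_map f)"
    unfolding bdry2_map_def map_prod_def
    using continuous_end_homeo[OF f] by (simp add: continuous_map_prod_top)
  then show "continuous_map (subtopology (prod_topology (bdry F X) (bdry F X)) {(\<zeta>, \<xi>). \<zeta> \<noteq> \<xi>})
     (prod_topology (bdry F X) (bdry F X)) (bdry2_map f)"
    by (rule continuous_map_from_subtopology)
  show "bdry2_map f \<in> topspace (subtopology (prod_topology (bdry F X) (bdry F X)) {(\<zeta>, \<xi>). \<zeta> \<noteq> \<xi>}) \<rightarrow> {(\<zeta>, \<xi>). \<zeta> \<noteq> \<xi>}"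
  proof
    fix p assume "p \<in> topspace (subtopology (prod_topology (bdry F X) (bdry F X)) {(\<zeta>, \<xi>). \<zeta> \<noteq> \<xi>})"
    then obtain \<zeta> \<xi> where "p = (\<zeta>, \<xi>)" "\<zeta> \<in> ends" "\<xi> \<in> ends" "\<zeta> \<noteq> \<xi>"
      using topspace_bdry2 unfolding bdry2_def by blast
    then show "bdry2_map f p \<in> {(\<zeta>, \<xi>). \<zeta> \<noteq> \<xi>}"
      using end_homeo_image_inverse[OF f] by (simp add: bdry2_map_apply) metis
  qed
qed

lemma continuous_swap: "continuous_map (bdry2 F X) (bdry2 F X) prod.swap"
  unfolding bdry2_def
proof (rule continuous_map_into_subtopology)
  have "continuous_map (prod_topology (bdry F X) (bdry F X)) (prod_topology (bdry F X) (bdry F X)) prod.swap"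
    unfolding prod.swap_def by (intro continuous_map_pairedI continuous_map_fst continuous_map_snd)
  then show "continuous_map (subtopology (prod_topology (bdry F X) (bdry F X)) {(\<zeta>, \<xi>). \<zeta> \<noteq> \<xi>})
     (prod_topology (bdry F X) (bdry F X)) prod.swap"
    by (rule continuous_map_from_subtopology)
qed auto

lemma length_rw_mult_le:
  assumes "g \<in> carrier F" "h \<in> carrier F"
  shows "length (rw (g \<otimes> h)) \<le> length (rw g) + length (rw h)"
  using length_rw_inv_mult[of "inv g" h] assms by (simp add: rw_inv)

text \<open>A map that moves adjacent vertices to bounded distance and is proper at a linear rate maps
  the tail of a long geodesic away from \<^term>\<open>\<one>\<close>; the images of two vertices with a long common
  prefix are therefore joined by a chain of pairwise close vertices far from \<^term>\<open>\<one>\<close>.\<close>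

lemma quasi_isometry_lcp:
  assumes f: "\<And>a. a \<in> carrier F \<Longrightarrow> f a \<in> carrier F"
    and lip: "\<And>a l. a \<in> carrier F \<Longrightarrow> fst l \<in> X \<Longrightarrow> length (rw (inv (f a) \<otimes> f (a \<otimes> lval l))) \<le> C"
    and proper: "\<And>a. a \<in> carrier F \<Longrightarrow> length (rw a) \<le> C * length (rw (f a)) + C"
  shows "\<exists>m. \<forall>a\<in>carrier F. \<forall>b\<in>carrier F.
        m \<le> length (lcp (rw a) (rw b)) \<longrightarrow> n \<le> length (lcp (rw (f a)) (rw (f b)))"
proof -
  \<comment> \<open>Chosen so that vertices of length at least \<open>m\<close> have images of
    length at least \<open>n + C\<close>. Images of adjacent vertices are at distance at most
    \<open>C\<close>, so they then share a prefix of length at least \<open>n\<close>.\<close>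
  define m where "m = C * (n + C) + C + 1"
  have far: "n + C \<le> length (rw (f a))" if "a \<in> carrier F" "length (rw a) \<ge> m" for a
  proof (rule ccontr)
    assume "\<not> ?thesis"
    then have "C * length (rw (f a)) \<le> C * (n + C)" by (intro mult_le_mono2) simp
    then show False using proper[OF that(1)] that(2) unfolding m_def by linarith
  qed
  have step: "n \<le> length (lcp (rw (f a)) (rw (f (a \<otimes> lval l))))"
    if "a \<in> carrier F" "fst l \<in> X" "length (rw a) \<ge> m" "length (rw (a \<otimes> lval l)) \<ge> m" for a l
  proof -
    have al: "a \<otimes> lval l \<in> carrier F" using that lval_closed by simp
    have "real (length (rw (inv (f a) \<otimes> f (a \<otimes> lval l)))) \<le> C" using lip[OF that(1,2)] by simp
    then show ?thesis
      using far[OF that(1,3)] far[OF al that(4)] length_rw_inv_mult[OF f[OF that(1)] f[OF al]] by linarith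
  qed
  have chain: "n \<le> length (lcp (rw (f (wv p))) (rw (f (wv (p @ u)))))"
    if "reduced_word (p @ u)" "p @ u \<in> words" "length p \<ge> m" for p u
    using that
  proof (induction u rule: rev_induct)
    case Nil
    then show ?case using far[of "wv p"] by simp
  next
    case (snoc l u)
    have W: "reduced_word (p @ u)" "p @ u \<in> words" "fst l \<in> X" "p \<in> words" "u \<in> words"
      using snoc.prems by (auto simp: reduced_word_append)
    have eq: "wv (p @ u @ [l]) = wv (p @ u) \<otimes> lval l"
      using wv_append[of "p @ u" "[l]"] W lval_closed by simp
    have rw: "rw (wv (p @ u) \<otimes> lval l) = p @ u @ [l]" "rw (wv (p @ u)) = p @ u"
      using snoc.prems W unfolding eq[symmetric] by (simp_all del: wv_Cons)
    have "n \<le> length (lcp (rw (f (wv (p @ u)))) (rw (f (wv (p @ u) \<otimes> lval l))))"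
      by (rule step) (use W rw snoc.prems(3) in auto)
    moreover have "n \<le> length (lcp (rw (f (wv p))) (rw (f (wv (p @ u)))))"
      using snoc.IH W snoc.prems(3) by simp
    ultimately show ?case
      unfolding eq using length_lcp_ultrametric[of "rw (f (wv p))" "rw (f (wv (p @ u)))" "rw (f (wv (p @ u) \<otimes> lval l))"]
      by linarith
  qed
  have "n \<le> length (lcp (rw (f a)) (rw (f b)))"
    if ab: "a \<in> carrier F" "b \<in> carrier F" "m \<le> length (lcp (rw a) (rw b))" for a b
  proof -
    define p where "p = lcp (rw a) (rw b)"
    obtain u where u: "rw a = p @ u" using longest_common_prefix_prefix1 unfolding p_def prefix_def by blast
    obtain v where v: "rw b = p @ v" using longest_common_prefix_prefix2 unfolding p_def prefix_def by blast
    have W: "reduced_word (p @ u)" "p @ u \<in> words" "reduced_word (p @ v)" "p @ v \<in> words"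
      using rw_words[OF ab(1)] rw_words[OF ab(2)] reduced_rw[OF ab(1)] reduced_rw[OF ab(2)] unfolding u v by auto
    have m: "m \<le> length p" using ab(3) by (simp add: p_def)
    have "a = wv (p @ u)" "b = wv (p @ v)" using wv_rw ab u v by metis+
    then have "n \<le> length (lcp (rw (f (wv p))) (rw (f a)))" "n \<le> length (lcp (rw (f (wv p))) (rw (f b)))"
      using chain[OF W(1,2) m] chain[OF W(3,4) m] by auto
    then show ?thesis
      using length_lcp_ultrametric[of "rw (f a)" "rw (f (wv p))" "rw (f b)"] lcp_commute[of "rw (f a)"] by simp
  qed
  then show ?thesis by blast
qed

lemma end_homeo_translation:
  assumes k: "k \<in> carrier F"
  shows "end_homeo (\<lambda>h. k \<otimes> h) (\<lambda>h. inv k \<otimes> h)"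
proof -
  have *: "\<exists>m. \<forall>a\<in>carrier F. \<forall>b\<in>carrier F.
        m \<le> length (lcp (rw a) (rw b)) \<longrightarrow> n \<le> length (lcp (rw (k \<otimes> a)) (rw (k \<otimes> b)))"
    if k: "k \<in> carrier F" for k n
  proof (rule quasi_isometry_lcp[where C = "Suc (length (rw k))"])
    fix a and l :: "'a \<times> bool" assume a: "a \<in> carrier F" "fst l \<in> X"
    then have "inv (k \<otimes> a) \<otimes> (k \<otimes> (a \<otimes> lval l)) = lval l"
      using k lval_closed by (simp add: inv_solve_left' m_assoc)
    moreover have "rw (lval l) = [l]"
      using rw_wv[of "[l]"] a lval_closed by (simp add: reduced_word_Cons)
    ultimately show "length (rw (inv (k \<otimes> a) \<otimes> (k \<otimes> (a \<otimes> lval l)))) \<le> Suc (length (rw k))" by simp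
  next
    fix a assume a: "a \<in> carrier F"
    have "length (rw (inv k \<otimes> (k \<otimes> a))) \<le> length (rw (inv k)) + length (rw (k \<otimes> a))"
      using k a by (intro length_rw_mult_le) auto
    then show "length (rw a) \<le> Suc (length (rw k)) * length (rw (k \<otimes> a)) + Suc (length (rw k))"
      using k a by (simp add: rw_inv flip: m_assoc)
  qed (use k in simp)
  show ?thesis
    unfolding end_homeo_def using *[OF k] *[of "inv k"] k by (simp flip: m_assoc)
qed

lemma length_transvect_word: "length (transvect_word c b w) \<le> 2 * length w"
proof -
  have "length (lcons l v) \<le> Suc (length v)" for l :: "'c \<times> bool" and v by (auto simp: lcons_def)
  note le = this
  show ?thesis
  proof (induction w)
    case (Cons l w)
    then show ?case
      using le[of c "lcons b (transvect_word c b w)"] le[of b "transvect_word c b w"]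
        le[of "linv b" "lcons (linv c) (transvect_word c b w)"] le[of "linv c" "transvect_word c b w"]
        le[of l "transvect_word c b w"] by auto
  qed simp
qed

lemma end_homeo_transvection:
  assumes yb: "y \<in> X" "fst b \<in> X" "fst b \<noteq> y"
  shows "end_homeo (transvection y b) (transvection y (linv b))"
proof -
  have *: "\<exists>m. \<forall>a\<in>carrier F. \<forall>a'\<in>carrier F. m \<le> length (lcp (rw a) (rw a')) \<longrightarrow>
      n \<le> length (lcp (rw (transvection y b a)) (rw (transvection y b a')))"
    if yb: "y \<in> X" "fst b \<in> X" "fst b \<noteq> y" for b n
  \<comment> \<open>A transvection sends a letter to at most two letters. The same bound for its
    inverse gives properness, so 2 serves for both conditions.\<close>
  proof (rule quasi_isometry_lcp[where C = 2])
    fix a and l :: "'a \<times> bool" assume a: "a \<in> carrier F" "fst l \<in> X"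
    have C: "transvection y b a \<in> carrier F" "transvection y b (lval l) \<in> carrier F"
      using transvection_closed[OF yb] a lval_closed by auto
    have "transvection y b (a \<otimes> lval l) = transvection y b a \<otimes> transvection y b (lval l)"
      by (rule hom_mult[OF transvection_hom[OF yb]]) (use a lval_closed in auto)
    then have "inv (transvection y b a) \<otimes> transvection y b (a \<otimes> lval l) = transvection y b (lval l)"
      using C by (simp flip: m_assoc)
    moreover have "rw (lval l) = [l]"
      using rw_wv[of "[l]"] a lval_closed by (simp add: reduced_word_Cons)
    ultimately show "length (rw (inv (transvection y b a) \<otimes> transvection y b (a \<otimes> lval l))) \<le> 2"
      using length_transvect_word[of "(y, True)" b "[l]"] rw_transvection[OF yb, of "lval l"] a lval_closed
      by (simp del: transvect_word.simps)
  next
    fix a assume a: "a \<in> carrier F"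
    have "length (rw (transvection y (linv b) (transvection y b a))) \<le> 2 * length (rw (transvection y b a))"
      using rw_transvection[of y "linv b" "transvection y b a"] length_transvect_word yb transvection_closed[OF yb a] by simp
    then show "length (rw a) \<le> 2 * length (rw (transvection y b a)) + 2"
      using transvection_inverse[OF yb a] by simp
  qed (use transvection_closed[OF yb] in simp)
  show ?thesis
    unfolding end_homeo_def
    using *[OF yb] *[of "linv b"] transvection_closed[OF yb] transvection_closed[of y "linv b"] yb
    by (simp add: transvection_inverse transvection_inverse')
qed

end

section \<open>Currents invariant under transvections\<close>

lemma space_borel_of: "space (borel_of T) = topspace T"
  unfolding borel_of_def by (rule space_measure_of) (auto dest: openin_subset)

lemma openin_sets_borel_of: "openin T U \<Longrightarrow> U \<in> sets (borel_of T)"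
  unfolding borel_of_def by (subst sets_measure_of) (auto dest: openin_subset)

lemma measurable_borel_of:
  assumes f: "continuous_map T T' f" and M: "sets M = sets (borel_of T)"
  shows "f \<in> measurable M (borel_of T')"
proof -
  have sp: "space M = topspace T" using sets_eq_imp_space_eq[OF M] by (simp add: space_borel_of)
  show ?thesis
    unfolding borel_of_def
  proof (rule measurable_measure_of)
    show "f \<in> space M \<rightarrow> topspace T'" using continuous_map_funspace[OF f] by (simp add: sp)
    fix U assume "U \<in> {U. openin T' U}"
    then have "openin T {x \<in> topspace T. f x \<in> U}" using f by (simp add: continuous_map_def)
    then have "{x \<in> topspace T. f x \<in> U} \<in> sets M" unfolding M by (rule openin_sets_borel_of)
    moreover have "f -` U \<inter> space M = {x \<in> topspace T. f x \<in> U}" by (auto simp: sp)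
    ultimately show "f -` U \<inter> space M \<in> sets M" by simp
  qed (auto dest: openin_subset)
qed

context free_group
begin

lemma openin_bdry2_Times:
  assumes "openin (bdry F X) A" "openin (bdry F X) B" "A \<inter> B = {}"
  shows "openin (bdry2 F X) (A \<times> B)"
proof -
  have "openin (prod_topology (bdry F X) (bdry F X)) (A \<times> B)" using assms by (simp add: openin_prod_Times_iff)
  moreover have "A \<times> B = A \<times> B \<inter> {(\<zeta>, \<xi>). \<zeta> \<noteq> \<xi>}" using assms(3) by auto
  ultimately show ?thesis unfolding bdry2_def openin_subtopology by blast
qed

lemma sets_current: "\<nu> \<in> currents F X \<Longrightarrow> sets \<nu> = sets (borel_of (bdry2 F X))"
  by (simp add: currents_def radon_measure_def)

lemma space_current: "\<nu> \<in> currents F X \<Longrightarrow> space \<nu> = topspace (bdry2 F X)"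
  using sets_eq_imp_space_eq[OF sets_current] by (simp add: space_borel_of)

lemma emeasure_distr_current:
  assumes "\<nu> \<in> currents F X" "continuous_map (bdry2 F X) (bdry2 F X) f" "A \<in> sets \<nu>"
  shows "emeasure (distr \<nu> (borel_of (bdry2 F X)) f) A = emeasure \<nu> (f -` A \<inter> space \<nu>)"
  using assms sets_current[OF assms(1)] by (intro emeasure_distr measurable_borel_of) auto

lemma preimage_sets_current:
  assumes "\<nu> \<in> currents F X" "continuous_map (bdry2 F X) (bdry2 F X) f" "A \<in> sets \<nu>"
  shows "f -` A \<inter> space \<nu> \<in> sets \<nu>"
  using assms(3) sets_current[OF assms(1)]
  by (intro measurable_sets[OF measurable_borel_of[OF assms(2) sets_current[OF assms(1)]]]) simp

text \<open>Negating \<open>cyl_iff\<close> would give only infinitely many indices. Comparison with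
  the prefix of \<zeta> that has the same length as \<open>w\<close> gives almost all of
  them.\<close>

lemma not_cyl_eventually:
  assumes "\<zeta> \<in> ends" "u \<in> \<zeta>" "\<zeta> \<notin> cyl w"
  shows "\<forall>\<^sub>F i in sequentially. \<not> prefix w (rw (u i))"
proof -
  obtain v where v: "length v = length w" "\<zeta> \<in> cyl v" using ends_prefix[OF assms(1)] .
  have "\<forall>\<^sub>F i in sequentially. prefix v (rw (u i))" using v(2) cyl_iff[OF assms(1,2)] by simp
  then show ?thesis
  proof eventually_elim
    case (elim i)
    show ?case
    proof
      assume "prefix w (rw (u i))"
      then have "v = w" using elim v(1) prefix_same_cases[of v "rw (u i)" w] by (auto simp: prefix_def)
      then show False using v(2) assms(3) by simp
    qed
  qed
qed

text \<open>The pairs of ends whose connecting geodesic crosses the edge from \<^term>\<open>\<one>\<close> to \<^term>\<open>y\<close> and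
  continues along the word \<^term>\<open>w\<close>, which starts with \<^term>\<open>(y, True)\<close>.\<close>

definition edge_pairs :: "'a \<Rightarrow> ('a \<times> bool) list \<Rightarrow> ((nat \<Rightarrow> 'a) set \<times> (nat \<Rightarrow> 'a) set) set" where
  "edge_pairs y w = (ends - cyl [(y, True)]) \<times> cyl w"

lemma openin_edge_pairs:
  assumes "prefix [(y, True)] w"
  shows "openin (bdry2 F X) (edge_pairs y w)"
  unfolding edge_pairs_def
  by (rule openin_bdry2_Times[OF openin_compl_cyl openin_cyl]) (use cyl_prefix_mono[OF assms] in blast)

lemma sets_edge_pairs: "\<nu> \<in> currents F X \<Longrightarrow> prefix [(y, True)] w \<Longrightarrow> edge_pairs y w \<in> sets \<nu>"
  using openin_sets_borel_of[OF openin_edge_pairs] sets_current by simp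

lemma transvection_cyl_iff:
  assumes yb: "y \<in> X" "fst b \<in> X" "fst b \<noteq> y" and \<zeta>: "\<zeta> \<in> ends"
  shows "(\<circ>) (transvection y b) ` \<zeta> \<in> cyl [(y, True)] \<longleftrightarrow> \<zeta> \<in> cyl [(y, True)]"
proof -
  obtain u where u: "u \<in> rays" "u \<in> \<zeta>" using ends_nonempty[OF \<zeta>] .
  show ?thesis
    using cyl_iff[OF \<zeta> u(2), of "[(y, True)]"] end_homeo_image_cyl_iff[OF end_homeo_transvection[OF yb] \<zeta> u(2), of "[(y, True)]"]
    by (simp add: prefix_transvection_iff[OF yb rays_carrier[OF u(1)]])
qed

lemma transvection_cyl:
  assumes yb: "y \<in> X" "fst b \<in> X" "fst b \<noteq> y"
    and \<zeta>: "\<zeta> \<in> cyl [(y, True)]" "\<zeta> \<notin> cyl [(y, True), linv b]"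
  shows "(\<circ>) (transvection y b) ` \<zeta> \<in> cyl [(y, True), b]"
proof -
  have e: "\<zeta> \<in> ends" using \<zeta>(1) cyl_subset by blast
  obtain u where u: "u \<in> rays" "u \<in> \<zeta>" using ends_nonempty[OF e] .
  have "\<forall>\<^sub>F i in sequentially. prefix [(y, True)] (rw (u i))" using \<zeta>(1) cyl_iff[OF e u(2)] by blast
  moreover have "\<forall>\<^sub>F i in sequentially. \<not> prefix [(y, True), linv b] (rw (u i))"
    by (rule not_cyl_eventually[OF e u(2) \<zeta>(2)])
  ultimately have "\<forall>\<^sub>F i in sequentially. prefix [(y, True), b] (rw (transvection y b (u i)))"
    by eventually_elim (rule prefix_transvection[OF yb rays_carrier[OF u(1)]])
  then show ?thesis using end_homeo_image_cyl_iff[OF end_homeo_transvection[OF yb] e u(2)] by blast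
qed

text \<open>A point of \<^term>\<open>edge_pairs y [(y, True)]\<close> outside \<^term>\<open>edge_pairs y [(y, True), linv b]\<close> is mapped
  into \<^term>\<open>edge_pairs y [(y, True), b]\<close>, and the scaling factor has to be \<^term>\<open>1::real\<close> because
  \<^term>\<open>edge_pairs y [(y, True)]\<close> is its own preimage.\<close>

lemma current_edge_split:
  assumes \<nu>: "\<nu> \<in> currents F X" and yb: "y \<in> X" "fst b \<in> X" "fst b \<noteq> y"
    and r: "r > 0" "act_current F X (transvection y b) \<nu> = scale_measure (ennreal r) \<nu>"
    and fin: "emeasure \<nu> (edge_pairs y [(y, True)]) < \<infinity>"
  shows "emeasure \<nu> (edge_pairs y [(y, True)]) \<le>
    emeasure \<nu> (edge_pairs y [(y, True), b]) + emeasure \<nu> (edge_pairs y [(y, True), linv b])"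
proof (cases "emeasure \<nu> (edge_pairs y [(y, True)]) = 0")
  case False
  define \<Phi> where "\<Phi> = bdry2_map (transvection y b)"
  note H = end_homeo_transvection[OF yb]
  have cont: "continuous_map (bdry2 F X) (bdry2 F X) \<Phi>" unfolding \<Phi>_def by (rule continuous_bdry2_map[OF H])
  have scale: "ennreal r * emeasure \<nu> A = emeasure \<nu> (\<Phi> -` A \<inter> space \<nu>)" if "A \<in> sets \<nu>" for A
    using emeasure_distr_current[OF \<nu> cont that] r(2) by (simp add: act_current_def \<Phi>_def)
  have sets: "edge_pairs y [(y, True)] \<in> sets \<nu>" "edge_pairs y [(y, True), l] \<in> sets \<nu>" for l
    using sets_edge_pairs[OF \<nu>] by auto
  have sub: "edge_pairs y [(y, True)] \<subseteq> space \<nu>" using sets.sets_into_space[OF sets(1)] .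
  have "\<Phi> -` edge_pairs y [(y, True)] \<inter> space \<nu> = edge_pairs y [(y, True)]"
    using sub by (auto simp: \<Phi>_def edge_pairs_def bdry2_map_apply space_current[OF \<nu>] topspace_bdry2
        transvection_cyl_iff[OF yb] end_homeo_image_mem[OF H])
  then have eq: "ennreal r * emeasure \<nu> (edge_pairs y [(y, True)]) = emeasure \<nu> (edge_pairs y [(y, True)])"
    using scale[OF sets(1)] by simp
  obtain m where m: "emeasure \<nu> (edge_pairs y [(y, True)]) = ennreal m" "m \<ge> 0"
    using fin by (cases "emeasure \<nu> (edge_pairs y [(y, True)])") auto
  then have "r * m = m" using eq r(1) by (simp flip: ennreal_mult)
  then have "r = 1" using m False by auto
  have "edge_pairs y [(y, True)] \<subseteq> (\<Phi> -` edge_pairs y [(y, True), b] \<inter> space \<nu>) \<union> edge_pairs y [(y, True), linv b]"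
  proof
    fix p assume p: "p \<in> edge_pairs y [(y, True)]"
    then obtain \<zeta> \<xi> where *: "p = (\<zeta>, \<xi>)" "\<zeta> \<in> ends" "\<zeta> \<notin> cyl [(y, True)]" "\<xi> \<in> cyl [(y, True)]"
      by (auto simp: edge_pairs_def)
    show "p \<in> (\<Phi> -` edge_pairs y [(y, True), b] \<inter> space \<nu>) \<union> edge_pairs y [(y, True), linv b]"
    proof (cases "\<xi> \<in> cyl [(y, True), linv b]")
      case True
      then show ?thesis using * by (simp add: edge_pairs_def)
    next
      case nc: False
      have "\<Phi> p \<in> edge_pairs y [(y, True), b]"
        using * transvection_cyl[OF yb *(4) nc] transvection_cyl_iff[OF yb *(2)] end_homeo_image_mem[OF H *(2)]
        by (simp add: \<Phi>_def edge_pairs_def bdry2_map_apply)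
      then show ?thesis using p sub by auto
    qed
  qed
  then have "emeasure \<nu> (edge_pairs y [(y, True)]) \<le>
      emeasure \<nu> ((\<Phi> -` edge_pairs y [(y, True), b] \<inter> space \<nu>) \<union> edge_pairs y [(y, True), linv b])"
    using preimage_sets_current[OF \<nu> cont sets(2)] sets by (intro emeasure_mono) auto
  also have "\<dots> \<le> emeasure \<nu> (\<Phi> -` edge_pairs y [(y, True), b] \<inter> space \<nu>) + emeasure \<nu> (edge_pairs y [(y, True), linv b])"
    by (rule emeasure_subadditive[OF preimage_sets_current[OF \<nu> cont sets(2)] sets(2)])
  also have "emeasure \<nu> (\<Phi> -` edge_pairs y [(y, True), b] \<inter> space \<nu>) = emeasure \<nu> (edge_pairs y [(y, True), b])"
    using scale[OF sets(2), of b] \<open>r = 1\<close> by simp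
  finally show ?thesis .
qed simp

end

section \<open>Vanishing of invariant currents\<close>

context fin_free_group
begin

text \<open>Both factors are closed in a compact space, and as they are disjoint their product
  misses the diagonal. A Radon measure is therefore finite on it.\<close>

lemma compactin_edge_pairs: "compactin (bdry2 F X) (edge_pairs y [(y, True)])"
proof -
  have "compactin (prod_topology (bdry F X) (bdry F X)) (edge_pairs y [(y, True)])"
    unfolding edge_pairs_def
    using closedin_compact_space[OF compact_space_bdry closedin_cyl] closedin_compact_space[OF compact_space_bdry closedin_compl_cyl]
    by (simp add: compactin_Times)
  then show ?thesis
    unfolding bdry2_def compactin_subtopology by (auto simp: edge_pairs_def)
qed

lemma current_edge_zero:
  assumes \<nu>: "\<nu> \<in> currents F X" and y: "y \<in> X" and bc: "b \<in> X" "c \<in> X" "b \<noteq> y" "c \<noteq> y" "b \<noteq> c"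
    and inv: "\<And>x. x \<in> {b, c} \<Longrightarrow> \<exists>r>0. act_current F X (transvection y (x, True)) \<nu> = scale_measure (ennreal r) \<nu>"
  shows "emeasure \<nu> (edge_pairs y [(y, True)]) = 0"
proof -
  have fin: "emeasure \<nu> (edge_pairs y [(y, True)]) < \<infinity>"
    using \<nu> compactin_edge_pairs by (simp add: currents_def radon_measure_def)
  define p where "p l = emeasure \<nu> (edge_pairs y [(y, True), l])" for l
  have split: "emeasure \<nu> (edge_pairs y [(y, True)]) \<le> p (x, True) + p (x, False)" if x: "x \<in> {b, c}" for x
  proof -
    obtain r where "r > 0" "act_current F X (transvection y (x, True)) \<nu> = scale_measure (ennreal r) \<nu>" using inv[OF x] by blast
    then show ?thesis
      using current_edge_split[OF \<nu> y, of "(x, True)" r] x bc fin by (auto simp: p_def linv_def)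
  qed
  let ?I = "{(b, True), (b, False), (c, True), (c, False)}"
  have sets: "edge_pairs y [(y, True), l] \<in> sets \<nu>" for l
    using sets_edge_pairs[OF \<nu>] by auto
  \<comment> \<open>Distinct words of equal length have disjoint cylinders.\<close>
  have "disjoint_family_on (\<lambda>l. edge_pairs y [(y, True), l]) ?I"
    unfolding disjoint_family_on_def edge_pairs_def using cyl_same_length by fastforce
  then have "sum p ?I = emeasure \<nu> (\<Union>l\<in>?I. edge_pairs y [(y, True), l])"
    unfolding p_def using sets by (intro sum_emeasure) auto
  also have "\<dots> \<le> emeasure \<nu> (edge_pairs y [(y, True)])"
  proof (rule emeasure_mono)
    have "edge_pairs y [(y, True), l] \<subseteq> edge_pairs y [(y, True)]" for l
      unfolding edge_pairs_def using cyl_prefix_mono[of "[(y, True)]" "[(y, True), l]"] by auto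
    then show "(\<Union>l\<in>?I. edge_pairs y [(y, True), l]) \<subseteq> edge_pairs y [(y, True)]" by blast
  qed (rule sets_edge_pairs[OF \<nu>], simp)
  also have "sum p ?I = (p (b, True) + p (b, False)) + (p (c, True) + p (c, False))"
    using bc(5) by (simp add: add.assoc)
  finally have "emeasure \<nu> (edge_pairs y [(y, True)]) + emeasure \<nu> (edge_pairs y [(y, True)])
      \<le> emeasure \<nu> (edge_pairs y [(y, True)])"
    using add_mono[OF split[of b] split[of c]] by (meson insertCI order_trans)
  then show ?thesis
    using fin by (cases "emeasure \<nu> (edge_pairs y [(y, True)])") (auto simp flip: ennreal_plus)
qed

lemma translation_cyl_iff:
  assumes "k \<in> carrier F" "\<zeta> \<in> ends" "u \<in> \<zeta>"
  shows "(\<circ>) (\<lambda>h. k \<otimes> h) ` \<zeta> \<in> cyl w \<longleftrightarrow> (\<forall>\<^sub>F i in sequentially. prefix w (rw (k \<otimes> u i)))"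
  by (rule end_homeo_image_cyl_iff[OF end_homeo_translation[OF assms(1)] assms(2,3)])

lemma translation_strip_prefix:
  assumes "\<zeta> \<in> cyl (p @ [a])"
  shows "(\<circ>) (\<lambda>h. inv (wv p) \<otimes> h) ` \<zeta> \<in> cyl [a]"
proof -
  have e: "\<zeta> \<in> ends" using assms cyl_subset by blast
  have p: "p \<in> words" using cyl_words[OF assms] by simp
  obtain u where u: "u \<in> rays" "u \<in> \<zeta>" using ends_nonempty[OF e] .
  have "\<forall>\<^sub>F i in sequentially. prefix (p @ [a]) (rw (u i))" using assms cyl_iff[OF e u(2)] by blast
  then have "\<forall>\<^sub>F i in sequentially. prefix [a] (rw (inv (wv p) \<otimes> u i))"
  proof eventually_elim
    case (elim i)
    then obtain r where r: "rw (u i) = p @ a # r" by (auto simp: prefix_def)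
    have ui: "u i \<in> carrier F" using rays_carrier[OF u(1)] .
    have W: "a # r \<in> words" "reduced_word (a # r)"
      using rw_words[OF ui] reduced_rw[OF ui] unfolding r by (auto simp: reduced_word_append)
    have "u i = wv p \<otimes> wv (a # r)" using wv_append[OF p W(1)] wv_rw[OF ui] r by metis
    then have "inv (wv p) \<otimes> u i = wv (a # r)" using p W(1) wv_closed by (simp flip: m_assoc del: wv_Cons)
    then have "rw (inv (wv p) \<otimes> u i) = a # r" using rw_wv[OF W] by metis
    then show ?case by simp
  qed
  then show ?thesis using translation_cyl_iff[OF inv_closed[OF wv_closed[OF p]] e u(2)] by blast
qed

text \<open>Multiplication by \<open>y\<close> puts \<open>y\<close> in front unless it cancels the
  first letter; in that case reducedness keeps the next letter from being \<open>y\<close>.\<close>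

lemma translation_generator_cyl:
  assumes y: "y \<in> X" and \<zeta>: "\<zeta> \<in> cyl [a]"
  shows "(\<circ>) (\<lambda>h. y \<otimes> h) ` \<zeta> \<in> cyl [(y, True)] \<longleftrightarrow> a \<noteq> (y, False)"
proof -
  have e: "\<zeta> \<in> ends" using \<zeta> cyl_subset by blast
  obtain u where u: "u \<in> rays" "u \<in> \<zeta>" using ends_nonempty[OF e] .
  have "\<forall>\<^sub>F i in sequentially. prefix [a] (rw (u i))" using \<zeta> cyl_iff[OF e u(2)] by blast
  then have "\<forall>\<^sub>F i in sequentially. prefix [(y, True)] (rw (y \<otimes> u i)) \<longleftrightarrow> a \<noteq> (y, False)"
  proof eventually_elim
    case (elim i)
    have ui: "u i \<in> carrier F" using rays_carrier[OF u(1)] .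
    obtain r where r: "rw (u i) = a # r" using elim by (auto simp: prefix_def)
    have "rw (y \<otimes> u i) = lcons (y, True) (a # r)"
      using rw_lval_mult[OF ui, of "(y, True)"] y r by (simp add: lval_def)
    moreover have "r \<noteq> [] \<Longrightarrow> hd r \<noteq> linv a" using reduced_rw[OF ui] r by (simp add: reduced_word_Cons)
    ultimately show ?case by (cases r) (auto simp: lcons_def linv_def)
  qed
  \<comment> \<open>If \<open>a = (y, False)\<close>, the prefix property fails eventually, and it
    cannot hold eventually as well because \<open>sequentially\<close> is nontrivial.\<close>
  then have "(\<forall>\<^sub>F i in sequentially. prefix [(y, True)] (rw (y \<otimes> u i))) \<longleftrightarrow> a \<noteq> (y, False)"
    using eventually_happens'[OF sequentially_bot, OF eventually_conj]
    by (cases "a = (y, False)") (auto dest: eventually_conj)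
  then show ?thesis using translation_cyl_iff[OF X_carrier[OF y] e u(2)] by simp
qed

text \<open>Ends with common prefixes of every length coincide, so there is a least length without
  one. It is positive, since every end lies in \<open>cyl []\<close>, and \<open>p\<close> is the
  common prefix one letter shorter.\<close>

lemma ends_branch:
  assumes "\<zeta> \<in> ends" "\<xi> \<in> ends" "\<zeta> \<noteq> \<xi>"
  obtains p a b where "\<zeta> \<in> cyl (p @ [a])" "\<xi> \<in> cyl (p @ [b])" "a \<noteq> b"
proof -
  define common where "common n \<longleftrightarrow> (\<exists>w. length w = n \<and> \<zeta> \<in> cyl w \<and> \<xi> \<in> cyl w)" for n
  obtain u where u: "u \<in> rays" "u \<in> \<zeta>" using ends_nonempty[OF assms(1)] .
  obtain v where v: "v \<in> rays" "v \<in> \<xi>" using ends_nonempty[OF assms(2)] .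
  have "\<exists>n. \<not> common n"
  proof (rule ccontr)
    assume all: "\<not> ?thesis"
    have "conv u v"
      unfolding conv_def
    proof
      fix n
      obtain w where w: "length w = n" "\<zeta> \<in> cyl w" "\<xi> \<in> cyl w" using all unfolding common_def by blast
      obtain N1 where N1: "\<forall>i\<ge>N1. prefix w (rw (u i))"
        using w(2) cyl_iff[OF assms(1) u(2)] by (auto simp: eventually_sequentially)
      obtain N2 where N2: "\<forall>i\<ge>N2. prefix w (rw (v i))"
        using w(3) cyl_iff[OF assms(2) v(2)] by (auto simp: eventually_sequentially)
      have "n \<le> length (lcp (rw (u i)) (rw (v j)))" if "i \<ge> max N1 N2" "j \<ge> max N1 N2" for i j
        using N1 N2 that w(1) prefix_length_le[of w "lcp (rw (u i)) (rw (v j))"] by (simp add: prefix_lcp_iff)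
      then show "\<exists>N. \<forall>i\<ge>N. \<forall>j\<ge>N. n \<le> length (lcp (rw (u i)) (rw (v j)))" by blast
    qed
    then show False using ends_eqI[OF assms(1,2) u(2) v(2)] assms(3) by simp
  qed
  define n where "n = (LEAST n. \<not> common n)"
  have n: "\<not> common n" "m < n \<Longrightarrow> common m" for m
    using LeastI_ex[OF \<open>\<exists>n. \<not> common n\<close>] not_less_Least[of m] unfolding n_def by auto
  have "common 0" unfolding common_def using assms cyl_Nil by auto
  then obtain k where k: "n = Suc k" using n(1) by (cases n) auto
  then obtain p where p: "length p = k" "\<zeta> \<in> cyl p" "\<xi> \<in> cyl p" using n(2)[of k] unfolding common_def by auto
  have ext: "\<exists>l. \<eta> \<in> cyl (p @ [l])" if \<eta>: "\<eta> \<in> ends" "\<eta> \<in> cyl p" for \<eta>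
  proof -
    obtain w where w: "length w = Suc k" "\<eta> \<in> cyl w" using ends_prefix[OF \<eta>(1)] .
    then have "prefix p w" using cyl_comparable[OF \<eta>(2) w(2)] p(1) prefix_length_le by fastforce
    then obtain r where r: "w = p @ r" by (auto simp: prefix_def)
    then obtain l where "r = [l]" using w(1) p(1) by (cases r) auto
    then show ?thesis using w(2) r by blast
  qed
  obtain a b where ab: "\<zeta> \<in> cyl (p @ [a])" "\<xi> \<in> cyl (p @ [b])" using ext assms p by meson
  moreover have "a \<noteq> b" using ab n(1) p(1) k unfolding common_def by auto
  ultimately show thesis using that by blast
qed

text \<open>Removing the common prefix of the two ends moves their geodesic through the identity. If
  it leaves towards \<xi> along a generator \<open>y\<close>, it crosses the required edge. If it
  leaves along the inverse of \<open>y\<close>, a further translation by \<open>y\<close> makes it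
  cross that edge backwards, which is why the flip appears.\<close>

lemma translate_meets_edge:
  assumes "(\<zeta>, \<xi>) \<in> topspace (bdry2 F X)"
  shows "\<exists>k\<in>carrier F. \<exists>y\<in>X. bdry2_map (\<lambda>h. k \<otimes> h) (\<zeta>, \<xi>) \<in> edge_pairs y [(y, True)] \<or>
     prod.swap (bdry2_map (\<lambda>h. k \<otimes> h) (\<zeta>, \<xi>)) \<in> edge_pairs y [(y, True)]"
proof -
  have e: "\<zeta> \<in> ends" "\<xi> \<in> ends" "\<zeta> \<noteq> \<xi>" using assms by (auto simp: topspace_bdry2)
  obtain p a b where pab: "\<zeta> \<in> cyl (p @ [a])" "\<xi> \<in> cyl (p @ [b])" "a \<noteq> b" using ends_branch[OF e] .
  define g where "g = inv (wv p)"
  have p: "p \<in> words" "fst b \<in> X" using cyl_words[OF pab(2)] by auto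
  have g: "g \<in> carrier F" using p by (simp add: g_def)
  define \<zeta>' \<xi>' where "\<zeta>' = (\<circ>) (\<lambda>h. g \<otimes> h) ` \<zeta>" and "\<xi>' = (\<circ>) (\<lambda>h. g \<otimes> h) ` \<xi>"
  have *: "\<zeta>' \<in> cyl [a]" "\<xi>' \<in> cyl [b]"
    using translation_strip_prefix pab by (auto simp: \<zeta>'_def \<xi>'_def g_def)
  obtain y s where b: "b = (y, s)" by (cases b)
  have y: "y \<in> X" using p b by simp
  show ?thesis
  proof (cases s)
    case True
    have "\<zeta>' \<notin> cyl [b]" using cyl_same_length[OF *(1), of "[b]"] pab(3) by auto
    then have "bdry2_map (\<lambda>h. g \<otimes> h) (\<zeta>, \<xi>) \<in> edge_pairs y [(y, True)]"
      using * b True cyl_subset by (auto simp: bdry2_map_apply edge_pairs_def \<zeta>'_def \<xi>'_def)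
    then show ?thesis using g y by blast
  next
    case False
    have yg: "y \<otimes> g \<in> carrier F" using y g X_carrier by simp
    have comp: "(\<circ>) (\<lambda>h. (y \<otimes> g) \<otimes> h) ` \<eta> = (\<circ>) (\<lambda>h. y \<otimes> h) ` (\<circ>) (\<lambda>h. g \<otimes> h) ` \<eta>" if "\<eta> \<in> ends" for \<eta>
      unfolding image_image
    proof (rule image_cong[OF refl])
      fix u assume "u \<in> \<eta>"
      then show "(\<lambda>h. (y \<otimes> g) \<otimes> h) \<circ> u = (\<lambda>h. y \<otimes> h) \<circ> ((\<lambda>h. g \<otimes> h) \<circ> u)"
        using rays_carrier[OF ends_mem[OF that]] y g X_carrier by (simp add: fun_eq_iff m_assoc)
    qed
    have "(\<circ>) (\<lambda>h. (y \<otimes> g) \<otimes> h) ` \<zeta> \<in> cyl [(y, True)]"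
      using translation_generator_cyl[OF y *(1)] pab(3) b False comp[OF e(1)] by (auto simp: \<zeta>'_def)
    moreover have "(\<circ>) (\<lambda>h. (y \<otimes> g) \<otimes> h) ` \<xi> \<notin> cyl [(y, True)]"
      using translation_generator_cyl[OF y *(2)] b False comp[OF e(2)] by (auto simp: \<xi>'_def)
    moreover have "(\<circ>) (\<lambda>h. (y \<otimes> g) \<otimes> h) ` \<xi> \<in> ends"
      by (rule end_homeo_image_mem[OF end_homeo_translation[OF yg] e(2)])
    ultimately have "prod.swap (bdry2_map (\<lambda>h. (y \<otimes> g) \<otimes> h) (\<zeta>, \<xi>)) \<in> edge_pairs y [(y, True)]"
      by (simp add: bdry2_map_apply edge_pairs_def)
    then show ?thesis using yg y by blast
  qed
qed

lemma current_zero_if_edges_zero: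
  assumes \<nu>: "\<nu> \<in> currents F X" and zero: "\<And>y. y \<in> X \<Longrightarrow> emeasure \<nu> (edge_pairs y [(y, True)]) = 0"
  shows "emeasure \<nu> (space \<nu>) = 0"
proof -
  define A where "A k y = bdry2_map (\<lambda>h. k \<otimes> h) -` edge_pairs y [(y, True)] \<inter> space \<nu>" for k y
  define S where "S y = prod.swap -` edge_pairs y [(y, True)] \<inter> space \<nu>" for y
  define B where "B k y = bdry2_map (\<lambda>h. k \<otimes> h) -` S y \<inter> space \<nu>" for k y
  have cont: "continuous_map (bdry2 F X) (bdry2 F X) (bdry2_map (\<lambda>h. k \<otimes> h))" if "k \<in> carrier F" for k
    by (rule continuous_bdry2_map[OF end_homeo_translation[OF that]])
  have inv: "emeasure \<nu> (bdry2_map (\<lambda>h. k \<otimes> h) -` C \<inter> space \<nu>) = emeasure \<nu> C" if "k \<in> carrier F" "C \<in> sets \<nu>" for k C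
    using emeasure_distr_current[OF \<nu> cont[OF that(1)] that(2)] \<nu> that(1) by (simp add: currents_def)
  have sets: "edge_pairs y [(y, True)] \<in> sets \<nu>" for y using sets_edge_pairs[OF \<nu>] by simp
  have S: "S y \<in> sets \<nu>" "emeasure \<nu> (S y) = 0" if "y \<in> X" for y
    using preimage_sets_current[OF \<nu> continuous_swap sets[of y]]
      emeasure_distr_current[OF \<nu> continuous_swap sets[of y]] \<nu> zero[OF that]
    by (simp_all add: S_def currents_def)
  have "A k y \<in> null_sets \<nu>" "B k y \<in> null_sets \<nu>" if "k \<in> carrier F" "y \<in> X" for k y
    using inv[OF that(1) sets[of y]] inv[OF that(1) S(1)[OF that(2)]] S(2)[OF that(2)] zero[OF that(2)]
      preimage_sets_current[OF \<nu> cont[OF that(1)] sets[of y]] preimage_sets_current[OF \<nu> cont[OF that(1)] S(1)[OF that(2)]]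
    by (auto simp: A_def B_def null_sets_def)
  then have "(\<Union>k\<in>carrier F. \<Union>y\<in>X. A k y \<union> B k y) \<in> null_sets \<nu>"
    using countable_carrier finite_X by (intro null_sets_UN' null_sets.Un) (auto simp: countable_finite)
  moreover have "space \<nu> \<subseteq> (\<Union>k\<in>carrier F. \<Union>y\<in>X. A k y \<union> B k y)"
  proof
    fix q assume q: "q \<in> space \<nu>"
    obtain \<zeta> \<xi> where z: "q = (\<zeta>, \<xi>)" by (cases q)
    obtain k y where ky: "k \<in> carrier F" "y \<in> X" "bdry2_map (\<lambda>h. k \<otimes> h) q \<in> edge_pairs y [(y, True)] \<or>
       prod.swap (bdry2_map (\<lambda>h. k \<otimes> h) q) \<in> edge_pairs y [(y, True)]"
      using translate_meets_edge[of \<zeta> \<xi>] q space_current[OF \<nu>] z by auto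
    have "bdry2_map (\<lambda>h. k \<otimes> h) q \<in> space \<nu>"
      using continuous_map_funspace[OF cont[OF ky(1)]] q space_current[OF \<nu>] by auto
    then have "q \<in> A k y \<union> B k y" using ky(3) q by (auto simp: A_def B_def S_def)
    then show "q \<in> (\<Union>k\<in>carrier F. \<Union>y\<in>X. A k y \<union> B k y)" using ky by blast
  qed
  ultimately have "space \<nu> \<in> null_sets \<nu>" using null_sets_subset by blast
  then show ?thesis by auto
qed

end

section \<open>Outer automorphisms and the boundary of Outer space\<close>

context group
begin

definition conjugation :: "'a \<Rightarrow> 'a \<Rightarrow> 'a" where
  "conjugation g = (\<lambda>x\<in>carrier G. g \<otimes> x \<otimes> inv g)"

lemma carrier_AutoGroup: "carrier (AutoGroup G) = auto G"
  by (simp add: AutoGroup_def)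

lemma mult_AutoGroup: "f \<in> auto G \<Longrightarrow> g \<in> auto G \<Longrightarrow> f \<otimes>\<^bsub>AutoGroup G\<^esub> g = compose (carrier G) f g"
  by (simp add: AutoGroup_def BijGroup_def auto_def)

lemma one_AutoGroup: "\<one>\<^bsub>AutoGroup G\<^esub> = (\<lambda>x\<in>carrier G. x)"
  by (simp add: AutoGroup_def BijGroup_def)

lemma auto_closed: "f \<in> auto G \<Longrightarrow> x \<in> carrier G \<Longrightarrow> f x \<in> carrier G"
  by (auto simp: auto_def hom_def)

lemma auto_mult: "f \<in> auto G \<Longrightarrow> x \<in> carrier G \<Longrightarrow> y \<in> carrier G \<Longrightarrow> f (x \<otimes> y) = f x \<otimes> f y"
  by (auto simp: auto_def hom_def)

lemma compose_conjugation:
  "g \<in> carrier G \<Longrightarrow> h \<in> carrier G \<Longrightarrow> compose (carrier G) (conjugation g) (conjugation h) = conjugation (g \<otimes> h)"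
  by (auto simp: conjugation_def compose_def fun_eq_iff m_assoc inv_mult_group)

lemma conjugation_one: "conjugation \<one> = (\<lambda>x\<in>carrier G. x)"
  by (auto simp: conjugation_def fun_eq_iff)

lemma conjugation_inverse:
  "g \<in> carrier G \<Longrightarrow> x \<in> carrier G \<Longrightarrow> inv g \<otimes> (g \<otimes> x \<otimes> inv g) \<otimes> g = x"
  by (simp add: m_assoc) (simp flip: m_assoc)

lemma conjugation_auto:
  assumes g: "g \<in> carrier G"
  shows "conjugation g \<in> auto G"
proof -
  have "conjugation g \<in> hom G G"
  proof (rule homI)
    fix x y assume xy: "x \<in> carrier G" "y \<in> carrier G"
    have "inv g \<otimes> (g \<otimes> (y \<otimes> inv g)) = y \<otimes> inv g" using g xy by (simp flip: m_assoc)
    then show "conjugation g (x \<otimes> y) = conjugation g x \<otimes> conjugation g y"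
      using g xy by (simp add: conjugation_def m_assoc)
  qed (use g in \<open>simp add: conjugation_def\<close>)
  moreover have "bij_betw (conjugation g) (carrier G) (carrier G)"
    by (rule bij_betwI[where g = "conjugation (inv g)"])
      (use g conjugation_inverse[of g] conjugation_inverse[of "inv g"] in \<open>auto simp: conjugation_def\<close>)
  ultimately show ?thesis by (simp add: auto_def Bij_def conjugation_def)
qed

text \<open>Conjugation by \<open>a\<close> followed by \<open>f\<close> equals \<open>f\<close>
  followed by conjugation by \<open>f a\<close>. Normality is what allows inverses in
  \<open>Out F\<close> to be computed on representatives.\<close>

lemma inner_auts_normal: "inner_auts G \<lhd> AutoGroup G"
proof -
  interpret A: Group.group "AutoGroup G" by (rule AutoGroup)
  have inner: "inner_auts G = conjugation ` carrier G" by (auto simp: inner_auts_def conjugation_def)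
  have mult: "conjugation g \<otimes>\<^bsub>AutoGroup G\<^esub> conjugation h = conjugation (g \<otimes> h)" if "g \<in> carrier G" "h \<in> carrier G" for g h
    using that mult_AutoGroup[OF conjugation_auto conjugation_auto] compose_conjugation by simp
  have inv: "inv\<^bsub>AutoGroup G\<^esub> conjugation g = conjugation (inv g)" if "g \<in> carrier G" for g
    by (rule A.inv_equality)
      (use that conjugation_auto mult[of "inv g" g] conjugation_one in \<open>simp_all add: carrier_AutoGroup one_AutoGroup\<close>)
  have "subgroup (inner_auts G) (AutoGroup G)"
  proof (rule subgroup.intro)
    show "\<one>\<^bsub>AutoGroup G\<^esub> \<in> inner_auts G"
      unfolding inner one_AutoGroup conjugation_one[symmetric] by (rule imageI) simp
    show "inner_auts G \<subseteq> carrier (AutoGroup G)"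
      unfolding inner carrier_AutoGroup using conjugation_auto by blast
    fix f g assume "f \<in> inner_auts G" "g \<in> inner_auts G"
    then obtain a b where "a \<in> carrier G" "b \<in> carrier G" "f = conjugation a" "g = conjugation b"
      unfolding inner by blast
    then show "f \<otimes>\<^bsub>AutoGroup G\<^esub> g \<in> inner_auts G"
      using mult[of a b] unfolding inner by (intro image_eqI[of _ _ "a \<otimes> b"]) auto
  next
    fix f assume "f \<in> inner_auts G"
    then obtain a where "a \<in> carrier G" "f = conjugation a" unfolding inner by blast
    then show "inv\<^bsub>AutoGroup G\<^esub> f \<in> inner_auts G"
      using inv[of a] unfolding inner by (intro image_eqI[of _ _ "inv a"]) auto
  qed
  moreover have "f \<otimes>\<^bsub>AutoGroup G\<^esub> h \<otimes>\<^bsub>AutoGroup G\<^esub> inv\<^bsub>AutoGroup G\<^esub> f \<in> inner_auts G"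
    if f: "f \<in> carrier (AutoGroup G)" and h: "h \<in> inner_auts G" for f h
  proof -
    obtain a where a: "a \<in> carrier G" "h = conjugation a" using h unfolding inner by blast
    have fa: "f \<in> auto G" "f a \<in> carrier G" using f a auto_closed by (auto simp: carrier_AutoGroup)
    have hom: "f \<in> hom G G" using fa(1) by (simp add: auto_def)
    then have finv: "f (inv a) = inv (f a)"
      using a(1) by (intro group_hom.hom_inv) (simp_all add: group_hom_def group_hom_axioms_def is_group)
    have "f \<otimes>\<^bsub>AutoGroup G\<^esub> h = conjugation (f a) \<otimes>\<^bsub>AutoGroup G\<^esub> f"
      unfolding a(2) mult_AutoGroup[OF fa(1) conjugation_auto[OF a(1)]] mult_AutoGroup[OF conjugation_auto[OF fa(2)] fa(1)]
      using a(1) fa(1) finv by (auto simp: conjugation_def compose_def fun_eq_iff auto_mult auto_closed)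
    then have "f \<otimes>\<^bsub>AutoGroup G\<^esub> h \<otimes>\<^bsub>AutoGroup G\<^esub> inv\<^bsub>AutoGroup G\<^esub> f =
        conjugation (f a) \<otimes>\<^bsub>AutoGroup G\<^esub> (f \<otimes>\<^bsub>AutoGroup G\<^esub> inv\<^bsub>AutoGroup G\<^esub> f)"
      using A.m_assoc f conjugation_auto[OF fa(2)] A.inv_closed[OF f] by (simp add: carrier_AutoGroup del: A.r_inv)
    also have "\<dots> = conjugation (f a)"
      using f conjugation_auto[OF fa(2)] A.r_inv[OF f] A.r_one by (simp add: carrier_AutoGroup)
    finally show ?thesis unfolding inner using fa(2) by blast
  qed
  ultimately show ?thesis using A.normal_inv_iff by blast
qed

end

text \<open>The displacement of \<open>x\<close> under \<open>g\<close> is that of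
  \<open>\<rho> h x\<close> under the conjugate, and \<open>\<rho> h\<close> permutes the tree, so
  both infima range over the same values.\<close>

lemma cv_conjugation:
  assumes "group F" "l \<in> cv F" "g \<in> carrier F" "h \<in> carrier F"
  shows "l (h \<otimes>\<^bsub>F\<^esub> g \<otimes>\<^bsub>F\<^esub> inv\<^bsub>F\<^esub> h) = l g"
proof -
  interpret group F by fact
  obtain M :: "real set" and d \<rho> where *: "l = translation_length F M d \<rho>" "real_tree M d"
    "isometric_action F M d \<rho>" using assms(2) by (auto simp: cv_def)
  interpret group_action F M \<rho> using * by (simp add: isometric_action_def)
  have M: "\<rho> a x \<in> M" if "a \<in> carrier F" "x \<in> M" for a x using element_image[OF that] by simp
  have comp: "\<rho> (a \<otimes>\<^bsub>F\<^esub> b) x = \<rho> a (\<rho> b x)" if "a \<in> carrier F" "b \<in> carrier F" "x \<in> M" for a b x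
    using composition_rule[OF that(3,1,2)] .
  have one: "\<rho> \<one>\<^bsub>F\<^esub> x = x" if "x \<in> M" for x
    using id_eq_one that by (metis restrict_apply)
  have "d (\<rho> h x) (\<rho> (h \<otimes>\<^bsub>F\<^esub> g \<otimes>\<^bsub>F\<^esub> inv\<^bsub>F\<^esub> h) (\<rho> h x)) = d x (\<rho> g x)" if "x \<in> M" for x
  proof -
    have "\<rho> (h \<otimes>\<^bsub>F\<^esub> g \<otimes>\<^bsub>F\<^esub> inv\<^bsub>F\<^esub> h) (\<rho> h x) = \<rho> h (\<rho> g x)"
      using that assms by (simp add: M m_assoc flip: comp)
    then show ?thesis using *(3) assms that M by (simp add: isometric_action_def)
  qed
  then have "(\<lambda>x. d x (\<rho> (h \<otimes>\<^bsub>F\<^esub> g \<otimes>\<^bsub>F\<^esub> inv\<^bsub>F\<^esub> h) x)) ` \<rho> h ` M = (\<lambda>x. d x (\<rho> g x)) ` M"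
    by (simp add: image_image)
  then show ?thesis
    using assms surj_prop[OF assms(4)] by (simp add: *(1) translation_length_def)
qed

lemma act_length_invariant:
  assumes \<phi>: "\<phi> \<in> auto F" and inv: "\<And>g. g \<in> carrier F \<Longrightarrow> l (\<phi> g) = l g"
  shows "act_length F \<phi> (\<lambda>g\<in>carrier F. c * l g) = (\<lambda>g\<in>carrier F. c * l g)"
proof
  fix w
  show "act_length F \<phi> (\<lambda>g\<in>carrier F. c * l g) w = (\<lambda>g\<in>carrier F. c * l g) w"
  proof (cases "w \<in> carrier F")
    case True
    have bij: "bij_betw \<phi> (carrier F) (carrier F)" using \<phi> by (simp add: auto_def Bij_def)
    then have "inv_into (carrier F) \<phi> w \<in> carrier F" "\<phi> (inv_into (carrier F) \<phi> w) = w"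
      using True by (auto simp: bij_betw_def inv_into_into f_inv_into_f)
    then show ?thesis using True inv[of "inv_into (carrier F) \<phi> w"] by (simp add: act_length_def)
  qed (simp add: act_length_def)
qed

section \<open>The HNN class and its invariance under transvections\<close>

context fin_free_group
begin

text \<open>The length function of the Bass--Serre tree of the splitting of \<^term>\<open>F\<close> as an HNN extension
  with stable letter \<^term>\<open>t\<close> and trivial edge group: it counts the letters \<^term>\<open>t\<close> in the
  cyclically reduced word.\<close>

definition hnn_length :: "'a \<Rightarrow> 'a \<Rightarrow> real" where
  "hnn_length t = (\<lambda>g\<in>carrier F. gnorm (indicator {t}) (g \<otimes> g) - gnorm (indicator {t}) g)"

lemma gnorm_add: "gnorm (\<lambda>x. L x + M x) g = gnorm L g + gnorm M g"
proof -
  have "wt (\<lambda>x. L x + M x) w = wt L w + wt M w" for w by (induction w) auto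
  then show ?thesis by (simp add: gnorm_def)
qed

text \<open>\<^const>\<open>hnn_length\<close> is a difference of two length functions in \<^term>\<open>cv F\<close>.\<close>

lemma hnn_length_conjugation:
  assumes "g \<in> carrier F" "h \<in> carrier F"
  shows "hnn_length t (h \<otimes> g \<otimes> inv h) = hnn_length t g"
proof -
  let ?k = "h \<otimes> g \<otimes> inv h"
  have k: "?k \<in> carrier F" using assms by simp
  have "gnorm L (?k \<otimes> ?k) - gnorm L ?k = gnorm L (g \<otimes> g) - gnorm L g" if "\<And>x. L x \<ge> 1" for L
    using cv_conjugation[OF is_group gnorm_mem_cv[of 1 L] assms] that assms by simp
  from this[of "\<lambda>x. indicator {t} x + 1"] this[of "\<lambda>x. 1"]
  show ?thesis using assms k by (simp add: hnn_length_def gnorm_add)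
qed

lemma rw_generator: "x \<in> X \<Longrightarrow> rw x = [(x, True)]"
  using rw_wv[of "[(x, True)]"] by (simp add: reduced_word_Cons lval_def X_carrier)

lemma hnn_length_generator:
  assumes "x \<in> X"
  shows "hnn_length t x = indicator {t} x"
proof -
  have "rw (x \<otimes> x) = [(x, True), (x, True)]"
    using rw_lval_mult[of x "(x, True)"] assms by (simp add: lval_def X_carrier rw_generator lcons_def linv_def)
  then show ?thesis using assms by (simp add: hnn_length_def X_carrier gnorm_def rw_generator)
qed

lemma hnn_length_transvection:
  assumes "y \<in> X" "fst b \<in> X" "fst b \<noteq> y" "fst b \<noteq> t" "g \<in> carrier F"
  shows "hnn_length t (transvection y b g) = hnn_length t g"
proof -
  have "transvection y b g \<otimes> transvection y b g = transvection y b (g \<otimes> g)"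
    using hom_mult[OF transvection_hom] assms by simp
  then show ?thesis
    using assms by (simp add: hnn_length_def transvection_closed gnorm_transvection)
qed

text \<open>\<open>out_act\<close> lets all representatives act on all members of the class. Each
  representative is a transvection followed by a conjugation and fixes every multiple of
  \<open>hnn_length t\<close>; since the coset is nonempty, the image is the whole class.\<close>

lemma transvection_fixes_hnn_class:
  assumes b: "y \<in> X" "fst b \<in> X" "fst b \<noteq> y" "fst b \<noteq> t"
  shows "out_act (act_length F) (inner_auts F #>\<^bsub>AutoGroup F\<^esub> transvection y b) (fun_class F (hnn_length t)) =
    fun_class F (hnn_length t)"
proof -
  let ?\<Phi> = "inner_auts F #>\<^bsub>AutoGroup F\<^esub> transvection y b"
  have tr: "transvection y b \<in> auto F" using transvection_auto b by blast
  have stable: "act_length F \<phi> (\<lambda>g\<in>carrier F. c * hnn_length t g) = (\<lambda>g\<in>carrier F. c * hnn_length t g)"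
    if \<phi>: "\<phi> \<in> ?\<Phi>" for \<phi> c
  proof -
    obtain a where a: "a \<in> carrier F" "\<phi> = conjugation a \<otimes>\<^bsub>AutoGroup F\<^esub> transvection y b"
      using \<phi> unfolding r_coset_def inner_auts_def conjugation_def by blast
    have eq: "\<phi> = compose (carrier F) (conjugation a) (transvection y b)"
      unfolding a(2) by (rule mult_AutoGroup[OF conjugation_auto[OF a(1)] tr])
    interpret A: group "AutoGroup F" by (rule AutoGroup)
    have "\<phi> \<in> auto F"
      using A.m_closed[of "conjugation a" "transvection y b"] conjugation_auto[OF a(1)] tr a(2) by (simp add: carrier_AutoGroup)
    then show ?thesis
      using a(1) b eq by (intro act_length_invariant)
        (simp_all add: compose_def conjugation_def transvection_closed hnn_length_conjugation hnn_length_transvection)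
  qed
  have "\<one>\<^bsub>AutoGroup F\<^esub> \<in> inner_auts F"
    using inner_auts_normal normal_imp_subgroup subgroup.one_closed by blast
  then have ne: "?\<Phi> \<noteq> {}" unfolding r_coset_def by blast
  show ?thesis
  proof (intro equalityI subsetI)
    fix l assume "l \<in> out_act (act_length F) ?\<Phi> (fun_class F (hnn_length t))"
    then show "l \<in> fun_class F (hnn_length t)"
      using stable unfolding out_act_def fun_class_def by blast
  next
    fix l assume l: "l \<in> fun_class F (hnn_length t)"
    obtain \<phi> where "\<phi> \<in> ?\<Phi>" using ne by blast
    moreover have "act_length F \<phi> l = l" using stable[OF \<open>\<phi> \<in> ?\<Phi>\<close>] l unfolding fun_class_def by auto
    ultimately show "l \<in> out_act (act_length F) ?\<Phi> (fun_class F (hnn_length t))"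
      using l unfolding out_act_def by force
  qed
qed

text \<open>Meant for the anti-equivariant case, where the inverse has to be taken in
  \<open>Out F\<close>.\<close>

lemma inv_Out_transvection:
  assumes b: "y \<in> X" "fst b \<in> X" "fst b \<noteq> y"
  shows "inv\<^bsub>Out F\<^esub> (inner_auts F #>\<^bsub>AutoGroup F\<^esub> transvection y (linv b)) = inner_auts F #>\<^bsub>AutoGroup F\<^esub> transvection y b"
proof -
  interpret A: group "AutoGroup F" by (rule AutoGroup)
  interpret N: normal "inner_auts F" "AutoGroup F" by (rule inner_auts_normal)
  have tr: "transvection y b \<in> auto F" "transvection y (linv b) \<in> auto F"
    using transvection_auto[of y b] transvection_auto[of y "linv b"] b by auto
  have "transvection y b \<otimes>\<^bsub>AutoGroup F\<^esub> transvection y (linv b) = \<one>\<^bsub>AutoGroup F\<^esub>"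
    using transvection_inverse'[OF b] by (auto simp: mult_AutoGroup[OF tr] one_AutoGroup compose_def fun_eq_iff)
  then have "inv\<^bsub>AutoGroup F\<^esub> transvection y (linv b) = transvection y b"
    using tr by (intro A.inv_equality) (auto simp: carrier_AutoGroup)
  moreover have "inner_auts F #>\<^bsub>AutoGroup F\<^esub> transvection y (linv b) \<in> carrier (AutoGroup F Mod inner_auts F)"
    using tr by (auto simp: carrier_FactGroup carrier_AutoGroup)
  ultimately show ?thesis
    using tr by (simp add: Out_def N.inv_FactGroup N.rcos_inv carrier_AutoGroup)
qed

lemma hnn_class_in_boundary:
  assumes t: "t \<in> X" and a: "a \<in> X" "a \<noteq> t"
  shows "fun_class F (hnn_length t) \<in> topspace (boundary_CV F)"
proof -
  let ?P = "powertop_real (carrier F)"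
  let ?S = "{l :: 'a \<Rightarrow> real. \<exists>g\<in>carrier F. l g \<noteq> 0}"
  \<comment> \<open>Every letter has positive weight, so each \<open>l n\<close> lies in
    \<open>cv F\<close>, while in the limit only \<open>t\<close> keeps its length.\<close>
  define L where "L n x = (indicator {t} x + inverse (real (Suc n)) :: real)" for n x
  define l where "l n = (\<lambda>g\<in>carrier F. gnorm (L n) (g \<otimes> g) - gnorm (L n) g)" for n
  have l_cv: "l n \<in> cv F" for n
    unfolding l_def by (rule gnorm_mem_cv[of "inverse (real (Suc n))"]) (auto simp: L_def)
  have l_S: "l n \<in> ?S" for n
  proof -
    have "l n t > 0" by (rule cv_pos[OF l_cv X_carrier[OF t]]) (use t rw_generator[OF t] rw_one in force)
    then show ?thesis using X_carrier[OF t] by force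
  qed
  have wt_lim: "(\<lambda>n. wt (L n) w) \<longlonglongrightarrow> wt (indicator {t}) w" for w
  proof (induction w)
    case (Cons m w)
    have "(\<lambda>n. L n (fst m)) \<longlonglongrightarrow> indicator {t} (fst m) + 0"
      unfolding L_def by (intro tendsto_intros LIMSEQ_inverse_real_of_nat)
    then show ?case using Cons by (auto intro: tendsto_add)
  qed simp
  have l_lim: "limitin ?P l (hnn_length t) sequentially"
    unfolding limitin_componentwise
  proof (intro conjI ballI)
    fix g assume g: "g \<in> carrier F"
    have "(\<lambda>n. gnorm (L n) (g \<otimes> g) - gnorm (L n) g) \<longlonglongrightarrow> hnn_length t g"
      using g wt_lim by (auto simp: hnn_length_def gnorm_def intro: tendsto_diff)
    then show "limitin euclideanreal (\<lambda>n. l n g) (hnn_length t g) sequentially"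
      using g by (simp add: l_def)
  qed (auto simp: hnn_length_def l_def)
  have h_top: "hnn_length t \<in> topspace (subtopology ?P ?S)"
    using hnn_length_generator[OF t, of t] X_carrier[OF t] by (force simp: hnn_length_def)
  have top: "fun_class F (hnn_length t) \<in> topspace (PR F)"
    unfolding PR_def using h_top by simp
  have "fun_class F (hnn_length t) \<in> PR F closure_of CV F"
    unfolding in_closure_of
  proof (intro conjI allI impI top; elim conjE)
    \<comment> \<open>Convergence before projectivization is enough, since open sets of the quotient
      pull back to open sets of functions.\<close>
    fix U assume U: "fun_class F (hnn_length t) \<in> U" "openin (PR F) U"
    then have "openin (subtopology ?P ?S) {l \<in> topspace (subtopology ?P ?S). fun_class F l \<in> U}"
      unfolding PR_def openin_quotient_topology by simp
    then obtain W where W: "openin ?P W" "{l \<in> topspace (subtopology ?P ?S). fun_class F l \<in> U} = W \<inter> ?S"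
      unfolding openin_subtopology by blast
    have "hnn_length t \<in> W" using W(2) h_top U(1) by blast
    then have "\<forall>\<^sub>F n in sequentially. l n \<in> W" using l_lim W(1) unfolding limitin_def by blast
    then obtain n where "l n \<in> W" by (auto simp: eventually_sequentially)
    then have "fun_class F (l n) \<in> U" using W(2) l_S by blast
    then show "\<exists>y. y \<in> CV F \<and> y \<in> U" using l_cv unfolding CV_def by blast
  qed
  moreover have "fun_class F (hnn_length t) \<notin> CV F"
  proof
    assume "fun_class F (hnn_length t) \<in> CV F"
    then obtain l' where l': "l' \<in> cv F" "fun_class F (hnn_length t) = fun_class F l'" unfolding CV_def by blast
    have "hnn_length t \<in> fun_class F (hnn_length t)"
      unfolding fun_class_def by (rule CollectI, rule exI[of _ 1]) (auto simp: hnn_length_def)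
    then have "hnn_length t \<in> fun_class F l'" by (simp only: l'(2))
    then obtain c where c: "c \<noteq> 0" "hnn_length t = (\<lambda>g\<in>carrier F. c * l' g)" by (auto simp: fun_class_def)
    \<comment> \<open>The second generator \<open>a\<close> separates the class from
      \<open>CV F\<close>: \<open>hnn_length t\<close> vanishes there, whereas a free action gives a
      positive length.\<close>
    have "l' a > 0" by (rule cv_pos[OF l'(1) X_carrier[OF a(1)]]) (use rw_generator[OF a(1)] rw_one in force)
    moreover have "c * l' a = 0" using hnn_length_generator[OF a(1), of t] c(2) a X_carrier[OF a(1)] by simp
    ultimately show False using c(1) by simp
  qed
  ultimately show ?thesis using top by (simp add: boundary_CV_def)
qed

text \<open>A transvection lies in its own coset, so invariance of the class means that it
  multiplies \<nu> by a positive factor. The bound 4 leaves two generators besides \<open>y\<close>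
  and \<open>t\<close>, as required by \<open>current_edge_zero\<close>.\<close>

lemma no_transvection_invariant_class:
  assumes t: "t \<in> X" and card: "card X \<ge> 4" and C: "C \<in> topspace (PCurr F X)"
    and stable: "\<And>y b. y \<in> X \<Longrightarrow> b \<in> X \<Longrightarrow> b \<noteq> y \<Longrightarrow> b \<noteq> t \<Longrightarrow>
      out_act (act_current F X) (inner_auts F #>\<^bsub>AutoGroup F\<^esub> transvection y (b, True)) C = C"
  shows False
proof -
  obtain \<nu> where \<nu>: "\<nu> \<in> currents F X" "emeasure \<nu> (space \<nu>) \<noteq> 0" "C = current_class \<nu>"
    using C unfolding PCurr_def Curr_def by (auto simp: topspace_pullback_topology)
  have inv: "\<exists>r>0. act_current F X (transvection y (b, True)) \<nu> = scale_measure (ennreal r) \<nu>"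
    if yb: "y \<in> X" "b \<in> X" "b \<noteq> y" "b \<noteq> t" for y b
  proof -
    interpret A: group "AutoGroup F" by (rule AutoGroup)
    have tr: "transvection y (b, True) \<in> auto F" using transvection_auto[of y "(b, True)"] yb by simp
    have "\<one>\<^bsub>AutoGroup F\<^esub> \<in> inner_auts F"
      using inner_auts_normal normal_imp_subgroup subgroup.one_closed by blast
    then have "transvection y (b, True) \<in> inner_auts F #>\<^bsub>AutoGroup F\<^esub> transvection y (b, True)"
      unfolding r_coset_def using A.l_one tr by (force simp: carrier_AutoGroup)
    moreover have "\<nu> \<in> C" unfolding \<nu>(3) current_class_def by (rule CollectI, rule exI[of _ 1]) simp
    ultimately have "act_current F X (transvection y (b, True)) \<nu> \<in> C"
      using stable[OF yb] unfolding out_act_def by blast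
    then show ?thesis unfolding \<nu>(3) current_class_def by blast
  qed
  have "emeasure \<nu> (edge_pairs y [(y, True)]) = 0" if y: "y \<in> X" for y
  proof -
    have "card (X - {y, t}) \<ge> 2"
      using card finite_X card_Diff_subset[of "{y, t}" X] y t card_insert_le_m1[of 2 "{t}" y] by simp
    then obtain T where "T \<subseteq> X - {y, t}" "card T = 2" by (meson obtain_subset_with_card_n)
    then obtain b c where "b \<in> X - {y, t}" "c \<in> X - {y, t}" "b \<noteq> c" by (auto simp: card_2_iff)
    then show ?thesis using current_edge_zero[OF \<nu>(1) y, of b c] inv[OF y] by blast
  qed
  then show False using current_zero_if_edges_zero[OF \<nu>(1)] \<nu>(2) by blast
qed

end

theorem theorem1:
  fixes F :: "('a, 'b) monoid_scheme" and X :: "'a set" and k :: nat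
  assumes "free_basis F X" and "finite X" and "card X = k" and "k \<ge> 5"
  shows "\<not> (\<exists>\<tau>. continuous_map (boundary_CV F) (PCurr F X) \<tau> \<and>
            equivariant_on (Out F) (topspace (boundary_CV F))
              (out_act (act_length F)) (out_act (act_current F X)) \<tau>) \<and>
         \<not> (\<exists>\<tau>. continuous_map (boundary_CV F) (PCurr F X) \<tau> \<and>
            anti_equivariant_on (Out F) (topspace (boundary_CV F))
              (out_act (act_length F)) (out_act (act_current F X)) \<tau>)"
proof -
  have ne: "X \<noteq> {}" using assms(3,4) by auto
  interpret fin_free_group F X
    by (intro fin_free_group.intro free_group.intro fin_free_group_axioms.intro assms(1,2) ne)
  obtain t where t: "t \<in> X" using ne by blast
  have "X \<noteq> {t}" using assms(3,4) by auto
  then obtain a where a: "a \<in> X" "a \<noteq> t" using t by blast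
  let ?x = "fun_class F (hnn_length t)"
  let ?\<Phi> = "\<lambda>y b. inner_auts F #>\<^bsub>AutoGroup F\<^esub> transvection y b"
  have x: "?x \<in> topspace (boundary_CV F)" by (rule hnn_class_in_boundary[OF t a])
  have Out: "?\<Phi> y b \<in> carrier (Out F)" if "y \<in> X" "fst b \<in> X" "fst b \<noteq> y" for y b
    using transvection_auto[OF that] by (simp add: Out_def carrier_FactGroup carrier_AutoGroup)
  have card: "card X \<ge> 4" using assms(3,4) by simp
  show ?thesis
  proof (intro conjI notI; elim exE conjE)
    fix \<tau>
    assume \<tau>: "continuous_map (boundary_CV F) (PCurr F X) \<tau>"
      and eq: "equivariant_on (Out F) (topspace (boundary_CV F))
          (out_act (act_length F)) (out_act (act_current F X)) \<tau>"
    show False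
    proof (rule no_transvection_invariant_class[OF t card, of "\<tau> ?x"])
      show "\<tau> ?x \<in> topspace (PCurr F X)" using continuous_map_funspace[OF \<tau>] x by blast
      fix y b assume "y \<in> X" "b \<in> X" "b \<noteq> y" "b \<noteq> t"
      then show "out_act (act_current F X) (?\<Phi> y (b, True)) (\<tau> ?x) = \<tau> ?x"
        using eq Out[of y "(b, True)"] x transvection_fixes_hnn_class[of y "(b, True)" t]
        unfolding equivariant_on_def by fastforce
    qed
  next
    fix \<tau>
    assume \<tau>: "continuous_map (boundary_CV F) (PCurr F X) \<tau>"
      and eq: "anti_equivariant_on (Out F) (topspace (boundary_CV F))
          (out_act (act_length F)) (out_act (act_current F X)) \<tau>"
    show False
    proof (rule no_transvection_invariant_class[OF t card, of "\<tau> ?x"])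
      show "\<tau> ?x \<in> topspace (PCurr F X)" using continuous_map_funspace[OF \<tau>] x by blast
      fix y b assume "y \<in> X" "b \<in> X" "b \<noteq> y" "b \<noteq> t"
      \<comment> \<open>The hypothesis is applied to the class of the inverse transvection, which
        also fixes \<open>?x\<close>; its inverse in \<open>Out F\<close> is the class that is
        wanted.\<close>
      then show "out_act (act_current F X) (?\<Phi> y (b, True)) (\<tau> ?x) = \<tau> ?x"
        using eq Out[of y "linv (b, True)"] x transvection_fixes_hnn_class[of y "linv (b, True)" t]
          inv_Out_transvection[of y "(b, True)"]
        unfolding anti_equivariant_on_def by fastforce
    qed
  qed
qed

end
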